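(* Let $\mathcal{C}:\mathbb{R}^m\to[0,\infty)$ be a multi-material transportation cost that is admissible in $\mathbb{R}^n$, with associated energy $\mathbb{E}$. Let $\mu^-,\mu^+\in\mathscr{M}(\mathbb{R}^n,\mathbb{R}^m)$ be a pair of compatible measures with compact support. Then there exists a multi-material flux $T$ between $\mu^-$ and $\mu^+$ with $\mathbb{E}(T)<\infty$.
   Context: Throughout $n\ge 2$, $m\ge 1$. $\mathscr{M}(\mathbb{R}^n,V)$ denotes the space of (Radon) measures on $\mathbb{R}^n$ with values in the normed space $V$. Partial order on $\mathbb{R}^m$: $\eta\preceq\theta$ iff $\mathrm{sign}(\eta_j)\,\mathrm{sign}(\theta_j)\ge 0$ and $|\eta_j|\le|\theta_j|$ for every $j$. A multi-material transportation cost is a function $\mathcal{C}:\mathbb{R}^m\to[0,\infty)$ such that: (i) $\mathcal{C}$ is even and $\mathcal{C}(\theta)=0$ iff $\theta=0$; (ii) $\mathcal{C}$ is lower semi-continuous; (iii) $\mathcal{C}(\eta+\theta)\le\mathcal{C}(\eta)+\mathcal{C}(\theta)$; (iv) $\mathcal{C}(\eta)\le\mathcal{C}(\theta)$ whenever $\eta\preceq\theta$. It is admissible in $\mathbb{R}^n$ if there is a concave, non-decreasing function $\beta:[0,\infty)\to[0,\infty)$ with $\mathcal{C}(x,\dots,x)\le\beta(x)$ for every $x\in[0,\infty)$ and $\int_0^1\beta(x)\,x^{-(2-\frac1n)}\,dx<+\infty$. Compactly supported $\mu^-,\mu^+\in\mathscr{M}(\mathbb{R}^n,\mathbb{R}^m)$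 are compatible if $\mu^-(v)=\mu^+(v)$ for every constant vector field $v:\mathbb{R}^n\to\mathbb{R}^m$. For $T\in\mathscr{M}(\mathbb{R}^n,\mathbb{R}^{n\times m})$, $\mathrm{div}\,T(\phi)=-T(D\phi)$ for $\phi\in C_c^\infty(\mathbb{R}^n,(\mathbb{R}^m)^* )$. A multi-material flux between $\mu^-$ and $\mu^+$ is a compactly supported $T\in\mathscr{M}(\mathbb{R}^n,\mathbb{R}^{n\times m})$ with $\mathrm{div}\,T=\mu^--\mu^+$. Currents. A $k$-current with coefficients in $\mathbb{R}^m$ is an $m$-tuple $T=(T_1,\dots,T_m)$ of classical $k$-currents in $\mathbb{R}^n$ acting on $m$-tuples $\omega=(\omega_1,\dots,\omega_m)$ of smooth compactly supported $k$-forms by $T(\omega)=\sum_jT_j(\omega_j)$; $\partial T=(\partial T_1,\dots,\partial T_m)$; its mass $\mathbb{M}(T)$ is $\sup|T(\omega)|$ over $\omega$ with $|(\langle\omega_1(x),\tau\rangle,\dots,\langle\omega_m(x),\tau\rangle)|\le 1$ for all $x$ and all simple $k$-vectors $\tau$ with $|\tau|\le 1$. A measure $T\in\mathscr{M}(\mathbb{R}^n,\mathbb{R}^{n\times m})$ is identified with the 1-current whose components are its $m$ columns. A polyhedral $k$-current with coefficients in $\mathbb{R}^m$ is a finite sum $P=\sum_{\ell=1}^N(\tau_\ell\otimes\theta_\ell)\,\mathcal{H}^k\llcorner\sigma_\ell$, where the $\sigma_\ell$ are $k$-simplexes with disjoint relative interiors, $\tau_\ell$ is a unit simple $k$-vector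 orienting $\sigma_\ell$, $\theta_\ell\in\mathbb{R}^m$ (acting by $P(\omega)=\sum_\ell\int_{\sigma_\ell}\sum_j(\theta_\ell)_j\langle\omega_j,\tau_\ell\rangle\,d\mathcal{H}^k$). For polyhedral $P$ the flat norm is $\mathbb{F}(P)=\inf\{\mathbb{M}(R)+\mathbb{M}(S): P=R+\partial S\}$, with $R,S$ polyhedral of dimension $k$ and $k+1$. Flat $k$-currents are the completion of polyhedral $k$-currents under $\mathbb{F}$, realized inside the space of currents, and $\mathbb{F}$ is extended to them; every multi-material flux is a flat 1-current. Energy. A discrete multi-material flux is a polyhedral 1-current $T=\sum_\ell(\tau_\ell\otimes\theta_\ell)\mathcal{H}^1\llcorner\sigma_\ell$ with coefficients in $\mathbb{R}^m$; its energy is $\mathbb{E}(T)=\sum_\ell\mathcal{C}(\theta_\ell)\mathcal{H}^1(\sigma_\ell)$. For a general multi-material flux $T$, $$\mathbb{E}(T):=\inf\{\liminf_h\mathbb{E}(T_h):\ \mathbb{F}(T_h-T)\to 0\}\in[0,+\infty],$$ the infimum being over sequences $(T_h)$ of discrete multi-material fluxes all supported on a common compact set. *)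

theory Defs
  imports "HOL-Analysis.Analysis" "HOL-Combinatorics.Permutations"
begin

section \<open>Transportation costs\<close>

definition cost_le :: "real ^ 'm \<Rightarrow> real ^ 'm \<Rightarrow> bool" where
  "cost_le \<eta> \<theta> \<longleftrightarrow> (\<forall>j. sgn (\<eta> $ j) * sgn (\<theta> $ j) \<ge> 0 \<and> \<bar>\<eta> $ j\<bar> \<le> \<bar>\<theta> $ j\<bar>)"

definition lower_semicontinuous :: "('a::topological_space \<Rightarrow> real) \<Rightarrow> bool" where
  "lower_semicontinuous f \<longleftrightarrow> (\<forall>x a. a < f x \<longrightarrow> (\<forall>\<^sub>F y in nhds x. a < f y))"

definition transportation_cost :: "(real ^ 'm \<Rightarrow> real) \<Rightarrow> bool" where
  "transportation_cost C \<longleftrightarrow>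
     (\<forall>\<theta>. 0 \<le> C \<theta>) \<and>
     (\<forall>\<theta>. C (- \<theta>) = C \<theta>) \<and>
     (\<forall>\<theta>. C \<theta> = 0 \<longleftrightarrow> \<theta> = 0) \<and>
     lower_semicontinuous C \<and>
     (\<forall>\<eta> \<theta>. C (\<eta> + \<theta>) \<le> C \<eta> + C \<theta>) \<and>
     (\<forall>\<eta> \<theta>. cost_le \<eta> \<theta> \<longrightarrow> C \<eta> \<le> C \<theta>)"

definition admissible_cost :: "nat \<Rightarrow> (real ^ 'm \<Rightarrow> real) \<Rightarrow> bool" where
  "admissible_cost n C \<longleftrightarrow>
     (\<exists>\<beta>::real \<Rightarrow> real.
        concave_on {0..} \<beta> \<and> mono_on {0..} \<beta> \<and> (\<forall>x\<ge>0. 0 \<le> \<beta> x) \<and>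
        (\<forall>x\<ge>0. C (\<chi> j. x) \<le> \<beta> x) \<and>
        (\<integral>\<^sup>+x\<in>{0<..<1}. ennreal (\<beta> x * x powr (- (2 - 1 / real n))) \<partial>lborel) < \<infinity>)"


section \<open>Compactly supported vector measures\<close>

text \<open>
  Only compactly supported measures occur below. A compactly supported Radon measure is finite, so it
  is a countably additive function on all Borel sets, and conversely every such function with values
  in a finite-dimensional space has finite total variation and is regular. Values on non-Borel sets
  are irrelevant.
\<close>

definition vector_measure :: "('a::topological_space set \<Rightarrow> 'v::real_normed_vector) \<Rightarrow> bool" where
  "vector_measure \<mu> \<longleftrightarrow>
     (\<forall>A::nat \<Rightarrow> 'a set. range A \<subseteq> sets borel \<longrightarrow> disjoint_family A \<longrightarrow>
        (\<lambda>i. \<mu> (A i)) sums \<mu> (\<Union>i. A i))"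

definition vm_support :: "('a::topological_space set \<Rightarrow> 'v::zero) \<Rightarrow> 'a set" where
  "vm_support \<mu> = - \<Union>{U. open U \<and> (\<forall>A\<in>sets borel. A \<subseteq> U \<longrightarrow> \<mu> A = 0)}"

text \<open>Positive part of the Jordan decomposition; the negative part is that of \<open>- \<nu>\<close>.\<close>

definition jordan_pos :: "('a::topological_space set \<Rightarrow> real) \<Rightarrow> 'a measure" where
  "jordan_pos \<nu> =
     measure_of UNIV (sets borel) (\<lambda>A. SUP B\<in>{B \<in> sets borel. B \<subseteq> A}. ennreal (\<nu> B))"

definition signed_integral :: "('a::topological_space set \<Rightarrow> real) \<Rightarrow> ('a \<Rightarrow> real) \<Rightarrow> real" where
  "signed_integral \<nu> f =
     integral\<^sup>L (jordan_pos \<nu>) f - integral\<^sup>L (jordan_pos (\<lambda>A. - \<nu> A)) f"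

text \<open>
  The action \<open>\<mu>(\<phi>) = \<integral> \<langle>\<phi>, d\<mu>\<rangle>\<close>; the dual of the value space is identified with the space itself
  through the inner product.
\<close>

definition vm_integral ::
    "('a::topological_space set \<Rightarrow> 'v::euclidean_space) \<Rightarrow> ('a \<Rightarrow> 'v) \<Rightarrow> real" where
  "vm_integral \<mu> \<phi> = (\<Sum>b\<in>Basis. signed_integral (\<lambda>A. \<mu> A \<bullet> b) (\<lambda>x. \<phi> x \<bullet> b))"

definition compatible ::
    "((real ^ 'n) set \<Rightarrow> real ^ 'm) \<Rightarrow> ((real ^ 'n) set \<Rightarrow> real ^ 'm) \<Rightarrow> bool" where
  "compatible \<mu>m \<mu>p \<longleftrightarrow> (\<forall>v. vm_integral \<mu>m (\<lambda>x. v) = vm_integral \<mu>p (\<lambda>x. v))"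


section \<open>Smooth maps and multi-material fluxes\<close>

primrec C_diff :: "nat \<Rightarrow> ('a::euclidean_space \<Rightarrow> 'b::real_normed_vector) \<Rightarrow> bool" where
  "C_diff 0 f \<longleftrightarrow> continuous_on UNIV f"
| "C_diff (Suc r) f \<longleftrightarrow>
     (\<forall>x. f differentiable at x) \<and> (\<forall>v. C_diff r (\<lambda>x. frechet_derivative f (at x) v))"

definition smooth :: "('a::euclidean_space \<Rightarrow> 'b::real_normed_vector) \<Rightarrow> bool" where
  "smooth f \<longleftrightarrow> (\<forall>r. C_diff r f)"

text \<open>Elements of \<open>\<real>\<^sup>n\<^sup>\<times>\<^sup>m\<close> have type \<open>real ^ 'm ^ 'n\<close>: row index in \<open>'n\<close>, column index in \<open>'m\<close>.\<close>

definition jacobian :: "(real ^ 'n \<Rightarrow> real ^ 'm) \<Rightarrow> real ^ 'n \<Rightarrow> real ^ 'm ^ 'n" where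
  "jacobian \<phi> x = (\<chi> i j. frechet_derivative \<phi> (at x) (axis i 1) $ j)"

definition divergence ::
    "((real ^ 'n) set \<Rightarrow> real ^ 'm ^ 'n) \<Rightarrow> (real ^ 'n \<Rightarrow> real ^ 'm) \<Rightarrow> real" where
  "divergence T \<phi> = - vm_integral T (jacobian \<phi>)"

definition multi_material_flux ::
    "((real ^ 'n) set \<Rightarrow> real ^ 'm) \<Rightarrow> ((real ^ 'n) set \<Rightarrow> real ^ 'm) \<Rightarrow>
     ((real ^ 'n) set \<Rightarrow> real ^ 'm ^ 'n) \<Rightarrow> bool" where
  "multi_material_flux \<mu>m \<mu>p T \<longleftrightarrow>
     vector_measure T \<and> compact (vm_support T) \<and>
     (\<forall>\<phi>. smooth \<phi> \<and> compact (closure {x. \<phi> x \<noteq> 0}) \<longrightarrow>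
        divergence T \<phi> = vm_integral \<mu>m \<phi> - vm_integral \<mu>p \<phi>)"


section \<open>Differential forms\<close>

text \<open>
  A simple \<open>k\<close>-vector \<open>v\<^sub>0 \<and> \<dots> \<and> v\<^sub>k\<^sub>-\<^sub>1\<close> is represented by a sequence \<open>v\<close> of which only the entries
  \<open>v i\<close> with \<open>i < k\<close> matter, and a \<open>k\<close>-covector by an alternating \<open>k\<close>-linear function of such
  sequences, so that the pairing of the two is function application.
\<close>

definition covector :: "nat \<Rightarrow> ((nat \<Rightarrow> real ^ 'n) \<Rightarrow> real) \<Rightarrow> bool" where
  "covector k a \<longleftrightarrow>
     (\<forall>v w. (\<forall>i<k. v i = w i) \<longrightarrow> a v = a w) \<and>
     (\<forall>v. \<forall>i<k. linear (\<lambda>u. a (v(i := u)))) \<and>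
     (\<forall>v. \<forall>i<k. \<forall>j<k. i \<noteq> j \<and> v i = v j \<longrightarrow> a v = 0)"

text \<open>Euclidean norm of \<open>v\<^sub>0 \<and> \<dots> \<and> v\<^sub>k\<^sub>-\<^sub>1\<close>, i.e. the root of the Gram determinant.\<close>

definition simple_vec_norm :: "nat \<Rightarrow> (nat \<Rightarrow> real ^ 'n) \<Rightarrow> real" where
  "simple_vec_norm k v =
     sqrt (\<Sum>p | p permutes {..<k}. of_int (sign p) * (\<Prod>i<k. v i \<bullet> v (p i)))"

type_synonym 'n form = "real ^ 'n \<Rightarrow> (nat \<Rightarrow> real ^ 'n) \<Rightarrow> real"

definition form_support :: "'n::finite form \<Rightarrow> (real ^ 'n) set" where
  "form_support \<omega> = closure {x. \<exists>v. \<omega> x v \<noteq> 0}"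

definition test_form :: "nat \<Rightarrow> 'n::finite form \<Rightarrow> bool" where
  "test_form k \<omega> \<longleftrightarrow>
     (\<forall>x. covector k (\<omega> x)) \<and> (\<forall>v. smooth (\<lambda>x. \<omega> x v)) \<and> compact (form_support \<omega>)"

text \<open>
  \<open>\<langle>d\<omega>(x), v\<^sub>0 \<and> \<dots> \<and> v\<^sub>k\<rangle> = \<Sum>\<^sub>i (-1)\<^sup>i \<langle>D\<omega>(x)[v\<^sub>i], v\<^sub>0 \<and> \<dots> v\<^sub>i\<^sub>-\<^sub>1 \<and> v\<^sub>i\<^sub>+\<^sub>1 \<dots> \<and> v\<^sub>k\<rangle>\<close>
\<close>

definition ext_deriv :: "nat \<Rightarrow> 'n::finite form \<Rightarrow> 'n form" where
  "ext_deriv k \<omega> x v =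
     (\<Sum>i\<le>k. (-1) ^ i *
        frechet_derivative (\<lambda>y. \<omega> y (\<lambda>j. if j < i then v j else v (Suc j))) (at x) (v i))"


section \<open>Currents\<close>

text \<open>
  The components of an \<open>m\<close>-tuple of \<open>k\<close>-currents are functionals of which only the values on
  \<open>k\<close>-forms satisfying \<open>test_form k\<close> matter. The currents used below are built from polyhedral
  currents and finite measures, so linearity and continuity need not be imposed separately.
\<close>

type_synonym ('n, 'm) current = "'m \<Rightarrow> 'n form \<Rightarrow> real"

definition current_minus ::
    "('n::finite, 'm::finite) current \<Rightarrow> ('n, 'm) current \<Rightarrow> ('n, 'm) current" where
  "current_minus P Q = (\<lambda>j \<omega>. P j \<omega> - Q j \<omega>)"

text \<open>\<open>boundary k\<close> maps \<open>(k+1)\<close>-currents to \<open>k\<close>-currents.\<close>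

definition boundary :: "nat \<Rightarrow> ('n::finite, 'm::finite) current \<Rightarrow> ('n, 'm) current" where
  "boundary k S = (\<lambda>j \<omega>. S j (ext_deriv k \<omega>))"

definition current_apply ::
    "('n::finite, 'm::finite) current \<Rightarrow> ('m \<Rightarrow> 'n form) \<Rightarrow> real" where
  "current_apply T \<omega> = (\<Sum>j\<in>UNIV. T j (\<omega> j))"

definition current_support :: "nat \<Rightarrow> ('n::finite, 'm::finite) current \<Rightarrow> (real ^ 'n) set" where
  "current_support k T =
     - \<Union>{U. open U \<and> (\<forall>\<omega>. (\<forall>j. test_form k (\<omega> j) \<and> form_support (\<omega> j) \<subseteq> U) \<longrightarrow>
                          current_apply T \<omega> = 0)}"

definition mass :: "nat \<Rightarrow> ('n::finite, 'm::finite) current \<Rightarrow> ennreal" where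
  "mass k T =
     (SUP \<omega>\<in>{\<omega>. (\<forall>j. test_form k (\<omega> j)) \<and>
                  (\<forall>x v. simple_vec_norm k v \<le> 1 \<longrightarrow> norm (\<chi> j. \<omega> j x v) \<le> 1)}.
        ennreal \<bar>current_apply T \<omega>\<bar>)"

text \<open>The \<open>j\<close>-th component of the 1-current given by a matrix-valued measure is its \<open>j\<close>-th column.\<close>

definition measure_current ::
    "((real ^ 'n) set \<Rightarrow> real ^ 'm ^ 'n) \<Rightarrow> ('n::finite, 'm::finite) current" where
  "measure_current T =
     (\<lambda>j \<omega>. vm_integral (\<lambda>A. column j (T A)) (\<lambda>x. \<chi> i. \<omega> x (\<lambda>_. axis i 1)))"


section \<open>Hausdorff measure\<close>

text \<open>
  The case distinction gives empty covering sets weight 0 also for \<open>k = 0\<close>. Boundedness of the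
  covering sets is required because \<open>diameter\<close> is unspecified on unbounded sets.
\<close>

definition hausdorff_weight :: "nat \<Rightarrow> 'a::metric_space set \<Rightarrow> ennreal" where
  "hausdorff_weight k U =
     (if U = {} then 0 else ennreal (unit_ball_vol (real k) * (diameter U / 2) ^ k))"

definition hausdorff_pre :: "nat \<Rightarrow> real \<Rightarrow> 'a::metric_space set \<Rightarrow> ennreal" where
  "hausdorff_pre k \<delta> A =
     (INF U\<in>{U::nat \<Rightarrow> 'a set. A \<subseteq> (\<Union>i. U i) \<and> (\<forall>i. bounded (U i) \<and> diameter (U i) \<le> \<delta>)}.
        \<Sum>i. hausdorff_weight k (U i))"

definition hausdorff_outer :: "nat \<Rightarrow> 'a::metric_space set \<Rightarrow> ennreal" where
  "hausdorff_outer k A = (SUP \<delta>\<in>{0<..}. hausdorff_pre k \<delta> A)"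

definition hausdorff_measure :: "nat \<Rightarrow> 'a::metric_space measure" where
  "hausdorff_measure k = measure_of UNIV (sets borel) (hausdorff_outer k)"


section \<open>Polyhedral currents\<close>

text \<open>A triple \<open>(\<sigma>, \<tau>, \<theta>)\<close> stands for \<open>(\<tau> \<otimes> \<theta>) H\<^sup>k \<llcorner> \<sigma>\<close>.\<close>

type_synonym ('n, 'm) piece = "(real ^ 'n) set \<times> (nat \<Rightarrow> real ^ 'n) \<times> (real ^ 'm)"

definition orients :: "nat \<Rightarrow> (nat \<Rightarrow> real ^ 'n) \<Rightarrow> (real ^ 'n) set \<Rightarrow> bool" where
  "orients k \<tau> \<sigma> \<longleftrightarrow>
     simple_vec_norm k \<tau> = 1 \<and> span (\<tau> ` {..<k}) = span {x - y | x y. x \<in> \<sigma> \<and> y \<in> \<sigma>}"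

definition polyhedral_data :: "nat \<Rightarrow> ('n::finite, 'm::finite) piece list \<Rightarrow> bool" where
  "polyhedral_data k Ps \<longleftrightarrow>
     (\<forall>(\<sigma>, \<tau>, \<theta>)\<in>set Ps. (int k) simplex \<sigma> \<and> orients k \<tau> \<sigma>) \<and>
     (\<forall>a<length Ps. \<forall>b<length Ps. a \<noteq> b \<longrightarrow>
        rel_interior (fst (Ps ! a)) \<inter> rel_interior (fst (Ps ! b)) = {})"

definition polyhedral_current ::
    "nat \<Rightarrow> ('n::finite, 'm::finite) piece list \<Rightarrow> ('n, 'm) current" where
  "polyhedral_current k Ps =
     (\<lambda>j \<omega>. \<Sum>(\<sigma>, \<tau>, \<theta>)\<leftarrow>Ps. LINT x:\<sigma>|hausdorff_measure k. \<theta> $ j * \<omega> x \<tau>)"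

definition polyhedral :: "nat \<Rightarrow> ('n::finite, 'm::finite) current \<Rightarrow> bool" where
  "polyhedral k P \<longleftrightarrow> (\<exists>Ps. polyhedral_data k Ps \<and> P = polyhedral_current k Ps)"


section \<open>Flat norm\<close>

text \<open>The flat norm of a polyhedral current.\<close>

definition poly_flat_norm :: "nat \<Rightarrow> ('n::finite, 'm::finite) current \<Rightarrow> ennreal" where
  "poly_flat_norm k P =
     Inf {mass k R + mass (Suc k) S | R S.
            polyhedral k R \<and> polyhedral (Suc k) S \<and>
            (\<forall>j \<omega>. test_form k \<omega> \<longrightarrow> P j \<omega> = R j \<omega> + boundary k S j \<omega>)}"

text \<open>
  A flat current is an element of the completion of the polyhedral currents, realized as the current
  to which a Cauchy sequence of polyhedral currents converges.
\<close>

definition flat_approx ::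
    "nat \<Rightarrow> (nat \<Rightarrow> ('n::finite, 'm::finite) current) \<Rightarrow> ('n, 'm) current \<Rightarrow> bool" where
  "flat_approx k P T \<longleftrightarrow>
     (\<forall>i. polyhedral k (P i)) \<and>
     (\<forall>e>0. \<exists>N. \<forall>a\<ge>N. \<forall>b\<ge>N. poly_flat_norm k (current_minus (P a) (P b)) < ennreal e) \<and>
     (\<forall>j \<omega>. test_form k \<omega> \<longrightarrow> (\<lambda>i. P i j \<omega>) \<longlonglongrightarrow> T j \<omega>)"

text \<open>
  The extension of the flat norm to flat currents. The limit \<open>L\<close> does not depend on the approximating
  sequence, since the completion embeds into the space of currents; hence the infimum is over a single
  value if \<open>T\<close> is flat. It is \<open>\<infinity>\<close> if \<open>T\<close> is not flat.
\<close>

definition flat_norm :: "nat \<Rightarrow> ('n::finite, 'm::finite) current \<Rightarrow> ennreal" where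
  "flat_norm k T = Inf {L. \<exists>P. flat_approx k P T \<and> (\<lambda>i. poly_flat_norm k (P i)) \<longlonglongrightarrow> L}"


section \<open>Energy\<close>

text \<open>
  The energy of a discrete flux does not depend on its presentation as a list of pieces, since
  \<open>C\<close> is even and vanishes at 0; so discrete fluxes are given by their list of pieces.
\<close>

definition discrete_energy ::
    "(real ^ 'm \<Rightarrow> real) \<Rightarrow> ('n::finite, 'm::finite) piece list \<Rightarrow> real" where
  "discrete_energy C Ps = (\<Sum>(\<sigma>, \<tau>, \<theta>)\<leftarrow>Ps. C \<theta> * measure (hausdorff_measure 1) \<sigma>)"

definition energy ::
    "(real ^ 'm \<Rightarrow> real) \<Rightarrow> ((real ^ 'n) set \<Rightarrow> real ^ 'm ^ 'n) \<Rightarrow> ennreal" where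
  "energy C T =
     Inf {liminf (\<lambda>h. ennreal (discrete_energy C (Ps h))) | Ps.
            (\<forall>h. polyhedral_data 1 (Ps h)) \<and>
            (\<exists>K. compact K \<and> (\<forall>h. current_support 1 (polyhedral_current 1 (Ps h)) \<subseteq> K)) \<and>
            (\<lambda>h. flat_norm 1 (current_minus (polyhedral_current 1 (Ps h)) (measure_current T)))
              \<longlonglongrightarrow> 0}"

end

theory Submission
  imports Defs
begin

text \<open>
  The measure \<open>\<rho> = \<mu>\<^sup>+ - \<mu>\<^sup>-\<close> is supported in a cube, which is bisected repeatedly, cycling through
  the coordinate directions; after \<open>t\<close> steps there are \<open>2\<^sup>t\<close> boxes of diameter comparable to
  \<open>2\<^bsup>-t/n\<^esup>\<close>. When a box is bisected, the mass of the half away from its lowest corner is moved from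
  the corner of the box to the corner of that half, along one segment parallel to an axis. The sum of
  all these segments converges in total variation, and testing it with \<open>D\<phi>\<close> telescopes to Riemann
  sums of \<open>\<integral> \<phi> d\<rho>\<close>, so it is a flux between \<open>\<mu>\<^sup>-\<close> and \<open>\<mu>\<^sup>+\<close>. By concavity of \<open>\<beta>\<close> the segments of
  step \<open>t\<close> cost at most a constant times \<open>2\<^sup>t \<beta>(M 2\<^bsup>-t\<^esup>) 2\<^bsup>-t/n\<^esup>\<close>, and the series of these numbers is
  dominated by the integral in the admissibility condition. The partial sums are discrete fluxes once
  their overlapping segments are cut into edges of a grid, where coefficients add up and \<open>C\<close> is
  subadditive; the flat distance to the limit is bounded by the mass of the remaining segments.
\<close>

section \<open>Hausdorff measure\<close>

text \<open>The exponent in the admissibility condition is the balance of this construction. Step t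
  has 2^t segments of length about 2^(-t/n), each carrying on average about 2^(-t) of the mass; with
  x = 2^(-t) its cost is beta(x) x^(-(1 - 1/n)), and a sum over dyadic x is an integral against
  dx/x, which gives beta(x) x^(-(2 - 1/n)). Halving one side at a time, instead of all n at once,
  keeps each transport on a single axis-parallel segment with dyadic endpoints. That matters because
  a polyhedral current needs pieces with disjoint relative interiors, while segments of different
  steps may leave the same corner in the same direction; on a dyadic grid such overlaps are unions
  of common edges. Only the half away from the corner is moved, so that the other half inherits the
  corner and the coefficients of one step are values of rho on disjoint boxes. Energy and polyhedral
  currents are written with a Hausdorff measure built from coverings, so it must first be shown to
  be a Borel measure and to be arc length on segments.\<close>

lemma metric_outer_measure_borel:
  fixes f :: "'a::metric_space set \<Rightarrow> ennreal"
  assumes empty: "f {} = 0"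
    and mono: "\<And>A B. A \<subseteq> B \<Longrightarrow> f A \<le> f B"
    and csub: "\<And>A :: nat \<Rightarrow> 'a set. f (\<Union>i. A i) \<le> (\<Sum>i. f (A i))"
    and sep: "\<And>A B d. 0 < d \<Longrightarrow> (\<And>x y. x \<in> A \<Longrightarrow> y \<in> B \<Longrightarrow> d \<le> dist x y) \<Longrightarrow> f A + f B \<le> f (A \<union> B)"
  shows "measure_space UNIV (sets borel) f"
proof -
  interpret sigma_algebra UNIV "Pow UNIV :: 'a set set" by (rule sigma_algebra_Pow)
  have oms: "outer_measure_space (Pow UNIV) f"
    using assms by (auto simp: outer_measure_space_def positive_def increasing_def countably_subadditive_def)
  define L where "L = lambda_system UNIV (Pow UNIV) f"
  have L: "measure_space UNIV L f" unfolding L_def by (rule caratheodory_lemma[OF oms])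
  have sub2: "f (A \<union> B) \<le> f A + f B" for A B
  proof -
    have "f (\<Union>i::nat. if i = 0 then A else if i = 1 then B else {}) \<le> (\<Sum>i::nat. f (if i = 0 then A else if i = 1 then B else {}))"
      by (rule csub)
    also have "(\<Union>i::nat. if i = 0 then A else if i = 1 then B else {}) = A \<union> B"
      by (auto split: if_splits)
    also have "(\<Sum>i::nat. f (if i = 0 then A else if i = 1 then B else {})) = (\<Sum>i\<in>{0,1::nat}. f (if i = 0 then A else if i = 1 then B else {}))"
      by (rule suminf_finite) (auto simp: empty)
    finally show ?thesis by simp
  qed
  \<comment> \<open>Caratheodory's criterion: \<open>sep\<close> separates
    \<open>A \<inter> F\<close> from the points of A at distance at least 1/(k+1) from F. The points
    closer to F lie in rings whose values form the tail of a convergent series, so nothing is lost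
    as k grows.\<close>
  have closed_L: "F \<in> L" if F: "closed F" for F
  proof (cases "F = {}")
    case True
    then show ?thesis using lambda_system_empty[of f] empty by (simp add: L_def positive_def)
  next
    case False
    have key: "f (A \<inter> F) + f (A - F) \<le> f A" for A
    proof (cases "f A = \<infinity>")
      case True then show ?thesis by simp
    next
      case fin: False
      \<comment> \<open>Rings \<open>D k\<close> whose indices differ by at least 2 have positive distance, so \<open>\<Sum>k. f (D k)\<close> converges.\<close>
      define g where "g x = infdist x F" for x
      define D where "D k = {x \<in> A. 1 / real (k + 2) \<le> g x \<and> g x < 1 / real (k + 1)}" for k :: nat
      define E where "E k = {x \<in> A. 1 / real (k + 1) \<le> g x}" for k :: nat
      have g_lip: "g x - g y \<le> dist x y" for x y
        using infdist_triangle[of x F y] by (simp add: g_def)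
      have EF: "f (A \<inter> F) + f (E k) \<le> f A" for k
      proof -
        have "f (A \<inter> F) + f (E k) \<le> f (A \<inter> F \<union> E k)"
        proof (rule sep[of "1 / real (k + 1)"])
          fix x y assume "x \<in> A \<inter> F" "y \<in> E k"
          then have "g x = 0" "1 / real (k + 1) \<le> g y" by (auto simp: g_def E_def)
          then show "1 / real (k + 1) \<le> dist x y" using g_lip[of y x] by (simp add: dist_commute)
        qed simp
        also have "\<dots> \<le> f A" by (rule mono) (auto simp: E_def)
        finally show ?thesis .
      qed
      have D_sum: "(\<Sum>i<N. f (D (2 * i + p))) \<le> f (\<Union>i<N. D (2 * i + p))" for N p
      proof (induction N)
        case 0 then show ?case by (simp add: empty)
      next
        case (Suc N)
        \<comment> \<open>The earlier rings lie where \<open>g\<close> is at least 1/(2N+p), the new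
          one where it is below 1/(2N+p+1). For N = 0 the first fraction may be 1/0, which is 0,
          hence the case distinction.\<close>
        define d where "d = 1 / real (2 * N + p) - 1 / real (2 * N + p + 1)"
        show ?case
        proof (cases "N = 0")
          case True then show ?thesis by (simp add: lessThan_Suc)
        next
          case False
          then have pos: "0 < d" by (auto simp: d_def intro!: divide_strict_left_mono)
          have "f (\<Union>i<N. D (2 * i + p)) + f (D (2 * N + p)) \<le> f ((\<Union>i<N. D (2 * i + p)) \<union> D (2 * N + p))"
          proof (rule sep[OF pos])
            fix x y assume "x \<in> (\<Union>i<N. D (2 * i + p))" and y: "y \<in> D (2 * N + p)"
            then obtain i where i: "i < N" "x \<in> D (2 * i + p)" by auto
            have "1 / real (2 * N + p) \<le> 1 / real (2 * i + p + 2)"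
              using i by (intro divide_left_mono) auto
            then have "1 / real (2 * N + p) \<le> g x" using i(2) by (simp add: D_def)
            moreover have "g y \<le> 1 / real (2 * N + p + 1)" using y by (simp add: D_def)
            ultimately show "d \<le> dist x y" using g_lip[of x y] by (simp add: d_def)
          qed
          also have "(\<Union>i<N. D (2 * i + p)) \<union> D (2 * N + p) = (\<Union>i<Suc N. D (2 * i + p))"
            by (auto simp: less_Suc_eq)
          finally show ?thesis using Suc by (simp add: add_mono order_trans[OF add_mono[OF Suc order_refl]])
        qed
      qed
      have D_le: "(\<Sum>i. f (D (2 * i + p))) \<le> f A" for p
      proof (rule suminf_le_const[OF summableI])
        fix N
        show "(\<Sum>i<N. f (D (2 * i + p))) \<le> f A"
          by (rule order_trans[OF D_sum]) (auto intro!: mono simp: D_def)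
      qed
      have D_tot: "(\<Sum>k. f (D k)) \<le> f A + f A"
      proof (rule suminf_le_const[OF summableI])
        fix N
        have "(\<Sum>k<N. f (D k)) \<le> (\<Sum>k<2*N. f (D k))"
          by (rule sum_mono2) auto
        also have "\<dots> = (\<Sum>i<N. f (D (2 * i + 0))) + (\<Sum>i<N. f (D (2 * i + 1)))"
          by (induction N) (auto simp: algebra_simps)
        also have "\<dots> \<le> (\<Sum>i. f (D (2 * i + 0))) + (\<Sum>i. f (D (2 * i + 1)))"
          by (intro add_mono sum_le_suminf) (auto intro: summableI)
        also have "\<dots> \<le> f A + f A" by (intro add_mono D_le)
        finally show "(\<Sum>k<N. f (D k)) \<le> f A + f A" .
      qed
      then have Dfin: "(\<Sum>k. f (D k)) \<noteq> \<infinity>" using fin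
        by (metis ennreal_add_eq_top infinity_ennreal_def top.extremum_unique)
      have AF: "f (A - F) \<le> f (E k) + (\<Sum>i. f (D (i + k)))" for k
      proof -
        have "A - F \<subseteq> E k \<union> (\<Union>i. D (i + k))"
        proof
          fix x assume x: "x \<in> A - F"
          then have g: "g x > 0" using infdist_pos_not_in_closed[OF F False] by (auto simp: g_def)
          \<comment> \<open>If x is not already in \<open>E k\<close>, its ring is the predecessor
            of the least index satisfying \<open>P\<close>.\<close>
          define P where "P m \<longleftrightarrow> 1 / real (m + 1) \<le> g x" for m :: nat
          obtain m where m: "P m" using reals_Archimedean[OF g]
            by (auto simp: P_def inverse_eq_divide intro: less_imp_le)
          define l where "l = (LEAST m. P m)"
          have l: "P l" unfolding l_def using m by (rule LeastI)
          show "x \<in> E k \<union> (\<Union>i. D (i + k))"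
          proof (cases "P k")
            case True then show ?thesis using x by (auto simp: E_def P_def)
          next
            case nk: False
            have "k < l"
            proof (rule ccontr)
              assume "\<not> k < l"
              then have "1 / real (k + 1) \<le> 1 / real (l + 1)" by (intro divide_left_mono) auto
              then show False using l nk by (simp add: P_def)
            qed
            then obtain q where q: "l = Suc q" "k \<le> q" by (cases l) auto
            have "\<not> P q" using not_less_Least[of q P] q by (simp add: l_def)
            then have "x \<in> D q" using l q x by (auto simp: D_def P_def add.commute)
            then have "x \<in> D ((q - k) + k)" using q by simp
            then show ?thesis by blast
          qed
        qed
        then have "f (A - F) \<le> f (E k \<union> (\<Union>i. D (i + k)))" by (rule mono)
        also have "\<dots> \<le> f (E k) + f (\<Union>i. D (i + k))" by (rule sub2)
        also have "\<dots> \<le> f (E k) + (\<Sum>i. f (D (i + k)))" by (intro add_left_mono csub)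
        finally show ?thesis .
      qed
      have le: "f (A \<inter> F) + f (A - F) \<le> f A + (\<Sum>i. f (D (i + k)))" for k
      proof -
        have "f (A \<inter> F) + f (A - F) \<le> f (A \<inter> F) + f (E k) + (\<Sum>i. f (D (i + k)))"
          using AF[of k] by (simp add: add.assoc add_left_mono)
        also have "\<dots> \<le> f A + (\<Sum>i. f (D (i + k)))" by (intro add_right_mono EF)
        finally show ?thesis .
      qed
      have tail: "(\<lambda>k. \<Sum>i. f (D (i + k))) \<longlonglongrightarrow> 0"
      proof -
        have Dk: "f (D k) < top" for k
          using order_trans[OF mono, of "D k" A] fin
          by (metis (no_types, lifting) D_def infinity_ennreal_def mem_Collect_eq mono order_le_less_trans subsetI top.not_eq_extremum)
        define r where "r k = enn2real (f (D k))" for k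
        have fr: "f (D k) = ennreal (r k)" "0 \<le> r k" for k using Dk by (auto simp: r_def)
        have sr: "summable r"
          using Dfin fr by (intro summable_suminf_not_top) auto
        have "(\<lambda>k. \<Sum>i. r (i + k)) \<longlonglongrightarrow> 0"
          by (rule suminf_exist_split2[OF sr])
        then have "(\<lambda>k. ennreal (\<Sum>i. r (i + k))) \<longlonglongrightarrow> ennreal 0" by (rule tendsto_ennrealI)
        moreover have "(\<Sum>i. f (D (i + k))) = ennreal (\<Sum>i. r (i + k))" for k
          using sr fr by (simp add: suminf_ennreal2 summable_iff_shift)
        ultimately show ?thesis by simp
      qed
      have "(\<lambda>k. f A + (\<Sum>i. f (D (i + k)))) \<longlonglongrightarrow> f A + 0"
        by (intro tendsto_add tendsto_const tail)
      then show ?thesis using le by (intro LIMSEQ_le_const[where X = "\<lambda>k. f A + (\<Sum>i. f (D (i + k)))"]) auto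
    qed
    have "f (A \<inter> F) + f (A - F) = f A" for A
    proof (rule antisym[OF key])
      show "f A \<le> f (A \<inter> F) + f (A - F)"
        using sub2[of "A \<inter> F" "A - F"] by (simp add: Int_Diff_Un)
    qed
    then show ?thesis unfolding L_def lambda_system_eq by auto
  qed
  have saL: "sigma_algebra UNIV L" using L by (simp add: measure_space_def)
  have "sets borel \<subseteq> L"
  proof -
    have "sets (borel :: 'a measure) = sigma_sets UNIV {S. closed S}"
      by (simp add: borel_eq_closed)
    also have "\<dots> \<subseteq> L"
      using closed_L sigma_algebra.sigma_sets_subset[OF saL, of "{S. closed S}"] by auto
    finally show ?thesis .
  qed
  then show ?thesis
    using measure_down[OF L, of "sets borel"] sets.sigma_algebra_axioms[of "borel :: 'a measure"] by simp
qed

section \<open>Coverings and the Hausdorff outer measure\<close>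

lemma hausdorff_pre_antimono: "\<delta> \<le> \<epsilon> \<Longrightarrow> hausdorff_pre k \<epsilon> A \<le> hausdorff_pre k \<delta> A"
  unfolding hausdorff_pre_def by (rule INF_superset_mono) (auto intro: order_trans)

text \<open>Coverings of the A i that are optimal up to e / 2^(i+1) are merged into one sequence by
  the pairing of natural numbers; the errors add up to e.\<close>

lemma hausdorff_pre_csub:
  "hausdorff_pre k \<delta> (\<Union>i::nat. A i) \<le> (\<Sum>i. hausdorff_pre k \<delta> (A i))"
proof (cases "\<exists>i. hausdorff_pre k \<delta> (A i) = \<infinity>")
  case True
  then obtain i where "hausdorff_pre k \<delta> (A i) = top" by auto
  then have "(\<Sum>i. hausdorff_pre k \<delta> (A i)) = top"
    using sum_le_suminf[OF summableI, of "{i}" "\<lambda>i. hausdorff_pre k \<delta> (A i)"] by (simp add: top_unique)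
  then show ?thesis by simp
next
  case False
  show ?thesis
  proof (rule ennreal_le_epsilon)
    fix e :: real assume e: "0 < e"
    have "\<exists>U. (A i \<subseteq> (\<Union>j. U j) \<and> (\<forall>j. bounded (U j) \<and> diameter (U j) \<le> \<delta>)) \<and>
            (\<Sum>j. hausdorff_weight k (U j)) \<le> hausdorff_pre k \<delta> (A i) + ennreal (e * (1/2) ^ Suc i)" for i
    proof -
      have "hausdorff_pre k \<delta> (A i) < hausdorff_pre k \<delta> (A i) + ennreal (e * (1/2) ^ Suc i)"
        using False e ennreal_add_left_cancel_less[of "hausdorff_pre k \<delta> (A i)" 0] by simp
      then have "(INF U\<in>{U::nat \<Rightarrow> 'a set. A i \<subseteq> (\<Union>i. U i) \<and> (\<forall>i. bounded (U i) \<and> diameter (U i) \<le> \<delta>)}.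
         \<Sum>i. hausdorff_weight k (U i)) < hausdorff_pre k \<delta> (A i) + ennreal (e * (1/2) ^ Suc i)"
        by (simp add: hausdorff_pre_def)
      then show ?thesis unfolding INF_less_iff by (auto intro: less_imp_le)
    qed
    then obtain U where U: "\<And>i. A i \<subseteq> (\<Union>j. U i j)" "\<And>i j. bounded (U i j)" "\<And>i j. diameter (U i j) \<le> \<delta>"
      "\<And>i. (\<Sum>j. hausdorff_weight k (U i j)) \<le> hausdorff_pre k \<delta> (A i) + ennreal (e * (1/2) ^ Suc i)"
      by metis
    define V where "V m = (case prod_decode m of (i, j) \<Rightarrow> U i j)" for m
    have "hausdorff_pre k \<delta> (\<Union>i. A i) \<le> (\<Sum>m. hausdorff_weight k (V m))"
      unfolding hausdorff_pre_def
    proof (rule INF_lower, safe)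
      fix x i assume "x \<in> A i"
      then obtain j where "x \<in> U i j" using U(1) by blast
      then have "x \<in> V (prod_encode (i, j))" by (simp add: V_def)
      then show "x \<in> (\<Union>m. V m)" by blast
    qed (auto simp: V_def U split: prod.splits)
    also have "\<dots> = (\<Sum>i. \<Sum>j. hausdorff_weight k (U i j))"
      using suminf_ennreal_2dimen[where f = "\<lambda>(i, j). hausdorff_weight k (U i j)" and g = "\<lambda>i. \<Sum>j. hausdorff_weight k (U i j)"]
      by (simp add: V_def comp_def case_prod_beta)
    also have "\<dots> \<le> (\<Sum>i. hausdorff_pre k \<delta> (A i) + ennreal (e * (1/2) ^ Suc i))"
      by (intro suminf_le U summableI)
    also have "\<dots> = (\<Sum>i. hausdorff_pre k \<delta> (A i)) + (\<Sum>i. ennreal (e * (1/2) ^ Suc i))"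
      by (rule suminf_add[symmetric]) (auto intro: summableI)
    also have "(\<Sum>i. ennreal (e * (1/2) ^ Suc i)) = ennreal e"
      using sums_mult[OF power_half_series, of e] e
      by (intro suminf_ennreal_eq) auto
    finally show "hausdorff_pre k \<delta> (\<Union>i. A i) \<le> (\<Sum>i. hausdorff_pre k \<delta> (A i)) + ennreal e" .
  qed
qed

lemma hausdorff_pre_le_outer: "0 < \<delta> \<Longrightarrow> hausdorff_pre k \<delta> A \<le> hausdorff_outer k A"
  unfolding hausdorff_outer_def by (rule SUP_upper) simp

text \<open>A covering set of diameter below d cannot meet both A and B, so any covering of the
  union splits into a covering of A and one of B without counting a set twice.\<close>

lemma hausdorff_pre_sep:
  assumes "\<delta> < d" and sep: "\<And>x y. x \<in> A \<Longrightarrow> y \<in> B \<Longrightarrow> d \<le> dist x y"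
  shows "hausdorff_pre k \<delta> A + hausdorff_pre k \<delta> B \<le> hausdorff_pre k \<delta> (A \<union> B)"
  unfolding hausdorff_pre_def[of k \<delta> "A \<union> B"]
proof (rule INF_greatest, clarsimp)
  fix U :: "nat \<Rightarrow> 'a set"
  assume U: "A \<subseteq> (\<Union>i. U i)" "B \<subseteq> (\<Union>i. U i)" "\<forall>i. bounded (U i) \<and> diameter (U i) \<le> \<delta>"
  define V where "V i = (if U i \<inter> A = {} then {} else U i)" for i
  define W where "W i = (if U i \<inter> B = {} then {} else U i)" for i
  have VW: "V i = {} \<or> W i = {}" for i
  proof (rule ccontr)
    assume "\<not> ?thesis"
    then obtain x y where xy: "x \<in> U i" "x \<in> A" "y \<in> U i" "y \<in> B"
      by (auto simp: V_def W_def split: if_splits)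
    have "dist x y \<le> diameter (U i)" using U(3) xy by (intro diameter_bounded_bound) auto
    with sep[OF xy(2,4)] assms(1) U(3) show False by (metis not_le order_trans)
  qed
  \<comment> \<open>Discarded sets are replaced by the empty set, whose diameter 0 is allowed only
    for a nonnegative scale; the given covering guarantees that.\<close>
  have dnn: "0 \<le> \<delta>" using U(3) diameter_ge_0 by (metis order_trans)
  have "hausdorff_pre k \<delta> A \<le> (\<Sum>i. hausdorff_weight k (V i))"
    unfolding hausdorff_pre_def
    by (rule INF_lower) (use U dnn in \<open>auto simp: V_def split: if_splits\<close>, blast)
  moreover have "hausdorff_pre k \<delta> B \<le> (\<Sum>i. hausdorff_weight k (W i))"
    unfolding hausdorff_pre_def
    by (rule INF_lower) (use U dnn in \<open>auto simp: W_def split: if_splits\<close>, blast)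
  ultimately have "hausdorff_pre k \<delta> A + hausdorff_pre k \<delta> B \<le>
      (\<Sum>i. hausdorff_weight k (V i)) + (\<Sum>i. hausdorff_weight k (W i))" by (rule add_mono)
  also have "\<dots> = (\<Sum>i. hausdorff_weight k (V i) + hausdorff_weight k (W i))"
    by (rule suminf_add) (auto intro: summableI)
  also have "\<dots> \<le> (\<Sum>i. hausdorff_weight k (U i))"
  proof (intro suminf_le summableI)
    fix i show "hausdorff_weight k (V i) + hausdorff_weight k (W i) \<le> hausdorff_weight k (U i)"
    proof -
      have "V i = {} \<or> V i = U i" "W i = {} \<or> W i = U i" by (auto simp: V_def W_def)
      with VW[of i] show ?thesis by (auto simp: hausdorff_weight_def)
    qed
  qed
  finally show "hausdorff_pre k \<delta> A + hausdorff_pre k \<delta> B \<le> (\<Sum>i. hausdorff_weight k (U i))" .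
qed

lemma hausdorff_outer_mono: "A \<subseteq> B \<Longrightarrow> hausdorff_outer k A \<le> hausdorff_outer k B"
  unfolding hausdorff_outer_def hausdorff_pre_def
  by (intro SUP_mono' INF_superset_mono) auto

text \<open>Without this fact \<open>measure_of\<close> would fall back to the zero measure, and
  \<open>hausdorff_measure\<close> would say nothing about \<open>hausdorff_outer\<close>.\<close>

lemma measure_space_hausdorff:
  "measure_space UNIV (sets borel) (hausdorff_outer k :: 'a::metric_space set \<Rightarrow> ennreal)"
proof (rule metric_outer_measure_borel)
  have "hausdorff_pre k \<delta> ({} :: 'a set) = 0" if "0 < \<delta>" for \<delta>
  proof -
    have "hausdorff_pre k \<delta> ({} :: 'a set) \<le> (\<Sum>i::nat. hausdorff_weight k ({} :: 'a set))"
      unfolding hausdorff_pre_def by (rule INF_lower) (use that in auto)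
    then show ?thesis by (simp add: hausdorff_weight_def)
  qed
  then have "hausdorff_outer k ({} :: 'a set) \<le> 0"
    unfolding hausdorff_outer_def by (intro SUP_least) auto
  then show "hausdorff_outer k ({} :: 'a set) = 0" by simp
next
  fix A :: "nat \<Rightarrow> 'a set"
  show "hausdorff_outer k (\<Union>i. A i) \<le> (\<Sum>i. hausdorff_outer k (A i))"
    unfolding hausdorff_outer_def[of k "\<Union>i. A i"]
  proof (rule SUP_least)
    fix \<delta> :: real assume "\<delta> \<in> {0<..}"
    then show "hausdorff_pre k \<delta> (\<Union>i. A i) \<le> (\<Sum>i. hausdorff_outer k (A i))"
      by (intro order_trans[OF hausdorff_pre_csub] suminf_le summableI hausdorff_pre_le_outer) auto
  qed
next
  fix A B :: "'a set" and d :: real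
  assume d: "0 < d" and sep: "\<And>x y. x \<in> A \<Longrightarrow> y \<in> B \<Longrightarrow> d \<le> dist x y"
  \<comment> \<open>Two independent scales allow the suprema for A and for B to be taken one after
    the other; both are compared with a common scale \<open>m\<close> below d.\<close>
  have *: "hausdorff_pre k \<delta> A + hausdorff_pre k \<epsilon> B \<le> hausdorff_outer k (A \<union> B)"
    if "0 < \<delta>" "0 < \<epsilon>" for \<delta> \<epsilon>
  proof -
    define m where "m = min (min \<delta> \<epsilon>) (d / 2)"
    have m: "0 < m" "m < d" "m \<le> \<delta>" "m \<le> \<epsilon>" using that d by (auto simp: m_def)
    have "hausdorff_pre k \<delta> A + hausdorff_pre k \<epsilon> B \<le> hausdorff_pre k m A + hausdorff_pre k m B"
      using m by (intro add_mono hausdorff_pre_antimono)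
    also have "\<dots> \<le> hausdorff_pre k m (A \<union> B)" using m sep by (intro hausdorff_pre_sep[of _ d])
    also have "\<dots> \<le> hausdorff_outer k (A \<union> B)" using m by (intro hausdorff_pre_le_outer)
    finally show ?thesis .
  qed
  show "hausdorff_outer k A + hausdorff_outer k B \<le> hausdorff_outer k (A \<union> B)"
  proof -
    have "hausdorff_outer k A + hausdorff_pre k \<epsilon> B \<le> hausdorff_outer k (A \<union> B)" if "0 < \<epsilon>" for \<epsilon>
      unfolding hausdorff_outer_def[of k A]
      by (subst ennreal_SUP_add_left[symmetric]) (use that * in \<open>auto intro!: SUP_least\<close>)
    then show ?thesis
      unfolding hausdorff_outer_def[of k B]
      by (subst ennreal_SUP_add_right) (use * in \<open>auto intro!: SUP_least\<close>)
  qed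
qed (rule hausdorff_outer_mono)

lemma sets_hausdorff [simp, measurable_cong]: "sets (hausdorff_measure k) = sets borel"
  unfolding hausdorff_measure_def by (simp add: sets.sigma_sets_eq[of borel, simplified])

lemma space_hausdorff [simp]: "space (hausdorff_measure k) = UNIV"
  unfolding hausdorff_measure_def by simp

lemma emeasure_hausdorff:
  "A \<in> sets borel \<Longrightarrow> emeasure (hausdorff_measure k) A = hausdorff_outer k A"
  unfolding hausdorff_measure_def
  using measure_space_hausdorff[of k]
  by (intro emeasure_measure_of_sigma) (auto simp: measure_space_def sets.sigma_algebra_axioms[of borel, simplified])

section \<open>One-dimensional Hausdorff measure as arc length\<close>

lemma hausdorff_weight_1: "hausdorff_weight 1 U = ennreal (diameter U)"
  by (simp add: hausdorff_weight_def unit_ball_vol_1)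

text \<open>Upper bound for the closed segment: cut it into N pieces of diameter at most the scale.
  Lower bound for the open one: projection along e does not increase diameters, so a covering of the
  segment yields intervals covering \<open>{l<..<u}\<close>, and Lebesgue measure is countably
  subadditive.\<close>

lemma emeasure_hausdorff_1_line:
  fixes a e :: "'a::euclidean_space"
  assumes e: "norm e = 1" and lu: "l \<le> u"
  shows "emeasure (hausdorff_measure 1) ((\<lambda>s. a + s *\<^sub>R e) ` {l<..<u}) = ennreal (u - l)"
    and "emeasure (hausdorff_measure 1) ((\<lambda>s. a + s *\<^sub>R e) ` {l..u}) = ennreal (u - l)"
proof -
  define \<gamma> where "\<gamma> s = a + s *\<^sub>R e" for s
  have dist: "dist (\<gamma> s) (\<gamma> t) = \<bar>s - t\<bar>" for s t
    using e by (simp add: \<gamma>_def dist_norm flip: scaleR_left_diff_distrib)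
  have proj: "(\<gamma> s - a) \<bullet> e = s" for s using e by (simp add: \<gamma>_def dot_square_norm)
  have upper: "hausdorff_pre 1 \<delta> (\<gamma> ` {l..u}) \<le> ennreal (u - l)" if "0 < \<delta>" for \<delta>
  proof -
    obtain N :: nat where N: "(u - l) / \<delta> < real N" using reals_Archimedean2 by blast
    then have N0: "0 < N" using lu that by (metis divide_nonneg_pos diff_ge_0_iff_ge gr0I not_less of_nat_0)
    define h where "h = (u - l) / real N"
    have h: "0 \<le> h" "h \<le> \<delta>" "h * real N = u - l"
      using N N0 that lu by (auto simp: h_def field_simps)
    define U where "U i = (if i < N then \<gamma> ` {l + real i * h .. l + real (Suc i) * h} else {})" for i
    have bdd: "bounded (U i)" for i
      by (auto simp: U_def \<gamma>_def intro!: compact_imp_bounded compact_continuous_image continuous_intros)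
    have diam: "diameter (U i) \<le> h" for i
    proof (rule diameter_le)
      show "U i \<noteq> {} \<or> 0 \<le> h" using h by simp
      show "norm (x - y) \<le> h" if "x \<in> U i" "y \<in> U i" for x y
        using that dist by (auto simp: U_def dist_norm[symmetric] algebra_simps abs_le_iff split: if_splits)
    qed
    have "hausdorff_pre 1 \<delta> (\<gamma> ` {l..u}) \<le> (\<Sum>i. hausdorff_weight 1 (U i))"
      unfolding hausdorff_pre_def
    proof (rule INF_lower, safe)
      fix s assume s: "s \<in> {l..u}"
      show "\<gamma> s \<in> (\<Union>i. U i)"
      \<comment> \<open>At the right endpoint the floor below would give the index N, and for l = u
        the width h is 0; this case catches both.\<close>
      proof (cases "s = u")
        case True
        have "\<gamma> u \<in> U (N - 1)" using N0 h by (auto simp: U_def algebra_simps of_nat_diff)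
        then show ?thesis using True by blast
      next
        case False
        with s have hpos: "0 < h" using N0 by (auto simp: h_def)
        define i where "i = nat \<lfloor>(s - l) / h\<rfloor>"
        have ri: "real i = of_int \<lfloor>(s - l) / h\<rfloor>" using s hpos by (simp add: i_def)
        have "real i \<le> (s - l) / h" "(s - l) / h \<le> real (Suc i)"
          using ri by linarith+
        then have i: "real i * h \<le> s - l" "s - l \<le> real (Suc i) * h"
          using hpos by (simp_all only: pos_le_divide_eq pos_divide_le_eq)
        have "real i * h < real N * h" using i(1) h(3) s False by (simp add: mult.commute)
        then have "i < N" using hpos by simp
        then have "\<gamma> s \<in> U i" using i by (auto simp: U_def)
        then show ?thesis by blast
      qed
    next
      fix i show "diameter (U i) \<le> \<delta>" using diam[of i] h by simp
    qed (rule bdd)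
    also have "\<dots> = (\<Sum>i<N. hausdorff_weight 1 (U i))"
      by (rule suminf_finite) (auto simp: U_def hausdorff_weight_def)
    also have "\<dots> \<le> (\<Sum>i<N. ennreal h)"
      unfolding hausdorff_weight_1 by (intro sum_mono ennreal_leI diam)
    also have "\<dots> = ennreal (u - l)" using h by (simp add: ennreal_mult ennreal_of_nat_eq_real_of_nat mult.commute flip: ennreal_mult)
    finally show ?thesis .
  qed
  have lower: "ennreal (u - l) \<le> hausdorff_pre 1 \<delta> (\<gamma> ` {l<..<u})" for \<delta>
    unfolding hausdorff_pre_def
  proof (rule INF_greatest, clarify)
    fix U :: "nat \<Rightarrow> 'a set"
    assume U: "\<gamma> ` {l<..<u} \<subseteq> (\<Union>i. U i)" "\<forall>i. bounded (U i) \<and> diameter (U i) \<le> \<delta>"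
    have "\<exists>c d. c \<le> d \<and> d - c \<le> diameter (U i) \<and> (\<lambda>x. (x - a) \<bullet> e) ` U i \<subseteq> {c..d}" for i
    proof (cases "U i = {}")
      case True then show ?thesis by (intro exI[of _ 0]) auto
    next
      case False
      define S where "S = (\<lambda>x. (x - a) \<bullet> e) ` U i"
      have S: "bounded S" "S \<noteq> {}" unfolding S_def
        using False U(2) by (auto intro!: bounded_linear_image[OF _ bounded_linear_inner_left]
            simp: image_image[of "\<lambda>x. x \<bullet> e" "\<lambda>x. x - a", symmetric] bounded_translation_minus)
      have diff: "s - t \<le> diameter (U i)" if "s \<in> S" "t \<in> S" for s t
      proof -
        from that obtain x y where xy: "x \<in> U i" "y \<in> U i" "s = (x - a) \<bullet> e" "t = (y - a) \<bullet> e"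
          by (auto simp: S_def)
        then have "s - t = (x - y) \<bullet> e" by (simp add: inner_diff_left)
        also have "\<dots> \<le> norm (x - y) * norm e" by (rule norm_cauchy_schwarz)
        also have "\<dots> \<le> diameter (U i)" using e U(2) xy diameter_bounded_bound[of "U i" x y] by (auto simp: dist_norm)
        finally show ?thesis .
      qed
      have bd: "bdd_above S" "bdd_below S" using S bounded_imp_bdd_above bounded_imp_bdd_below by auto
      have "Sup S \<le> diameter (U i) + Inf S"
      proof (rule cSup_least[OF S(2)])
        fix s assume s: "s \<in> S"
        have "s - diameter (U i) \<le> Inf S" by (rule cInf_greatest[OF S(2)]) (use diff[OF s] in force)
        then show "s \<le> diameter (U i) + Inf S" by simp
      qed
      moreover have "Inf S \<le> Sup S" using bd S by (simp add: cInf_le_cSup)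
      moreover have "S \<subseteq> {Inf S..Sup S}" using bd by (auto intro: cInf_lower cSup_upper)
      ultimately show ?thesis unfolding S_def[symmetric]
        by (intro exI[of _ "Inf S"] exI[of _ "Sup S"]) auto
    qed
    then obtain c d where cd: "\<And>i. c i \<le> d i" "\<And>i. d i - c i \<le> diameter (U i)"
      "\<And>i. (\<lambda>x. (x - a) \<bullet> e) ` U i \<subseteq> {c i..d i}" by metis
    have "{l<..<u} \<subseteq> (\<Union>i. {c i..d i})"
    proof
      fix s assume "s \<in> {l<..<u}"
      then obtain i where "\<gamma> s \<in> U i" using U(1) by blast
      then have "s \<in> {c i..d i}" using cd(3)[of i] proj[of s] by (metis image_subset_iff)
      then show "s \<in> (\<Union>i. {c i..d i})" by blast
    qed
    then have "emeasure lborel {l<..<u} \<le> emeasure lborel (\<Union>i. {c i..d i})"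
      by (intro emeasure_mono) auto
    also have "\<dots> \<le> (\<Sum>i. emeasure lborel {c i..d i})"
      by (intro emeasure_subadditive_countably) auto
    also have "\<dots> \<le> (\<Sum>i. hausdorff_weight 1 (U i))"
      using cd by (intro suminf_le summableI) (auto simp: hausdorff_weight_1[unfolded One_nat_def] intro!: ennreal_leI)
    finally show "ennreal (u - l) \<le> (\<Sum>i. hausdorff_weight 1 (U i))" using lu by simp
  qed
  have up: "hausdorff_outer 1 (\<gamma> ` {l..u}) \<le> ennreal (u - l)"
    unfolding hausdorff_outer_def by (rule SUP_least) (use upper in auto)
  have lo: "ennreal (u - l) \<le> hausdorff_outer 1 (\<gamma> ` {l<..<u})"
    by (rule order_trans[OF lower[of 1] hausdorff_pre_le_outer]) simp
  have mono: "hausdorff_outer 1 (\<gamma> ` {l<..<u}) \<le> hausdorff_outer 1 (\<gamma> ` {l..u})"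
    by (rule hausdorff_outer_mono) auto
  have b1: "\<gamma> ` {l..u} \<in> sets borel"
    by (auto simp: \<gamma>_def intro!: borel_compact compact_continuous_image continuous_intros)
  have "inj \<gamma>" by (metis injI proj)
  moreover have "{l<..<u} = {l..u} - {l, u}" by auto
  ultimately have "\<gamma> ` {l<..<u} = \<gamma> ` {l..u} - {\<gamma> l, \<gamma> u}"
    by (simp add: image_set_diff)
  then have b2: "\<gamma> ` {l<..<u} \<in> sets borel" using b1 by auto
  show "emeasure (hausdorff_measure 1) ((\<lambda>s. a + s *\<^sub>R e) ` {l<..<u}) = ennreal (u - l)"
    "emeasure (hausdorff_measure 1) ((\<lambda>s. a + s *\<^sub>R e) ` {l..u}) = ennreal (u - l)"
    using b1 b2 up lo mono unfolding \<gamma>_def[symmetric] by (auto simp: emeasure_hausdorff \<gamma>_def[symmetric])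
qed

text \<open>Hausdorff measure restricted to the whole line through a and pushed forward by the
  coordinate \<open>\<pi>\<close> gives every interval its length, which characterises Lebesgue
  measure. On the line, \<open>\<gamma>\<close> inverts \<open>\<pi>\<close>.\<close>

lemma set_integral_hausdorff_1_line:
  fixes a e :: "'a::euclidean_space" and f :: "'a \<Rightarrow> real"
  assumes e: "norm e = 1" and f [measurable]: "f \<in> borel_measurable borel"
  shows "(LINT x:(\<lambda>s. a + s *\<^sub>R e) ` {l..u}|hausdorff_measure 1. f x) = (LINT s:{l..u}|lborel. f (a + s *\<^sub>R e))"
proof -
  define \<gamma> where "\<gamma> s = a + s *\<^sub>R e" for s
  define \<pi> where "\<pi> x = (x - a) \<bullet> e" for x
  have \<pi>\<gamma> [simp]: "\<pi> (\<gamma> s) = s" for s using e by (simp add: \<gamma>_def \<pi>_def dot_square_norm)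
  have [measurable]: "\<pi> \<in> borel_measurable borel" "\<gamma> \<in> borel_measurable borel"
    unfolding \<pi>_def \<gamma>_def by auto
  have rng: "range \<gamma> = {x. \<gamma> (\<pi> x) = x}" by (auto intro: range_eqI[OF sym])
  have [measurable]: "range \<gamma> \<in> sets borel" unfolding rng by measurable
  define D where "D = density (hausdorff_measure 1) (\<lambda>x. indicator (range \<gamma>) x :: ennreal)"
  have [measurable_cong]: "sets D = sets borel" by (simp add: D_def)
  have "lborel = distr D borel \<pi>"
  proof (rule lborel_eqI)
    fix l u :: real assume "\<And>b. b \<in> Basis \<Longrightarrow> l \<bullet> b \<le> u \<bullet> b"
    then have lu: "l \<le> u" by simp
    have [measurable]: "\<pi> -` {l<..<u} \<in> sets borel"
      by (rule measurable_sets_borel[of \<pi> borel]) simp_all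
    have "emeasure (distr D borel \<pi>) (box l u) = emeasure D (\<pi> -` {l<..<u})"
      by (subst emeasure_distr) (auto simp: D_def box_real)
    also have "\<dots> = emeasure (hausdorff_measure 1) (range \<gamma> \<inter> \<pi> -` {l<..<u})"
      unfolding D_def by (subst emeasure_density) (auto simp flip: indicator_inter_arith intro!: nn_integral_indicator)
    also have "range \<gamma> \<inter> \<pi> -` {l<..<u} = \<gamma> ` {l<..<u}" by auto
    also have "emeasure (hausdorff_measure 1) \<dots> = ennreal (u - l)"
      unfolding \<gamma>_def by (rule emeasure_hausdorff_1_line[OF e lu])
    finally show "emeasure (distr D borel \<pi>) (box l u) = ennreal (\<Prod>b\<in>Basis. (u - l) \<bullet> b)" by simp
  qed simp
  then have "(LINT s:{l..u}|lborel. f (\<gamma> s)) = (LINT s:{l..u}|distr D borel \<pi>. f (\<gamma> s))" by simp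
  also have "\<dots> = (LINT x|D. indicator {l..u} (\<pi> x) *\<^sub>R f (\<gamma> (\<pi> x)))"
    unfolding set_lebesgue_integral_def by (subst integral_distr) auto
  also have "\<dots> = (LINT x|hausdorff_measure 1. indicator (range \<gamma>) x *\<^sub>R (indicator {l..u} (\<pi> x) *\<^sub>R f (\<gamma> (\<pi> x))))"
    unfolding D_def ennreal_indicator[symmetric] by (subst integral_density) auto
  also have "\<dots> = (LINT x:\<gamma> ` {l..u}|hausdorff_measure 1. f x)"
    unfolding set_lebesgue_integral_def
    by (intro Bochner_Integration.integral_cong) (auto simp: indicator_def rng, metis atLeastAtMost_iff imageI)
  finally show ?thesis by (simp add: \<gamma>_def)
qed

section \<open>Signed and vector measures\<close>

lemma vector_measure_sums:
  "vector_measure \<mu> \<Longrightarrow> (\<And>i. A i \<in> sets borel) \<Longrightarrow> disjoint_family A \<Longrightarrow> (\<lambda>i::nat. \<mu> (A i)) sums \<mu> (\<Union>i. A i)"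
  unfolding vector_measure_def by (metis image_subsetI)

lemma vector_measure_empty [simp]:
  assumes "vector_measure \<mu>" shows "\<mu> {} = 0"
proof -
  have "(\<lambda>i::nat. \<mu> {}) sums \<mu> (\<Union>i::nat. {})"
    by (rule vector_measure_sums[OF assms]) (auto simp: disjoint_family_on_def)
  then show ?thesis by (simp add: sums_iff summable_const_iff)
qed

lemma vector_measure_Un:
  assumes \<mu>: "vector_measure \<mu>" and AB: "A \<in> sets borel" "B \<in> sets borel" "A \<inter> B = {}"
  shows "\<mu> (A \<union> B) = \<mu> A + \<mu> B"
proof -
  define F where "F i = (if i = 0 then A else if i = 1 then B else {})" for i :: nat
  have "(\<lambda>i. \<mu> (F i)) sums \<mu> (\<Union>i. F i)"
    using AB by (intro vector_measure_sums[OF \<mu>]) (auto simp: F_def disjoint_family_on_def)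
  moreover have "(\<lambda>i. \<mu> (F i)) sums (\<Sum>i\<in>{0,1}. \<mu> (F i))"
    by (rule sums_finite) (auto simp: F_def \<mu>)
  moreover have "(\<Union>i. F i) = A \<union> B" by (auto simp: F_def split: if_splits)
  ultimately show ?thesis using sums_unique2 by (fastforce simp: F_def)
qed

lemma vector_measure_UN:
  assumes \<mu>: "vector_measure \<mu>" and "finite I" and "\<And>i. i \<in> I \<Longrightarrow> A i \<in> sets borel" and "disjoint_family_on A I"
  shows "\<mu> (\<Union>i\<in>I. A i) = (\<Sum>i\<in>I. \<mu> (A i))"
  using assms(2-)
proof (induction I)
  case empty then show ?case by (simp add: \<mu>)
next
  case (insert i I)
  have "\<mu> (A i \<union> (\<Union>i\<in>I. A i)) = \<mu> (A i) + \<mu> (\<Union>i\<in>I. A i)"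
    using insert by (intro vector_measure_Un[OF \<mu>]) (auto simp: disjoint_family_on_def)
  then show ?case using insert by (simp add: disjoint_family_on_def)
qed

lemma vector_measure_bounded_linear:
  "vector_measure \<mu> \<Longrightarrow> bounded_linear h \<Longrightarrow> vector_measure (\<lambda>A. h (\<mu> A))"
  unfolding vector_measure_def by (intro allI impI, rule bounded_linear.sums[of h]) auto

lemma vector_measure_diff:
  "vector_measure \<mu> \<Longrightarrow> vector_measure \<nu> \<Longrightarrow> vector_measure (\<lambda>A. \<mu> A - \<nu> A)"
  unfolding vector_measure_def by (intro allI impI sums_diff) auto

lemma vector_measure_minus:
  "vector_measure \<nu> \<Longrightarrow> vector_measure (\<lambda>A. - \<nu> A)"
  unfolding vector_measure_def by (intro allI impI sums_minus) auto

lemma vector_measure_sum: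
  fixes \<nu> :: "'i \<Rightarrow> 'a::topological_space set \<Rightarrow> 'v::real_normed_vector"
  assumes "\<And>a. a \<in> I \<Longrightarrow> vector_measure (\<nu> a)"
  shows "vector_measure (\<lambda>A. \<Sum>a\<in>I. \<nu> a A)"
  unfolding vector_measure_def
proof (intro allI impI sums_sum)
  fix A :: "nat \<Rightarrow> 'a set" and a assume "range A \<subseteq> sets borel" "disjoint_family A" "a \<in> I"
  then show "(\<lambda>i. \<nu> a (A i)) sums \<nu> a (\<Union>i. A i)"
    using assms[of a] unfolding vector_measure_def by metis
qed

lemma vector_measure_scale:
  fixes \<nu> :: "'a::topological_space set \<Rightarrow> real"
  shows "vector_measure \<nu> \<Longrightarrow> vector_measure (\<lambda>A. c * \<nu> A)"
  by (rule vector_measure_bounded_linear[where h = "\<lambda>x. c * x"], assumption, rule bounded_linear_mult_right)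

lemma vector_measure_vecI:
  fixes \<mu> :: "'a::topological_space set \<Rightarrow> 'v::real_normed_vector ^ 'n"
  assumes "\<And>i. vector_measure (\<lambda>A. \<mu> A $ i)"
  shows "vector_measure \<mu>"
  unfolding vector_measure_def sums_def
proof (intro allI impI vec_tendstoI)
  fix A :: "nat \<Rightarrow> 'a set" and i assume "range A \<subseteq> sets borel" "disjoint_family A"
  then show "(\<lambda>n. (\<Sum>k<n. \<mu> (A k)) $ i) \<longlonglongrightarrow> \<mu> (\<Union>i. A i) $ i"
    using assms[of i] by (simp add: vector_measure_def sums_def sum_component)
qed

lemma vector_measure_measure:
  assumes "finite_measure M" "sets M = sets borel"
  shows "vector_measure (measure M)"
proof -
  interpret finite_measure M by fact
  show ?thesis unfolding vector_measure_def using finite_measure_UNION by (simp add: assms(2))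
qed

text \<open>The complement of the support is a union of possibly uncountably many null open sets.
  Lindelof's theorem leaves countably many, which are made disjoint so that countable additivity
  applies.\<close>

lemma vector_measure_null:
  fixes \<mu> :: "'a::second_countable_topology set \<Rightarrow> 'v::real_normed_vector"
  assumes \<mu>: "vector_measure \<mu>" and A: "A \<in> sets borel" "A \<inter> vm_support \<mu> = {}"
  shows "\<mu> A = 0"
proof -
  define F where "F = {U. open U \<and> (\<forall>A\<in>sets borel. A \<subseteq> U \<longrightarrow> \<mu> A = 0)}"
  have "open S" if "S \<in> F" for S using that by (simp add: F_def)
  from Lindelof[OF this] obtain G where G: "G \<subseteq> F" "countable G" "\<Union>G = \<Union>F" by metis
  have AF: "A \<subseteq> \<Union>G" using A(2) G by (auto simp: vm_support_def F_def)
  show ?thesis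
  proof (cases "G = {}")
    case True then show ?thesis using AF \<mu> by simp
  next
    case False
    define U where "U = from_nat_into G"
    have U: "U i \<in> F" for i using from_nat_into[OF False] G(1) by (auto simp: U_def)
    have Ub: "U i \<in> sets borel" for i using U[of i] by (auto simp: F_def)
    have rg: "(\<Union>i. U i) = \<Union>G" using range_from_nat_into[OF False G(2)] by (simp add: U_def)
    have db: "disjointed U i \<in> sets borel" for i
      using sets.range_disjointed_sets[of U borel] Ub by auto
    have "(\<lambda>i. \<mu> (A \<inter> disjointed U i)) sums \<mu> (\<Union>i. A \<inter> disjointed U i)"
      using A(1) db disjoint_family_disjointed[of U]
      by (intro vector_measure_sums[OF \<mu>]) (auto simp: disjoint_family_on_def)
    moreover have "\<mu> (A \<inter> disjointed U i) = 0" for i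
    proof -
      have "A \<inter> disjointed U i \<subseteq> U i" using disjointed_subset[of U i] by blast
      moreover have "A \<inter> disjointed U i \<in> sets borel" using A(1) db[of i] by simp
      ultimately show ?thesis using U[of i] unfolding F_def by blast
    qed
    moreover have "(\<Union>i. A \<inter> disjointed U i) = A"
      using AF by (simp add: UN_disjointed_eq rg Int_absorb2 flip: Int_UN_distrib)
    ultimately show ?thesis by (simp add: sums_iff)
  qed
qed

section \<open>Boundedness and Jordan decomposition of signed measures\<close>

lemma signed_measure_bounded:
  fixes \<nu> :: "'a::topological_space set \<Rightarrow> real"
  assumes \<nu>: "vector_measure \<nu>"
  obtains M where "0 \<le> M" "\<And>A. A \<in> sets borel \<Longrightarrow> \<bar>\<nu> A\<bar> \<le> M"
proof -
  \<comment> \<open>A set with unbounded values on its subsets has such a subset whose removal costs at least 1;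
    iterating contradicts the convergence of \<open>\<nu>\<close> along the removed parts.\<close>
  define bad where "bad E \<longleftrightarrow> E \<in> sets borel \<and> (\<forall>K. \<exists>B\<in>sets borel. B \<subseteq> E \<and> K < \<bar>\<nu> B\<bar>)" for E
  have not_bad: "\<exists>K. \<forall>C\<in>sets borel. C \<subseteq> X \<longrightarrow> \<bar>\<nu> C\<bar> \<le> K" if "\<not> bad X" "X \<in> sets borel" for X
    using that unfolding bad_def by (meson not_less)
  have split: "\<exists>E'. bad E' \<and> E' \<subseteq> E \<and> 1 \<le> \<bar>\<nu> (E - E')\<bar>" if E: "bad E" for E
  proof -
    \<comment> \<open>The margin 1 over the value of E forces both B and E - B to have absolute
      value at least 1, so whichever of them is bad, the removed one costs at least 1.\<close>
    obtain B where B: "B \<in> sets borel" "B \<subseteq> E" "\<bar>\<nu> E\<bar> + 1 < \<bar>\<nu> B\<bar>" using E unfolding bad_def by blast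
    have Eb: "E \<in> sets borel" using E by (simp add: bad_def)
    have eq: "\<nu> E = \<nu> B + \<nu> (E - B)"
      using vector_measure_Un[OF \<nu> B(1), of "E - B"] B Eb by (simp add: Un_absorb1)
    then have ge: "1 \<le> \<bar>\<nu> B\<bar>" "1 \<le> \<bar>\<nu> (E - B)\<bar>" using B(3) by linarith+
    have "bad B \<or> bad (E - B)"
    proof (rule ccontr)
      assume "\<not> ?thesis"
      then have nb: "\<not> bad B" "\<not> bad (E - B)" by blast+
      obtain K where K: "\<forall>C\<in>sets borel. C \<subseteq> B \<longrightarrow> \<bar>\<nu> C\<bar> \<le> K"
        using not_bad[OF nb(1) B(1)] by blast
      obtain L where L: "\<forall>C\<in>sets borel. C \<subseteq> E - B \<longrightarrow> \<bar>\<nu> C\<bar> \<le> L"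
        using not_bad[OF nb(2)] B Eb by blast
      obtain C where C: "C \<in> sets borel" "C \<subseteq> E" "K + L < \<bar>\<nu> C\<bar>" using E unfolding bad_def by blast
      have "\<nu> C = \<nu> (C \<inter> B) + \<nu> (C - B)"
        using vector_measure_Un[OF \<nu>, of "C \<inter> B" "C - B"] B C by (simp add: Int_Diff_Un Int_Diff_disjoint)
      moreover have "\<bar>\<nu> (C \<inter> B)\<bar> \<le> K" by (rule K[rule_format]) (use B C in auto)
      moreover have "\<bar>\<nu> (C - B)\<bar> \<le> L" by (rule L[rule_format]) (use B C in auto)
      ultimately show False using C(3) by linarith
    qed
    then show ?thesis
    proof
      assume "bad B" then show ?thesis using B ge by blast
    next
      assume "bad (E - B)"
      moreover have "E - (E - B) = B" using B by blast
      ultimately show ?thesis using ge by (intro exI[of _ "E - B"]) auto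
    qed
  qed
  have "\<not> bad UNIV"
  proof
    assume bad: "bad UNIV"
    have "\<exists>E. \<forall>k::nat. bad (E k) \<and> (E (Suc k) \<subseteq> E k \<and> 1 \<le> \<bar>\<nu> (E k - E (Suc k))\<bar>)"
      by (rule dependent_nat_choice[of "\<lambda>_. bad"]) (use bad split in blast)+
    then obtain E where E: "\<And>k::nat. bad (E k)" "\<And>k. E (Suc k) \<subseteq> E k" "\<And>k. 1 \<le> \<bar>\<nu> (E k - E (Suc k))\<bar>"
      by blast
    have dec: "decseq E" using E(2) by (rule decseq_SucI)
    have "(\<lambda>k. \<nu> (E k - E (Suc k))) sums \<nu> (\<Union>k. E k - E (Suc k))"
    proof (rule vector_measure_sums[OF \<nu>])
      show "E k - E (Suc k) \<in> sets borel" for k using E(1) by (auto simp: bad_def)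
      have "(E i - E (Suc i)) \<inter> (E j - E (Suc j)) = {}" if "i < j" for i j
        using decseqD[OF dec, of "Suc i" j] that by auto
      then show "disjoint_family (\<lambda>k. E k - E (Suc k))"
        unfolding disjoint_family_on_def by (metis inf_commute nat_neq_iff)
    qed
    then have "(\<lambda>k. \<nu> (E k - E (Suc k))) \<longlonglongrightarrow> 0" by (simp add: summable_LIMSEQ_zero sums_iff)
    from LIMSEQ_D[OF this, of 1] obtain k where "\<bar>\<nu> (E k - E (Suc k))\<bar> < 1" by auto
    then show False using E(3)[of k] by simp
  qed
  from not_bad[OF this] obtain K where "\<And>B. B \<in> sets borel \<Longrightarrow> \<bar>\<nu> B\<bar> \<le> K" by auto
  then show ?thesis using that[of "\<bar>K\<bar>"] by (meson abs_ge_zero abs_ge_self order_trans)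
qed

text \<open>Subadditivity comes from cutting a competitor B along the A i, finite superadditivity
  from uniting competitors of disjoint sets. As for Hausdorff measure, \<open>measure_of\<close>
  would otherwise fall back to zero.\<close>

lemma measure_space_jordan:
  fixes \<nu> :: "'a::topological_space set \<Rightarrow> real"
  assumes \<nu>: "vector_measure \<nu>"
  shows "measure_space UNIV (sets borel) (\<lambda>A. SUP B\<in>{B \<in> sets borel. B \<subseteq> A}. ennreal (\<nu> B))" (is "measure_space _ _ ?p")
proof -
  have pos: "positive (sets borel) ?p"
  proof -
    have "{B \<in> sets borel. B \<subseteq> ({}::'a set)} = {{}}" by auto
    then show ?thesis by (simp add: positive_def \<nu>)
  qed
  have ca: "countably_additive (sets borel) ?p"
    unfolding countably_additive_def
  proof (intro allI impI)
    fix A :: "nat \<Rightarrow> 'a set"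
    assume A: "range A \<subseteq> sets borel" "disjoint_family A" "(\<Union>i. A i) \<in> sets borel"
    have Ab: "A i \<in> sets borel" for i using A(1) by auto
    show "(\<Sum>i. ?p (A i)) = ?p (\<Union>i. A i)"
    proof (rule antisym)
      show "?p (\<Union>i. A i) \<le> (\<Sum>i. ?p (A i))"
      proof (rule SUP_least, clarify)
        fix B assume B: "B \<in> sets borel" "B \<subseteq> (\<Union>i. A i)"
        have "(\<lambda>i. \<nu> (B \<inter> A i)) sums \<nu> (\<Union>i. B \<inter> A i)"
          using A Ab B by (intro vector_measure_sums[OF \<nu>]) (auto simp: disjoint_family_on_def)
        moreover have "(\<Union>i. B \<inter> A i) = B" using B by auto
        ultimately have s: "(\<lambda>i. \<nu> (B \<inter> A i)) sums \<nu> B" by simp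
        have "ennreal (\<nu> B) \<le> (\<Sum>i. ennreal (\<nu> (B \<inter> A i)))"
        proof (rule LIMSEQ_le_const2[OF tendsto_ennrealI[OF s[unfolded sums_def]]])
          have "ennreal (\<Sum>i<n. \<nu> (B \<inter> A i)) \<le> (\<Sum>i. ennreal (\<nu> (B \<inter> A i)))" for n
          proof -
            have "ennreal (\<Sum>i<n. \<nu> (B \<inter> A i)) \<le> ennreal (\<Sum>i<n. max 0 (\<nu> (B \<inter> A i)))"
              by (intro ennreal_leI sum_mono) auto
            also have "\<dots> = (\<Sum>i<n. ennreal (max 0 (\<nu> (B \<inter> A i))))"
              by simp
            also have "\<dots> = (\<Sum>i<n. ennreal (\<nu> (B \<inter> A i)))"
              by (intro sum.cong refl) (simp add: max_def ennreal_neg)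
            also have "\<dots> \<le> (\<Sum>i. ennreal (\<nu> (B \<inter> A i)))" by (intro sum_le_suminf summableI) auto
            finally show ?thesis .
          qed
          then show "\<exists>N. \<forall>n\<ge>N. ennreal (\<Sum>i<n. \<nu> (B \<inter> A i)) \<le> (\<Sum>i. ennreal (\<nu> (B \<inter> A i)))" by blast
        qed
        also have "\<dots> \<le> (\<Sum>i. ?p (A i))"
          using B Ab by (intro suminf_le summableI SUP_upper) auto
        finally show "ennreal (\<nu> B) \<le> (\<Sum>i. ?p (A i))" .
      qed
      have sup: "?p X + ?p Y \<le> ?p (X \<union> Y)" if X: "X \<in> sets borel" "Y \<in> sets borel" "X \<inter> Y = {}" for X Y
      proof -
        have nn: "ennreal (\<nu> B) + ennreal (\<nu> C) \<le> ?p (X \<union> Y)"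
          if B: "B \<in> sets borel" "B \<subseteq> X" "C \<in> sets borel" "C \<subseteq> Y" for B C
        proof -
          \<comment> \<open>\<open>ennreal\<close> truncates negative reals to 0, so it is additive
            only in the first case; in the other two one summand disappears.\<close>
          consider "0 \<le> \<nu> B" "0 \<le> \<nu> C" | "\<nu> B \<le> 0" | "\<nu> C \<le> 0" by linarith
          then show ?thesis
          proof cases
            case 1
            have "B \<inter> C = {}" using B X by blast
            then have "\<nu> (B \<union> C) = \<nu> B + \<nu> C" by (rule vector_measure_Un[OF \<nu> B(1,3)])
            with 1 have "ennreal (\<nu> B) + ennreal (\<nu> C) = ennreal (\<nu> (B \<union> C))" by simp
            also have "\<dots> \<le> ?p (X \<union> Y)" using B by (intro SUP_upper) auto
            finally show ?thesis .
          next
            case 2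
            then have "ennreal (\<nu> B) + ennreal (\<nu> C) = ennreal (\<nu> C)" by (simp add: ennreal_neg)
            also have "\<dots> \<le> ?p (X \<union> Y)" using B by (intro SUP_upper) auto
            finally show ?thesis .
          next
            case 3
            then have "ennreal (\<nu> B) + ennreal (\<nu> C) = ennreal (\<nu> B)" by (simp add: ennreal_neg)
            also have "\<dots> \<le> ?p (X \<union> Y)" using B by (intro SUP_upper) auto
            finally show ?thesis .
          qed
        qed
        have ne: "{B \<in> sets borel. B \<subseteq> Z} \<noteq> {}" for Z :: "'a set" by blast
        have "?p X + ennreal (\<nu> C) \<le> ?p (X \<union> Y)" if "C \<in> sets borel" "C \<subseteq> Y" for C
          using nn that by (subst ennreal_SUP_add_left[OF ne, symmetric]) (auto intro!: SUP_least)
        then show ?thesis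
          by (subst ennreal_SUP_add_right[OF ne]) (auto intro!: SUP_least)
      qed
      have fin: "(\<Sum>i<n. ?p (A i)) \<le> ?p (\<Union>i<n. A i)" for n
      proof (induction n)
        case 0 then show ?case by simp
      next
        case (Suc n)
        have "(\<Sum>i<Suc n. ?p (A i)) \<le> ?p (\<Union>i<n. A i) + ?p (A n)" using Suc by (simp add: add_right_mono)
        also have "\<dots> \<le> ?p ((\<Union>i<n. A i) \<union> A n)"
          using disjoint_family_onD[OF A(2), of _ n] Ab by (intro sup) force+
        also have "(\<Union>i<n. A i) \<union> A n = (\<Union>i<Suc n. A i)" by (auto simp: less_Suc_eq)
        finally show ?case .
      qed
      show "(\<Sum>i. ?p (A i)) \<le> ?p (\<Union>i. A i)"
      proof (rule suminf_le_const[OF summableI])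
        fix n
        have "?p (\<Union>i<n. A i) \<le> ?p (\<Union>i. A i)" by (intro SUP_subset_mono) auto
        with fin[of n] show "(\<Sum>i<n. ?p (A i)) \<le> ?p (\<Union>i. A i)" by (rule order_trans)
      qed
    qed
  qed
  show ?thesis using pos ca sets.sigma_algebra_axioms[of "borel :: 'a measure"] by (simp add: measure_space_def)
qed

lemma sets_jordan [simp, measurable_cong]: "sets (jordan_pos \<nu>) = sets borel"
  unfolding jordan_pos_def by (simp add: sets.sigma_sets_eq[of borel, simplified])

lemma space_jordan [simp]: "space (jordan_pos \<nu>) = UNIV"
  unfolding jordan_pos_def by simp

lemma emeasure_jordan:
  "vector_measure \<nu> \<Longrightarrow> A \<in> sets borel \<Longrightarrow>
    emeasure (jordan_pos \<nu>) A = (SUP B\<in>{B \<in> sets borel. B \<subseteq> A}. ennreal (\<nu> B))"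
  unfolding jordan_pos_def using measure_space_jordan[of \<nu>]
  by (intro emeasure_measure_of_sigma) (auto simp: measure_space_def sets.sigma_algebra_axioms[of borel, simplified])

lemma emeasure_jordan_le:
  assumes "vector_measure \<nu>" "A \<in> sets borel" "\<And>B. B \<in> sets borel \<Longrightarrow> B \<subseteq> A \<Longrightarrow> \<nu> B \<le> M"
  shows "emeasure (jordan_pos \<nu>) A \<le> ennreal M"
  unfolding emeasure_jordan[OF assms(1,2)] by (rule SUP_least) (auto intro: ennreal_leI assms)

lemma finite_measure_jordan:
  assumes \<nu>: "vector_measure \<nu>" shows "finite_measure (jordan_pos \<nu>)"
proof -
  obtain M where "\<And>A. A \<in> sets borel \<Longrightarrow> \<bar>\<nu> A\<bar> \<le> M" using signed_measure_bounded[OF \<nu>] by blast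
  then have "emeasure (jordan_pos \<nu>) UNIV \<le> ennreal M"
    by (intro emeasure_jordan_le[OF \<nu>]) (auto intro: abs_le_D1)
  then show ?thesis by (intro finite_measureI) (auto simp: top_unique)
qed

text \<open>For B inside A, the value of B is that of A minus that of A - B, so the supremum over B
  exceeds the value of A by at most the negative part. Applied to the negated measure, the same
  bound gives the reverse inequality.\<close>

lemma jordan_decomposition:
  assumes \<nu>: "vector_measure \<nu>" and A: "A \<in> sets borel"
  shows "measure (jordan_pos \<nu>) A - measure (jordan_pos (\<lambda>A. - \<nu> A)) A = \<nu> A"
proof -
  have le: "measure (jordan_pos \<nu>) A - \<nu> A \<le> measure (jordan_pos (\<lambda>A. - \<nu> A)) A"
    if \<nu>: "vector_measure \<nu>" for \<nu> :: "'a set \<Rightarrow> real"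
  proof -
    interpret p: finite_measure "jordan_pos \<nu>" by (rule finite_measure_jordan[OF \<nu>])
    interpret q: finite_measure "jordan_pos (\<lambda>A. - \<nu> A)" by (rule finite_measure_jordan[OF vector_measure_minus[OF \<nu>]])
    have B: "\<nu> B \<le> \<nu> A + measure (jordan_pos (\<lambda>A. - \<nu> A)) A" if "B \<in> sets borel" "B \<subseteq> A" for B
    proof -
      have "ennreal (- \<nu> (A - B)) \<le> emeasure (jordan_pos (\<lambda>A. - \<nu> A)) A"
        unfolding emeasure_jordan[OF vector_measure_minus[OF \<nu>] A] using A that
        by (intro SUP_upper) auto
      then have "- \<nu> (A - B) \<le> measure (jordan_pos (\<lambda>A. - \<nu> A)) A"
        by (simp add: q.emeasure_eq_measure)
      moreover have "\<nu> A = \<nu> B + \<nu> (A - B)"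
        using vector_measure_Un[OF \<nu>, of B "A - B"] A that by (simp add: Un_absorb1)
      ultimately show ?thesis by simp
    qed
    then have "emeasure (jordan_pos \<nu>) A \<le> ennreal (\<nu> A + measure (jordan_pos (\<lambda>A. - \<nu> A)) A)"
      by (intro emeasure_jordan_le[OF \<nu> A])
    moreover have "0 \<le> \<nu> A + measure (jordan_pos (\<lambda>A. - \<nu> A)) A" using B[of "{}"] \<nu> by simp
    ultimately show ?thesis by (simp add: p.emeasure_eq_measure)
  qed
  from le[OF \<nu>] le[OF vector_measure_minus[OF \<nu>]] show ?thesis by simp
qed

section \<open>Integration against signed measures\<close>

lemma integrable_bounded_borel:
  fixes f :: "'a::topological_space \<Rightarrow> real"
  assumes "finite_measure M" "sets M = sets borel" "f \<in> borel_measurable borel" "\<And>x. \<bar>f x\<bar> \<le> K"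
  shows "integrable M f"
  using assms by (intro finite_measure.integrable_const_bound[where B = K]) (auto cong: measurable_cong_sets)

context
  fixes \<nu> :: "'a::topological_space set \<Rightarrow> real"
  assumes \<nu>: "vector_measure \<nu>"
begin

lemma signed_integral_add:
  assumes "f \<in> borel_measurable borel" "\<And>x. \<bar>f x\<bar> \<le> K" "g \<in> borel_measurable borel" "\<And>x. \<bar>g x\<bar> \<le> L"
  shows "signed_integral \<nu> (\<lambda>x. f x + g x) = signed_integral \<nu> f + signed_integral \<nu> g"
  unfolding signed_integral_def
  by (simp add: Bochner_Integration.integral_add integrable_bounded_borel[OF _ _ assms(1,2)] integrable_bounded_borel[OF _ _ assms(3,4)]
      finite_measure_jordan \<nu> vector_measure_minus)

lemma signed_integral_mult: "signed_integral \<nu> (\<lambda>x. c * f x) = c * signed_integral \<nu> f"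
  unfolding signed_integral_def by (simp add: algebra_simps)

lemma signed_integral_diff:
  assumes "f \<in> borel_measurable borel" "\<And>x. \<bar>f x\<bar> \<le> K" "g \<in> borel_measurable borel" "\<And>x. \<bar>g x\<bar> \<le> L"
  shows "signed_integral \<nu> (\<lambda>x. f x - g x) = signed_integral \<nu> f - signed_integral \<nu> g"
  unfolding signed_integral_def
  by (simp add: Bochner_Integration.integral_diff integrable_bounded_borel[OF _ _ assms(1,2)] integrable_bounded_borel[OF _ _ assms(3,4)]
      finite_measure_jordan \<nu> vector_measure_minus)

lemma signed_integral_indicator: "A \<in> sets borel \<Longrightarrow> signed_integral \<nu> (indicator A) = \<nu> A"
  using jordan_decomposition[OF \<nu>, of A] by (simp add: signed_integral_def)

lemma signed_integral_const: "signed_integral \<nu> (\<lambda>_. c) = c * \<nu> UNIV"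
  using jordan_decomposition[OF \<nu>, of UNIV] by (simp add: signed_integral_def flip: left_diff_distrib)

lemma signed_integral_step:
  assumes "finite I" "\<And>k. k \<in> I \<Longrightarrow> A k \<in> sets borel"
  shows "signed_integral \<nu> (\<lambda>x. \<Sum>k\<in>I. r k * indicator (A k) x) = (\<Sum>k\<in>I. r k * \<nu> (A k))"
  using assms
proof (induction I)
  case empty then show ?case by (simp add: signed_integral_def)
next
  case (insert i I)
  have "\<bar>\<Sum>k\<in>I. r k * indicator (A k) x\<bar> \<le> (\<Sum>k\<in>I. \<bar>r k\<bar>)" for x
    by (rule order_trans[OF sum_abs sum_mono]) (auto simp: indicator_def)
  then have "signed_integral \<nu> (\<lambda>x. r i * indicator (A i) x + (\<Sum>k\<in>I. r k * indicator (A k) x)) =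
      signed_integral \<nu> (\<lambda>x. r i * indicator (A i) x) + signed_integral \<nu> (\<lambda>x. \<Sum>k\<in>I. r k * indicator (A k) x)"
    using insert.prems by (intro signed_integral_add[where K = "\<bar>r i\<bar>"]) (auto simp: indicator_def)
  then show ?case
    by (simp only: sum.insert[OF insert(1,2)] insert.IH[OF insert.prems(1)[OF insertI2]]
        signed_integral_mult signed_integral_indicator[OF insert.prems(1)[OF insertI1]])
qed

text \<open>Each of the two Jordan parts has total mass at most M, hence the factor 2.\<close>

lemma signed_integral_bound:
  assumes f: "f \<in> borel_measurable borel" "\<And>x. \<bar>f x\<bar> \<le> K" and M: "\<And>A. A \<in> sets borel \<Longrightarrow> \<bar>\<nu> A\<bar> \<le> M"
  shows "\<bar>signed_integral \<nu> f\<bar> \<le> 2 * M * K"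
proof -
  have K: "0 \<le> K" by (rule order_trans[OF abs_ge_zero f(2)])
  have M0: "0 \<le> M" using M[of UNIV] by simp
  have *: "\<bar>integral\<^sup>L (jordan_pos \<nu>) f\<bar> \<le> M * K"
    if \<nu>: "vector_measure \<nu>" and M: "\<And>A. A \<in> sets borel \<Longrightarrow> \<nu> A \<le> M" for \<nu>
  proof -
    interpret p: finite_measure "jordan_pos \<nu>" by (rule finite_measure_jordan[OF \<nu>])
    have "emeasure (jordan_pos \<nu>) UNIV \<le> ennreal M" using M by (intro emeasure_jordan_le[OF \<nu>]) auto
    then have m: "measure (jordan_pos \<nu>) UNIV \<le> M" using M0 by (simp add: p.emeasure_eq_measure)
    have "\<bar>integral\<^sup>L (jordan_pos \<nu>) f\<bar> \<le> (LINT x|jordan_pos \<nu>. \<bar>f x\<bar>)" by (rule integral_abs_bound)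
    also have "\<dots> \<le> (LINT x|jordan_pos \<nu>. K)"
      using f K by (intro integral_mono integrable_bounded_borel[OF p.finite_measure_axioms, of _ K]) auto
    also have "\<dots> \<le> M * K" using m K by (simp add: mult_right_mono)
    finally show ?thesis .
  qed
  have "\<bar>integral\<^sup>L (jordan_pos \<nu>) f\<bar> \<le> M * K"
    using M by (intro *[OF \<nu>]) (simp add: abs_le_iff)
  moreover have "\<bar>integral\<^sup>L (jordan_pos (\<lambda>A. - \<nu> A)) f\<bar> \<le> M * K"
    using M by (intro *[OF vector_measure_minus[OF \<nu>]]) (simp add: abs_le_iff)
  ultimately show ?thesis unfolding signed_integral_def by linarith
qed

end

text \<open>The Jordan parts of a sum are not the sums of the Jordan parts, so linearity in the
  measure is obtained through f: rounding f down to multiples of e gives a step function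
  \<open>g\<close>, whose integrals only involve values of the measures, and the error is at most a
  constant times e.\<close>

lemma signed_integral_lincomb_zero:
  fixes \<nu> :: "'i \<Rightarrow> 'a::topological_space set \<Rightarrow> real"
  assumes I: "finite I" and \<nu>: "\<And>a. a \<in> I \<Longrightarrow> vector_measure (\<nu> a)"
    and zero: "\<And>A. A \<in> sets borel \<Longrightarrow> (\<Sum>a\<in>I. c a * \<nu> a A) = 0"
    and f [measurable]: "f \<in> borel_measurable borel" and K: "\<And>x. \<bar>f x\<bar> \<le> K"
  shows "(\<Sum>a\<in>I. c a * signed_integral (\<nu> a) f) = 0"
proof -
  have "\<exists>M. \<forall>A\<in>sets borel. \<bar>\<nu> a A\<bar> \<le> M" if "a \<in> I" for a
    using signed_measure_bounded[OF \<nu>[OF that]] by metis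
  then obtain M where M: "\<And>a A. a \<in> I \<Longrightarrow> A \<in> sets borel \<Longrightarrow> \<bar>\<nu> a A\<bar> \<le> M a" by metis
  define S where "S = (\<Sum>a\<in>I. \<bar>c a\<bar> * (2 * M a))"
  have S: "0 \<le> S" unfolding S_def using M[of _ UNIV] by (intro sum_nonneg mult_nonneg_nonneg) force+
  have bd: "\<bar>\<Sum>a\<in>I. c a * signed_integral (\<nu> a) f\<bar> \<le> S * e" if e: "0 < e" for e
  proof -
    define J where "J = {\<lfloor>- K / e\<rfloor> .. \<lfloor>K / e\<rfloor>}"
    define A where "A k = {x. \<lfloor>f x / e\<rfloor> = k}" for k
    have A [measurable]: "A k \<in> sets borel" for k unfolding A_def by measurable
    define g where "g x = (\<Sum>k\<in>J. (e * of_int k) * indicator (A k) x)" for x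
    have g: "g x = e * of_int \<lfloor>f x / e\<rfloor>" for x
    proof -
      have "- K / e \<le> f x / e" "f x / e \<le> K / e"
        using K[of x] e by (intro divide_right_mono; linarith)+
      then have "\<lfloor>f x / e\<rfloor> \<in> J" unfolding J_def by (auto intro: floor_mono)
      then have "g x = (\<Sum>k\<in>J. if k = \<lfloor>f x / e\<rfloor> then e * of_int k else 0)"
        unfolding g_def A_def by (intro sum.cong) (auto simp: indicator_def)
      then show ?thesis using \<open>\<lfloor>f x / e\<rfloor> \<in> J\<close> by (simp add: J_def)
    qed
    have gm [measurable]: "g \<in> borel_measurable borel" unfolding g by measurable
    have fg: "\<bar>f x - g x\<bar> \<le> e" for x
    proof -
      have "e * of_int \<lfloor>f x / e\<rfloor> \<le> e * (f x / e)" "e * (f x / e) \<le> e * (of_int \<lfloor>f x / e\<rfloor> + 1)"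
        using e by (intro mult_left_mono; linarith)+
      then show ?thesis using e by (simp add: g abs_le_iff algebra_simps)
    qed
    have gK: "\<bar>g x\<bar> \<le> K + e" for x using K[of x] fg[of x] by linarith
    have "signed_integral (\<nu> a) g = (\<Sum>k\<in>J. (e * of_int k) * \<nu> a (A k))" if "a \<in> I" for a
      unfolding g_def by (rule signed_integral_step[OF \<nu>[OF that]]) (auto simp: J_def)
    then have "(\<Sum>a\<in>I. c a * signed_integral (\<nu> a) g) = (\<Sum>a\<in>I. c a * (\<Sum>k\<in>J. (e * of_int k) * \<nu> a (A k)))"
      by (intro sum.cong) auto
    also have "\<dots> = (\<Sum>k\<in>J. (e * of_int k) * (\<Sum>a\<in>I. c a * \<nu> a (A k)))"
      unfolding sum_distrib_left by (subst sum.swap) (simp add: ac_simps)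
    also have "\<dots> = 0" by (simp add: zero)
    finally have "(\<Sum>a\<in>I. c a * signed_integral (\<nu> a) f) = (\<Sum>a\<in>I. c a * signed_integral (\<nu> a) (\<lambda>x. f x - g x))"
      by (simp add: signed_integral_diff[OF \<nu> f K gm gK] right_diff_distrib sum_subtractf)
    also have "\<bar>\<dots>\<bar> \<le> (\<Sum>a\<in>I. \<bar>c a\<bar> * (2 * M a * e))"
      using \<nu> M fg by (intro order_trans[OF sum_abs sum_mono])
        (auto simp: abs_mult intro!: mult_left_mono signed_integral_bound)
    also have "\<dots> = S * e" unfolding S_def sum_distrib_right by (simp add: ac_simps)
    finally show ?thesis .
  qed
  have "\<bar>\<Sum>a\<in>I. c a * signed_integral (\<nu> a) f\<bar> \<le> 0"
  proof (rule field_le_epsilon)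
    fix e :: real assume e: "0 < e"
    have "\<bar>\<Sum>a\<in>I. c a * signed_integral (\<nu> a) f\<bar> \<le> S * (e / (S + 1))" using S e by (intro bd) simp
    also have "\<dots> \<le> 0 + e" using S e by (simp add: field_simps)
    finally show "\<bar>\<Sum>a\<in>I. c a * signed_integral (\<nu> a) f\<bar> \<le> 0 + e" .
  qed
  then show ?thesis by simp
qed

lemma signed_integral_lincomb:
  fixes \<nu> :: "'i \<Rightarrow> 'a::topological_space set \<Rightarrow> real"
  assumes I: "finite I" and \<nu>: "\<And>a. a \<in> I \<Longrightarrow> vector_measure (\<nu> a)" and \<mu>: "vector_measure \<mu>"
    and eq: "\<And>A. A \<in> sets borel \<Longrightarrow> \<mu> A = (\<Sum>a\<in>I. c a * \<nu> a A)"
    and f: "f \<in> borel_measurable borel" "\<And>x. \<bar>f x\<bar> \<le> K"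
  shows "signed_integral \<mu> f = (\<Sum>a\<in>I. c a * signed_integral (\<nu> a) f)"
proof -
  \<comment> \<open>The index \<open>None\<close> carries \<open>\<mu>\<close> with coefficient -1,
    which turns the identity into a vanishing combination.\<close>
  have "(\<Sum>b\<in>insert None (Some ` I). (case b of None \<Rightarrow> -1 | Some a \<Rightarrow> c a) *
      signed_integral (case b of None \<Rightarrow> \<mu> | Some a \<Rightarrow> \<nu> a) f) = 0"
    using assms by (intro signed_integral_lincomb_zero[where K = K]) (auto simp: sum.reindex)
  then show ?thesis using I by (simp add: sum.reindex)
qed

lemma signed_integral_measure:
  fixes M :: "'a::topological_space measure"
  assumes M: "finite_measure M" "sets M = sets borel"
  shows "signed_integral (measure M) f = integral\<^sup>L M f"
proof -
  interpret finite_measure M by fact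
  note vm = vector_measure_measure[OF M]
  have "jordan_pos (measure M) = M"
  proof (rule measure_eqI)
    fix A assume "A \<in> sets (jordan_pos (measure M))"
    then have A: "A \<in> sets borel" by simp
    have "emeasure M A \<le> emeasure (jordan_pos (measure M)) A"
      unfolding emeasure_jordan[OF vm A] emeasure_eq_measure using A by (intro SUP_upper) auto
    moreover have "emeasure (jordan_pos (measure M)) A \<le> emeasure M A"
      unfolding emeasure_eq_measure using A M(2) by (intro emeasure_jordan_le[OF vm A] finite_measure_mono) auto
    ultimately show "emeasure (jordan_pos (measure M)) A = emeasure M A" by simp
  qed (simp add: M)
  moreover have "integral\<^sup>L (jordan_pos (\<lambda>A. - measure M A)) f = 0"
  proof -
    have "emeasure (jordan_pos (\<lambda>A. - measure M A)) UNIV \<le> ennreal 0"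
      by (intro emeasure_jordan_le vector_measure_minus vm) auto
    then have "AE x in jordan_pos (\<lambda>A. - measure M A). False"
      by (intro AE_I[of _ _ UNIV]) auto
    then have "integral\<^sup>L (jordan_pos (\<lambda>A. - measure M A)) f = integral\<^sup>L (jordan_pos (\<lambda>A. - measure M A)) (\<lambda>_. 0)"
      by (intro integral_eq_zero_AE[THEN trans]) auto
    then show ?thesis by simp
  qed
  ultimately show ?thesis by (simp add: signed_integral_def)
qed

text \<open>Convergence that is uniform over all Borel sets preserves countable additivity, by an
  e/3 argument, and carries over to integrals of bounded functions.\<close>

lemma signed_measure_uniform_limit:
  fixes \<nu> :: "nat \<Rightarrow> 'a::topological_space set \<Rightarrow> real"
  assumes \<nu>: "\<And>t. vector_measure (\<nu> t)" and \<epsilon>: "\<epsilon> \<longlonglongrightarrow> 0"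
    and bd: "\<And>t A. A \<in> sets borel \<Longrightarrow> \<bar>\<nu> t A - \<mu> A\<bar> \<le> \<epsilon> t"
  shows "vector_measure \<mu>"
    and "f \<in> borel_measurable borel \<Longrightarrow> (\<And>x. \<bar>f x\<bar> \<le> K) \<Longrightarrow> (\<lambda>t. signed_integral (\<nu> t) f) \<longlonglongrightarrow> signed_integral \<mu> f"
proof -
  show \<mu>: "vector_measure \<mu>" unfolding vector_measure_def
  proof (intro allI impI)
    fix A :: "nat \<Rightarrow> 'a set" assume A: "range A \<subseteq> sets borel" "disjoint_family A"
    have Ab: "A i \<in> sets borel" for i using A(1) by auto
    \<comment> \<open>The error does not grow with n: the limit is still finitely additive, so both
      sums are values on the single set that is the union of the first n sets.\<close>
    have fin: "\<bar>(\<Sum>i<n. \<nu> t (A i)) - (\<Sum>i<n. \<mu> (A i))\<bar> \<le> \<epsilon> t" for n t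
    proof -
      have lim: "(\<lambda>t. \<nu> t B) \<longlonglongrightarrow> \<mu> B" if "B \<in> sets borel" for B
        using that by (intro LIM_zero_cancel[OF Lim_null_comparison[OF always_eventually \<epsilon>]]) (auto intro: bd)
      have u: "\<nu> t (\<Union>i<n. A i) = (\<Sum>i<n. \<nu> t (A i))" for t
        using A Ab by (intro vector_measure_UN \<nu>) (auto simp: disjoint_family_on_def)
      have "(\<lambda>t. \<Sum>i<n. \<nu> t (A i)) \<longlonglongrightarrow> (\<Sum>i<n. \<mu> (A i))" using Ab by (intro tendsto_sum lim) auto
      moreover have "(\<lambda>t. \<Sum>i<n. \<nu> t (A i)) \<longlonglongrightarrow> \<mu> (\<Union>i<n. A i)"
        unfolding u[symmetric] using Ab by (intro lim) auto
      ultimately have "(\<Sum>i<n. \<mu> (A i)) = \<mu> (\<Union>i<n. A i)" by (rule LIMSEQ_unique)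
      then show ?thesis unfolding u[symmetric] using Ab by (auto intro!: bd)
    qed
    show "(\<lambda>i. \<mu> (A i)) sums \<mu> (\<Union>i. A i)" unfolding sums_def
    proof (rule LIMSEQ_I)
      fix e :: real assume e: "0 < e"
      have "eventually (\<lambda>t. \<epsilon> t < e / 3) sequentially" using e by (intro order_tendstoD[OF \<epsilon>]) simp
      then obtain t where t: "\<epsilon> t < e / 3" by (auto simp: eventually_sequentially)
      have "(\<lambda>i. \<nu> t (A i)) sums \<nu> t (\<Union>i. A i)" using A Ab by (intro vector_measure_sums \<nu>) auto
      then obtain N where N: "\<And>n. n \<ge> N \<Longrightarrow> \<bar>(\<Sum>i<n. \<nu> t (A i)) - \<nu> t (\<Union>i. A i)\<bar> < e / 3"
        using LIMSEQ_D[of "\<lambda>n. \<Sum>i<n. \<nu> t (A i)" _ "e / 3"] e unfolding sums_def by fastforce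
      have "\<bar>(\<Sum>i<n. \<mu> (A i)) - \<mu> (\<Union>i. A i)\<bar> < e" if "n \<ge> N" for n
      proof -
        have "\<bar>\<nu> t (\<Union>i. A i) - \<mu> (\<Union>i. A i)\<bar> \<le> \<epsilon> t" using Ab by (intro bd) auto
        then show ?thesis using N[OF that] fin[where n = n and t = t] t by linarith
      qed
      then show "\<exists>N. \<forall>n\<ge>N. norm ((\<Sum>i<n. \<mu> (A i)) - \<mu> (\<Union>i. A i)) < e" by auto
    qed
  qed
  assume f: "f \<in> borel_measurable borel" "\<And>x. \<bar>f x\<bar> \<le> K"
  have "\<bar>signed_integral (\<nu> t) f - signed_integral \<mu> f\<bar> \<le> 2 * \<epsilon> t * K" for t
  proof -
    have vd: "vector_measure (\<lambda>A. \<nu> t A - \<mu> A)" by (intro vector_measure_diff \<nu> \<mu>)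
    have "signed_integral (\<lambda>A. \<nu> t A - \<mu> A) f =
        (\<Sum>a\<in>UNIV. (if a then 1 else -1) * signed_integral (if a then \<nu> t else \<mu>) f)"
      by (rule signed_integral_lincomb[OF _ _ vd _ f]) (auto simp: \<nu> \<mu> UNIV_bool)
    also have "\<dots> = signed_integral (\<nu> t) f - signed_integral \<mu> f" by (simp add: UNIV_bool)
    finally show ?thesis using signed_integral_bound[OF vd f bd] by simp
  qed
  then have "\<forall>\<^sub>F t in sequentially. norm (signed_integral (\<nu> t) f - signed_integral \<mu> f) \<le> 2 * \<epsilon> t * K"
    by simp
  moreover have "(\<lambda>t. 2 * \<epsilon> t * K) \<longlonglongrightarrow> 0" using tendsto_mult[OF tendsto_mult[OF tendsto_const \<epsilon>] tendsto_const, of 2 K] by simp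
  ultimately have "(\<lambda>t. signed_integral (\<nu> t) f - signed_integral \<mu> f) \<longlonglongrightarrow> 0" by (rule Lim_null_comparison)
  then show "(\<lambda>t. signed_integral (\<nu> t) f) \<longlonglongrightarrow> signed_integral \<mu> f" by (rule LIM_zero_cancel)
qed

section \<open>Polyhedral currents on a grid\<close>

definition seg_pt :: "real ^ 'n \<Rightarrow> 'n \<Rightarrow> real \<Rightarrow> real ^ 'n" where
  "seg_pt p i s = p + s *\<^sub>R axis i 1"

lemma seg_pt_nth: "seg_pt p i s $ k = (if k = i then p $ i + s else p $ k)"
  by (simp add: seg_pt_def axis_def)

lemma continuous_seg_pt [continuous_intros]: "continuous_on S (seg_pt p i)"
  unfolding seg_pt_def by (intro continuous_intros)

definition seg_integral :: "real ^ 'n \<Rightarrow> 'n \<Rightarrow> real \<Rightarrow> (real ^ 'n \<Rightarrow> real) \<Rightarrow> real" where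
  "seg_integral p i l g = integral {0..l} (\<lambda>s. g (seg_pt p i s))"

lemma continuous_on_seg:
  "continuous_on UNIV g \<Longrightarrow> continuous_on S (\<lambda>s. g (seg_pt p i s))"
  by (rule continuous_on_compose2[of UNIV g]) (auto intro: continuous_seg_pt)

lemma seg_integral_split:
  assumes g: "continuous_on UNIV g" and l: "0 \<le> l" "0 \<le> r"
  shows "seg_integral p i (l + r) g = seg_integral p i l g + seg_integral (seg_pt p i l) i r g"
proof -
  have c: "continuous_on S (\<lambda>s. g (seg_pt p i s))" for S by (rule continuous_on_seg[OF g])
  have "integral {0..l + r} (\<lambda>s. g (seg_pt p i s)) =
      integral {0..l} (\<lambda>s. g (seg_pt p i s)) + integral {l..l + r} (\<lambda>s. g (seg_pt p i s))"
    using l by (intro Henstock_Kurzweil_Integration.integral_combine[symmetric] integrable_continuous_interval c) auto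
  also have "integral {l..l + r} (\<lambda>s. g (seg_pt p i s)) = integral {0..r} ((\<lambda>s. g (seg_pt p i s)) \<circ> (\<lambda>x. x + l))"
    using integral_shift[of 0 l r "\<lambda>s. g (seg_pt p i s)"] c by (simp add: add.commute)
  also have "((\<lambda>s. g (seg_pt p i s)) \<circ> (\<lambda>x. x + l)) = (\<lambda>s. g (seg_pt (seg_pt p i l) i s))"
    by (simp add: fun_eq_iff seg_pt_def scaleR_add_left algebra_simps)
  finally show ?thesis by (simp add: seg_integral_def)
qed

lemma seg_integral_sum:
  assumes g: "continuous_on UNIV g" and \<delta>: "0 \<le> \<delta>"
  shows "seg_integral p i (real l * \<delta>) g = (\<Sum>m<l. seg_integral (seg_pt p i (real m * \<delta>)) i \<delta> g)"
proof (induction l)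
  case 0 show ?case by (simp add: seg_integral_def)
next
  case (Suc l)
  have "seg_integral p i (real l * \<delta> + \<delta>) g = seg_integral p i (real l * \<delta>) g + seg_integral (seg_pt p i (real l * \<delta>)) i \<delta> g"
    using \<delta> by (intro seg_integral_split g) auto
  then show ?case using Suc by (simp add: algebra_simps)
qed

lemma seg_integral_hausdorff:
  assumes g: "continuous_on UNIV g"
  shows "(LINT x:seg_pt p i ` {0..l}|hausdorff_measure 1. g x) = seg_integral p i l g"
proof -
  have "(LINT x:seg_pt p i ` {0..l}|hausdorff_measure 1. g x) = (LINT s:{0..l}|lborel. g (seg_pt p i s))"
    unfolding seg_pt_def
    by (rule set_integral_hausdorff_1_line) (auto simp: norm_axis_1 intro: borel_measurable_continuous_onI g)
  also have "\<dots> = seg_integral p i l g"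
    unfolding seg_integral_def
    by (intro set_borel_integral_eq_integral(2) borel_integrable_atLeastAtMost' continuous_on_seg g)
  finally show ?thesis .
qed

lemma measure_hausdorff_seg: "0 \<le> l \<Longrightarrow> measure (hausdorff_measure 1) (seg_pt p i ` {0..l}) = l"
  unfolding seg_pt_def measure_def by (subst emeasure_hausdorff_1_line) (auto simp: norm_axis_1)

lemma seg_pt_image_eq: "0 < l \<Longrightarrow> seg_pt p i ` {0..l} = closed_segment p (seg_pt p i l)"
proof -
  assume l: "0 < l"
  have "closed_segment p (seg_pt p i l) = (\<lambda>u. seg_pt p i (u * l)) ` {0..1}"
    unfolding closed_segment_image_interval by (intro image_cong) (auto simp: seg_pt_def algebra_simps)
  also have "\<dots> = seg_pt p i ` ((\<lambda>u. u * l) ` {0..1})" by (simp add: image_image)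
  also have "(\<lambda>u. u * l) ` {0..1} = {0..l}" using l by (simp add: image_mult_atLeastAtMost mult.commute[of _ l])
  finally show ?thesis by simp
qed

lemma simple_vec_norm_1: "simple_vec_norm 1 v = norm (v 0)"
proof -
  have "{p. p permutes {..<1::nat}} = {id}"
    using permutes_sing by (auto simp: lessThan_Suc permutes_id)
  then show ?thesis by (simp add: simple_vec_norm_def sign_id norm_eq_sqrt_inner lessThan_Suc)
qed

lemma simplex_seg: "0 < l \<Longrightarrow> (int 1) simplex (seg_pt p i ` {0..l})"
  unfolding simplex seg_pt_image_eq segment_convex_hull
  by (rule exI[of _ "{p, seg_pt p i l}"]) (auto simp: seg_pt_def affine_independent_2 axis_eq_0_iff)

lemma orients_seg:
  assumes l: "0 < l" shows "orients 1 (\<lambda>_. axis i 1) (seg_pt p i ` {0..l})"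
proof -
  define S where "S = {x - y | x y. x \<in> seg_pt p i ` {0..l} \<and> y \<in> seg_pt p i ` {0..l}}"
  have "S \<subseteq> span {axis i 1}"
    unfolding S_def seg_pt_def
    by (auto simp: span_singleton scaleR_diff_left[symmetric])
  moreover have "axis i 1 \<in> span S"
  proof -
    have "seg_pt p i l - seg_pt p i 0 \<in> S" using l unfolding S_def by force
    then have "(1 / l) *\<^sub>R (seg_pt p i l - seg_pt p i 0) \<in> span S" by (intro span_mul span_base)
    then show ?thesis using l by (simp add: seg_pt_def)
  qed
  ultimately have "span S = span {axis i 1}"
    unfolding span_eq by simp
  moreover have "(\<lambda>_. axis i 1) ` {..<1::nat} = {axis i (1::real)}" by (auto simp: lessThan_Suc)
  ultimately show ?thesis
    by (simp add: orients_def S_def[symmetric] simple_vec_norm_1[unfolded One_nat_def] norm_axis_1)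
qed

text \<open>A relative interior point of a grid edge has exactly one coordinate that is not a
  multiple of the mesh. This coordinate determines the direction of the edge, and rounding it down
  recovers the base point.\<close>

lemma grid_edges_disjoint:
  fixes f g :: "'n::finite \<Rightarrow> int"
  assumes \<delta>: "0 < \<delta>" and ne: "(f, i) \<noteq> (g, k)"
  shows "rel_interior (seg_pt (\<chi> j. \<delta> * of_int (f j)) i ` {0..\<delta>}) \<inter>
         rel_interior (seg_pt (\<chi> j. \<delta> * of_int (g j)) k ` {0..\<delta>}) = {}"
proof -
  define c :: "('n \<Rightarrow> int) \<Rightarrow> real ^ 'n" where "c f = (\<chi> j. \<delta> * of_int (f j))" for f
  have ri: "\<exists>s. 0 < s \<and> s < \<delta> \<and> x = seg_pt (c f) i s" if x: "x \<in> rel_interior (seg_pt (c f) i ` {0..\<delta>})" for f i x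
  proof -
    have ne: "c f \<noteq> seg_pt (c f) i \<delta>" using \<delta> by (auto simp: vec_eq_iff seg_pt_nth)
    have "x \<in> open_segment (c f) (seg_pt (c f) i \<delta>)"
      using x ne by (simp add: seg_pt_image_eq[OF \<delta>] rel_interior_closed_segment)
    then obtain u where u: "0 < u" "u < 1" "x = (1 - u) *\<^sub>R c f + u *\<^sub>R seg_pt (c f) i \<delta>"
      by (auto simp: in_segment)
    then have "x = seg_pt (c f) i (u * \<delta>)" by (simp add: seg_pt_def algebra_simps)
    then show ?thesis using u \<delta> by (intro exI[of _ "u * \<delta>"]) auto
  qed
  have "False" if x: "x \<in> rel_interior (seg_pt (c f) i ` {0..\<delta>})" "x \<in> rel_interior (seg_pt (c g) k ` {0..\<delta>})" for x
  proof -
    obtain s where s: "0 < s" "s < \<delta>" "x = seg_pt (c f) i s" using ri[OF x(1)] by blast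
    obtain t where t: "0 < t" "t < \<delta>" "x = seg_pt (c g) k t" using ri[OF x(2)] by blast
    have eq: "(if j = i then \<delta> * of_int (f i) + s else \<delta> * of_int (f j)) =
        (if j = k then \<delta> * of_int (g k) + t else \<delta> * of_int (g j))" for j
      using s(3) t(3) arg_cong[of _ _ "\<lambda>x. x $ j"] by (metis (no_types, lifting) c_def seg_pt_nth vec_lambda_beta)
    have lat: "m = n" if "\<delta> * of_int m + a = \<delta> * of_int n + b" "0 \<le> a" "a < \<delta>" "0 \<le> b" "b < \<delta>" for m n :: int and a b
    proof -
      have "\<bar>\<delta> * of_int (m - n)\<bar> < \<delta>" using that by (simp add: algebra_simps abs_less_iff)
      then have "\<bar>of_int (m - n) :: real\<bar> < 1" using \<delta> by (simp add: abs_mult)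
      then show ?thesis by linarith
    qed
    have "i = k"
    proof (rule ccontr)
      assume ik: "i \<noteq> k"
      then have e: "\<delta> * of_int (f i) + s = \<delta> * of_int (g i) + 0" using eq[of i] by simp
      then have "f i = g i" using s \<delta> by (intro lat[OF e]) auto
      then show False using e s by simp
    qed
    moreover have "f j = g j" for j
    proof (cases "j = i")
      case True
      then have e: "\<delta> * of_int (f j) + s = \<delta> * of_int (g j) + t" using eq[of j] \<open>i = k\<close> by simp
      show ?thesis using s t by (intro lat[OF e]) auto
    next
      case False
      then show ?thesis using eq[of j] \<open>i = k\<close> \<delta> by simp
    qed
    ultimately show False using ne by auto
  qed
  then show ?thesis unfolding c_def by blast
qed

lemma sum_subadditive:
  fixes C :: "'b::comm_monoid_add \<Rightarrow> real"
  assumes "C 0 = 0" "\<And>x y. C (x + y) \<le> C x + C y"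
  shows "C (\<Sum>a\<in>I. \<theta> a) \<le> (\<Sum>a\<in>I. C (\<theta> a))"
  by (induction I rule: infinite_finite_induct) (auto simp: assms intro: order_trans[OF assms(2)])

text \<open>Overlapping segments are cut into edges of one grid, and each edge receives the sum of
  the coefficients of all segments through it. An edge is indexed by its integer base point and
  direction, so that an edge shared by several segments is literally the same index.\<close>

lemma grid_polyhedral:
  fixes p :: "'a \<Rightarrow> real ^ 'n" and \<theta> :: "'a \<Rightarrow> real ^ 'm"
  assumes A: "finite A" and \<delta>: "0 < \<delta>"
    and lattice: "\<And>a i. a \<in> A \<Longrightarrow> \<exists>z::int. p a $ i = \<delta> * of_int z"
    and C: "C 0 = (0::real)" "\<And>\<eta> \<theta>. C (\<eta> + \<theta>) \<le> C \<eta> + C \<theta>"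
  obtains Ps :: "('n, 'm) piece list" where "polyhedral_data 1 Ps"
    "\<And>j \<omega>. (\<And>v. continuous_on UNIV (\<lambda>x. \<omega> x v)) \<Longrightarrow> polyhedral_current 1 Ps j \<omega> =
        (\<Sum>a\<in>A. \<theta> a $ j * seg_integral (p a) (d a) (real (l a) * \<delta>) (\<lambda>x. \<omega> x (\<lambda>_. axis (d a) 1)))"
    "discrete_energy C Ps \<le> (\<Sum>a\<in>A. C (\<theta> a) * (real (l a) * \<delta>))"
    "\<And>\<sigma> \<tau> \<eta>. (\<sigma>, \<tau>, \<eta>) \<in> set Ps \<Longrightarrow> \<exists>a\<in>A. \<sigma> \<subseteq> seg_pt (p a) (d a) ` {0..real (l a) * \<delta>}"
proof -
  from lattice have "\<forall>a. \<exists>z::'n \<Rightarrow> int. a \<in> A \<longrightarrow> (\<forall>i. p a $ i = \<delta> * of_int (z i))" by metis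
  then obtain z :: "'a \<Rightarrow> 'n \<Rightarrow> int" where z: "\<And>a i. a \<in> A \<Longrightarrow> p a $ i = \<delta> * of_int (z a i)" by metis
  define edge where "edge a m = ((z a)(d a := z a (d a) + int m), d a)" for a m
  define E where "E a = edge a ` {..<l a}" for a
  define EE where "EE = (\<Union>a\<in>A. E a)"
  have finE: "finite (E a)" for a by (simp add: E_def)
  have finEE: "finite EE" using A finE by (simp add: EE_def)
  have inj: "inj_on (edge a) {..<l a}" for a
    by (rule inj_onI) (auto simp: edge_def fun_eq_iff split: if_splits dest: spec[of _ "d a"])
  define c :: "('n \<Rightarrow> int) \<Rightarrow> real ^ 'n" where "c f = (\<chi> j. \<delta> * of_int (f j))" for f
  have c_edge: "c (fst (edge a m)) = seg_pt (p a) (d a) (real m * \<delta>)" if "a \<in> A" for a m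
    using z[OF that] by (auto simp: vec_eq_iff c_def edge_def seg_pt_nth algebra_simps)
  define \<sigma> where "\<sigma> e = seg_pt (c (fst e)) (snd e) ` {0..\<delta>}" for e
  \<comment> \<open>All segments are oriented in the positive axis direction, so coefficients on a
    common edge add without signs.\<close>
  define \<Theta> where "\<Theta> e = (\<Sum>a\<in>{a \<in> A. e \<in> E a}. \<theta> a)" for e
  obtain es where es: "set es = EE" "distinct es" using finite_distinct_list[OF finEE] by blast
  define Ps :: "('n, 'm) piece list" where "Ps = map (\<lambda>e. (\<sigma> e, \<lambda>_. axis (snd e) 1, \<Theta> e)) es"
  \<comment> \<open>Double counting of the incidences between edges and segments; it serves both the
    current and the energy.\<close>
  have swap: "(\<Sum>e\<in>EE. \<Sum>a\<in>{a \<in> A. e \<in> E a}. F a e) = (\<Sum>a\<in>A. \<Sum>e\<in>E a. F a e)" for F :: "'a \<Rightarrow> _ \<Rightarrow> real"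
  proof -
    have "(\<Sum>e\<in>EE. \<Sum>a\<in>{a \<in> A. e \<in> E a}. F a e) = (\<Sum>a\<in>A. \<Sum>e\<in>{e \<in> EE. e \<in> E a}. F a e)"
      by (rule sum.swap_restrict[OF finEE A])
    also have "\<dots> = (\<Sum>a\<in>A. \<Sum>e\<in>E a. F a e)"
      by (intro sum.cong refl) (auto simp: EE_def)
    finally show ?thesis .
  qed
  show ?thesis
  proof
    show "polyhedral_data 1 Ps"
      unfolding polyhedral_data_def
    proof safe
      fix s \<tau> \<eta> assume "(s, \<tau>, \<eta>) \<in> set Ps"
      then obtain e where "s = \<sigma> e" "\<tau> = (\<lambda>_. axis (snd e) 1)" by (auto simp: Ps_def)
      then show "(int 1) simplex s" "orients 1 \<tau> s"
        using simplex_seg[OF \<delta>] orients_seg[OF \<delta>] by (auto simp: \<sigma>_def)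
    next
      fix a b x assume ab: "a < length Ps" "b < length Ps" "a \<noteq> b"
        and x: "x \<in> rel_interior (fst (Ps ! a))" "x \<in> rel_interior (fst (Ps ! b))"
      have len: "length Ps = length es" by (simp add: Ps_def)
      have "es ! a \<noteq> es ! b" using ab es(2) by (simp add: nth_eq_iff_index_eq len)
      then have "(fst (es ! a), snd (es ! a)) \<noteq> (fst (es ! b), snd (es ! b))" by simp
      from grid_edges_disjoint[OF \<delta> this] have "rel_interior (\<sigma> (es ! a)) \<inter> rel_interior (\<sigma> (es ! b)) = {}"
        by (simp add: \<sigma>_def c_def)
      then show "x \<in> {}" using x ab by (auto simp: Ps_def)
    qed
  next
    fix j and \<omega> :: "'n form" assume cont: "\<And>v. continuous_on UNIV (\<lambda>x. \<omega> x v)"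
    have sub: "(\<Sum>e\<in>E a. seg_integral (c (fst e)) (snd e) \<delta> (\<lambda>x. \<omega> x (\<lambda>_. axis (snd e) 1))) =
        seg_integral (p a) (d a) (real (l a) * \<delta>) (\<lambda>x. \<omega> x (\<lambda>_. axis (d a) 1))" if a: "a \<in> A" for a
    proof -
      have "(\<Sum>e\<in>E a. seg_integral (c (fst e)) (snd e) \<delta> (\<lambda>x. \<omega> x (\<lambda>_. axis (snd e) 1))) =
        (\<Sum>m<l a. seg_integral (c (fst (edge a m))) (snd (edge a m)) \<delta> (\<lambda>x. \<omega> x (\<lambda>_. axis (snd (edge a m)) 1)))"
        unfolding E_def by (subst sum.reindex[OF inj]) simp
      also have "\<dots> = (\<Sum>m<l a. seg_integral (seg_pt (p a) (d a) (real m * \<delta>)) (d a) \<delta> (\<lambda>x. \<omega> x (\<lambda>_. axis (d a) 1)))"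
        by (intro sum.cong refl, subst c_edge[OF a]) (simp add: edge_def)
      also have "\<dots> = seg_integral (p a) (d a) (real (l a) * \<delta>) (\<lambda>x. \<omega> x (\<lambda>_. axis (d a) 1))"
        using \<delta> by (intro seg_integral_sum[symmetric] cont) simp
      finally show ?thesis .
    qed
    have "polyhedral_current 1 Ps j \<omega> =
        (\<Sum>e\<in>EE. LINT x:\<sigma> e|hausdorff_measure 1. \<Theta> e $ j * \<omega> x (\<lambda>_. axis (snd e) 1))"
      unfolding polyhedral_current_def Ps_def
      by (simp add: sum_list_distinct_conv_sum_set[OF es(2)] es(1) comp_def)
    also have "\<dots> = (\<Sum>e\<in>EE. \<Theta> e $ j * seg_integral (c (fst e)) (snd e) \<delta> (\<lambda>x. \<omega> x (\<lambda>_. axis (snd e) 1)))"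
      unfolding \<sigma>_def set_integral_mult_right by (simp only: seg_integral_hausdorff[OF cont])
    also have "\<dots> = (\<Sum>e\<in>EE. \<Sum>a\<in>{a \<in> A. e \<in> E a}. \<theta> a $ j * seg_integral (c (fst e)) (snd e) \<delta> (\<lambda>x. \<omega> x (\<lambda>_. axis (snd e) 1)))"
      by (simp add: \<Theta>_def sum_component sum_distrib_right)
    also have "\<dots> = (\<Sum>a\<in>A. \<theta> a $ j * seg_integral (p a) (d a) (real (l a) * \<delta>) (\<lambda>x. \<omega> x (\<lambda>_. axis (d a) 1)))"
      unfolding swap by (intro sum.cong refl) (simp add: sub flip: sum_distrib_left)
    finally show "polyhedral_current 1 Ps j \<omega> = \<dots>" .
  next
    have "discrete_energy C Ps = (\<Sum>e\<in>EE. C (\<Theta> e) * \<delta>)"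
      unfolding discrete_energy_def Ps_def using \<delta>
      by (simp add: sum_list_distinct_conv_sum_set[OF es(2)] es(1) comp_def \<sigma>_def measure_hausdorff_seg[unfolded One_nat_def])
    also have "\<dots> \<le> (\<Sum>e\<in>EE. (\<Sum>a\<in>{a \<in> A. e \<in> E a}. C (\<theta> a)) * \<delta>)"
      unfolding \<Theta>_def using \<delta> C by (intro sum_mono mult_right_mono sum_subadditive) auto
    also have "\<dots> = (\<Sum>a\<in>A. \<Sum>e\<in>E a. C (\<theta> a) * \<delta>)"
      unfolding sum_distrib_right swap ..
    also have "\<dots> = (\<Sum>a\<in>A. C (\<theta> a) * (real (l a) * \<delta>))"
      by (intro sum.cong refl) (simp add: E_def card_image[OF inj])
    finally show "discrete_energy C Ps \<le> (\<Sum>a\<in>A. C (\<theta> a) * (real (l a) * \<delta>))" .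
  next
    fix s \<tau> \<eta> assume "(s, \<tau>, \<eta>) \<in> set Ps"
    then obtain e where e: "e \<in> EE" "s = \<sigma> e" by (auto simp: Ps_def es(1))
    then obtain a m where am: "a \<in> A" "m < l a" "e = edge a m" by (auto simp: EE_def E_def)
    have "seg_pt (seg_pt (p a) (d a) (real m * \<delta>)) (d a) t = seg_pt (p a) (d a) (real m * \<delta> + t)" for t
      by (simp add: seg_pt_def scaleR_add_left)
    moreover have "real m * \<delta> + t \<le> real (l a) * \<delta>" if "t \<le> \<delta>" for t
    proof -
      have "real m * \<delta> + t \<le> (real m + 1) * \<delta>" using that by (simp add: algebra_simps)
      also have "\<dots> \<le> real (l a) * \<delta>" using am \<delta> by (intro mult_right_mono) auto
      finally show ?thesis .
    qed
    ultimately have "s \<subseteq> seg_pt (p a) (d a) ` {0..real (l a) * \<delta>}"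
      unfolding e(2) \<sigma>_def am(3) c_edge[OF am(1)] using \<delta> by (auto simp: edge_def intro!: image_eqI)
    then show "\<exists>a\<in>A. s \<subseteq> seg_pt (p a) (d a) ` {0..real (l a) * \<delta>}" using am by blast
  qed
qed

section \<open>The cost of dyadic transport\<close>

text \<open>Admissibility controls only the diagonal, and the order compares only vectors with
  compatible signs. So the vector is split into its positive and negative part, each of which lies
  below the diagonal vector of its l1 norm; evenness handles the negative part, and the two parts
  give the factor 2.\<close>

lemma transportation_cost_le:
  fixes C :: "real ^ 'm \<Rightarrow> real"
  assumes C: "transportation_cost C" and \<beta>: "\<And>x. 0 \<le> x \<Longrightarrow> C (\<chi> j. x) \<le> \<beta> x"
  shows "C \<theta> \<le> 2 * \<beta> (\<Sum>j\<in>UNIV. \<bar>\<theta> $ j\<bar>)"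
proof -
  define s where "s = (\<Sum>j\<in>UNIV. \<bar>\<theta> $ j\<bar>)"
  have s: "0 \<le> s" "\<And>j. \<bar>\<theta> $ j\<bar> \<le> s"
    by (auto simp: s_def intro: sum_nonneg member_le_sum)
  have mono: "\<And>\<eta> \<theta>. cost_le \<eta> \<theta> \<Longrightarrow> C \<eta> \<le> C \<theta>" and sub: "\<And>\<eta> \<theta>. C (\<eta> + \<theta>) \<le> C \<eta> + C \<theta>"
    and even: "\<And>\<theta>. C (- \<theta>) = C \<theta>" using C by (auto simp: transportation_cost_def)
  define P where "P = (\<chi> j. max 0 (\<theta> $ j))"
  define Q where "Q = (\<chi> j. max 0 (- \<theta> $ j))"
  have le: "\<bar>max 0 (\<theta> $ j)\<bar> \<le> \<bar>s\<bar>" "\<bar>max 0 (- \<theta> $ j)\<bar> \<le> \<bar>s\<bar>" for j using s(1) s(2)[of j] by auto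
  have PQ: "C P \<le> \<beta> s" "C Q \<le> \<beta> s"
    using le s(1) by (auto simp: cost_le_def P_def Q_def sgn_if intro!: order_trans[OF mono \<beta>])
  have "\<theta> = P + (- Q)" by (auto simp: vec_eq_iff P_def Q_def max_def)
  then have "C \<theta> \<le> C P + C (- Q)" using sub by metis
  with PQ even[of Q] show ?thesis by (simp add: s_def)
qed

text \<open>Jensen's inequality for the average of the a k; monotonicity then replaces their sum by
  its bound M.\<close>

lemma concave_sum_le:
  fixes \<beta> :: "real \<Rightarrow> real"
  assumes \<beta>: "concave_on {0..} \<beta>" "mono_on {0..} \<beta>" and I: "finite I" "I \<noteq> {}"
    and a: "\<And>k. k \<in> I \<Longrightarrow> 0 \<le> a k" "(\<Sum>k\<in>I. a k) \<le> M"
  shows "(\<Sum>k\<in>I. \<beta> (a k)) \<le> card I * \<beta> (M / card I)"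
proof -
  define N where "N = real (card I)"
  have N: "0 < N" using I by (simp add: N_def card_gt_0_iff)
  have "(\<Sum>k\<in>I. (1 / N) * \<beta> (a k)) \<le> \<beta> (\<Sum>k\<in>I. (1 / N) *\<^sub>R a k)"
    using I a N by (intro concave_on_sum[OF _ _ \<beta>(1)]) (auto simp: N_def)
  also have "\<dots> = \<beta> ((\<Sum>k\<in>I. a k) / N)" by (simp add: sum_divide_distrib)
  also have "\<dots> \<le> \<beta> (M / N)"
    using a N by (intro mono_onD[OF \<beta>(2)]) (auto intro!: divide_right_mono divide_nonneg_pos sum_nonneg order_trans[OF sum_nonneg a(2)])
  finally have "(\<Sum>k\<in>I. \<beta> (a k)) / N \<le> \<beta> (M / N)" by (simp add: sum_divide_distrib)
  then show ?thesis using N by (simp add: N_def[symmetric] field_simps)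
qed

text \<open>On the dyadic interval \<open>I t\<close> the integrand is at least \<open>c t\<close>,
  the product of beta at the left end and the power at the right end. The intervals are disjoint, so
  the sum of these bounds times the lengths lies below the integral; the length 2^(-(t+1)) lowers
  the exponent by one.\<close>

lemma dyadic_summable:
  fixes \<beta> :: "real \<Rightarrow> real"
  assumes \<beta>: "mono_on {0..} \<beta>" "\<And>x. 0 \<le> x \<Longrightarrow> 0 \<le> \<beta> x"
    and \<alpha>: "0 \<le> \<alpha>"
    and int: "(\<integral>\<^sup>+x\<in>{0<..<1}. ennreal (\<beta> x * x powr (- \<alpha>)) \<partial>lborel) < \<infinity>"
  shows "summable (\<lambda>t. \<beta> ((1/2) ^ Suc t) * (2 ^ t) powr (\<alpha> - 1))"
proof -
  define I where "I t = {(1/2) ^ Suc t <..< (1/2) ^ t :: real}" for t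
  define c where "c t = \<beta> ((1/2) ^ Suc t) * ((1/2) ^ t) powr (- \<alpha>)" for t
  have c0: "0 \<le> c t" for t using \<beta>(2) by (simp add: c_def)
  have disj: "x \<notin> I u" if "x \<in> I t" "u \<noteq> t" for x t u
  proof
    assume u: "x \<in> I u"
    have *: False if "x \<in> I t" "x \<in> I u" "t < u" for t u
    proof -
      have "(1/2) ^ u \<le> (1/2 :: real) ^ Suc t" using that by (intro power_decreasing) auto
      then show False using that by (auto simp: I_def)
    qed
    show False using *[OF that(1) u] *[OF u that(1)] that(2) by (cases "t < u") auto
  qed
  have pt: "(\<Sum>t. ennreal (c t) * indicator (I t) x) \<le> ennreal (\<beta> x * x powr (- \<alpha>)) * indicator {0<..<1} x" for x
  proof (cases "\<exists>t. x \<in> I t")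
    case True
    then obtain t where t: "x \<in> I t" by blast
    have x: "0 < x" "x < 1" "(1/2) ^ Suc t \<le> x" "x \<le> (1/2) ^ t"
      using t power_le_one[of "1/2 :: real" t] zero_less_power[of "1/2 :: real" "Suc t"]
      unfolding I_def greaterThanLessThan_iff by linarith+
    have "(\<Sum>t. ennreal (c t) * indicator (I t) x) = (\<Sum>u\<in>{t}. ennreal (c u) * indicator (I u) x)"
      using disj[OF t] by (intro suminf_finite) auto
    also have "\<dots> = ennreal (c t)" using t by simp
    also have "\<dots> \<le> ennreal (\<beta> x * x powr (- \<alpha>))"
      unfolding c_def using x \<alpha> \<beta>(2)
      by (intro ennreal_leI mult_mono mono_onD[OF \<beta>(1)] powr_mono2') (auto simp del: power_Suc)
    finally show ?thesis using x by simp
  next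
    case False
    then have "(\<lambda>t. ennreal (c t) * indicator (I t) x) = (\<lambda>_. 0)" by auto
    then show ?thesis by simp
  qed
  have "(\<Sum>t. ennreal (c t * (1/2) ^ Suc t)) = (\<Sum>t. \<integral>\<^sup>+x. ennreal (c t) * indicator (I t) x \<partial>lborel)"
  proof (intro arg_cong[where f = suminf] ext)
    fix t
    have "emeasure lborel (I t) = ennreal ((1/2) ^ Suc t)" by (simp add: I_def)
    then show "ennreal (c t * (1/2) ^ Suc t) = (\<integral>\<^sup>+x. ennreal (c t) * indicator (I t) x \<partial>lborel)"
      using c0[of t] by (subst nn_integral_cmult_indicator) (auto simp: I_def ennreal_mult simp del: power_Suc)
  qed
  also have "\<dots> = (\<integral>\<^sup>+x. (\<Sum>t. ennreal (c t) * indicator (I t) x) \<partial>lborel)"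
    by (rule nn_integral_suminf[symmetric]) (auto simp: I_def)
  also have "\<dots> \<le> (\<integral>\<^sup>+x\<in>{0<..<1}. ennreal (\<beta> x * x powr (- \<alpha>)) \<partial>lborel)"
    by (intro nn_integral_mono pt)
  also have "\<dots> < \<infinity>" by (rule int)
  finally have "summable (\<lambda>t. c t * (1/2) ^ Suc t)"
    using c0 by (intro summable_suminf_not_top) auto
  then have "summable (\<lambda>t. 2 * (c t * (1/2) ^ Suc t))" by (rule summable_mult)
  moreover have "2 * (c t * (1/2) ^ Suc t) = \<beta> ((1/2) ^ Suc t) * (2 ^ t) powr (\<alpha> - 1)" for t
  proof -
    have "((1/2) ^ t) powr (- \<alpha>) = ((2::real) ^ t) powr \<alpha>"
      by (simp add: power_one_over powr_minus_divide powr_divide)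
    moreover have "((2::real) ^ t) powr (\<alpha> - 1) = (2 ^ t) powr \<alpha> * (1/2) ^ t"
      by (simp add: powr_diff power_one_over)
    ultimately show ?thesis by (simp add: c_def)
  qed
  ultimately show ?thesis by simp
qed

text \<open>\<open>t div n\<close> is at least t/n - 1, and this rounding costs the factor 2. It
  turns the stepwise decay of the box sides into a geometric one.\<close>

lemma half_power_div_le:
  assumes n: "0 < n" shows "(1/2 :: real) ^ (t div n) \<le> 2 * (2 powr (- (1 / real n))) ^ t"
proof -
  have "real t = real n * real (t div n) + real (t mod n)"
    by (metis mult_div_mod_eq of_nat_add of_nat_mult)
  moreover have "real (t mod n) \<le> real n" using n by (simp add: less_imp_le)
  ultimately have "real t \<le> (real (t div n) + 1) * real n" by (simp add: algebra_simps)
  then have e: "real t / real n - 1 \<le> real (t div n)" using n by (simp add: field_simps)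
  have "(1/2 :: real) ^ (t div n) = 2 powr (- real (t div n))"
    by (simp add: powr_minus powr_realpow power_one_over inverse_eq_divide)
  also have "\<dots> \<le> 2 powr (1 - real t / real n)" using e by (intro powr_mono) auto
  also have "\<dots> = 2 * 2 powr (- (real t / real n))" by (simp add: powr_diff powr_minus_divide)
  also have "2 powr (- (real t / real n)) = (2 powr (- (1 / real n))) ^ t" by (subst powr_power) auto
  finally show ?thesis .
qed

text \<open>Concavity and a nonnegative value at 0 let a factor K of at least 1 be pulled out of
  beta, which reduces the argument M / 2^t to a power of 1/2. The remaining power of 2^t has
  exponent 1 - 1/n, which is the exponent of the integral condition minus one.\<close>

lemma admissible_summable:
  fixes \<beta> :: "real \<Rightarrow> real"
  assumes \<beta>: "concave_on {0..} \<beta>" "mono_on {0..} \<beta>" "\<And>x. 0 \<le> x \<Longrightarrow> 0 \<le> \<beta> x"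
    and n: "0 < n" and M: "0 \<le> M"
    and int: "(\<integral>\<^sup>+x\<in>{0<..<1}. ennreal (\<beta> x * x powr (- (2 - 1 / real n))) \<partial>lborel) < \<infinity>"
  shows "summable (\<lambda>t. 2 ^ t * \<beta> (M / 2 ^ t) * (1/2) ^ (t div n))"
proof -
  \<comment> \<open>The convex combination below has weights 1/K and 1 - 1/K, so it requires K to be
    at least 1.\<close>
  define K where "K = max 1 M"
  have K: "1 \<le> K" "M \<le> K" by (auto simp: K_def)
  have n1: "1 / real n \<le> 1" using n by simp
  have \<beta>M: "\<beta> (M * x) \<le> K * \<beta> x" if x: "0 \<le> x" for x
  proof -
    have "(1 - 1 / K) * \<beta> 0 + (1 / K) * \<beta> (K * x) \<le> \<beta> ((1 - 1 / K) *\<^sub>R 0 + (1 / K) *\<^sub>R (K * x))"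
      using K x by (intro concave_onD[OF \<beta>(1)]) auto
    moreover have "0 \<le> (1 - 1 / K) * \<beta> 0" using K \<beta>(3)[of 0] by (intro mult_nonneg_nonneg) auto
    ultimately have "\<beta> (K * x) / K \<le> \<beta> x" using K by simp
    then have "\<beta> (K * x) \<le> K * \<beta> x" using K by (simp add: field_simps)
    moreover have "\<beta> (M * x) \<le> \<beta> (K * x)"
      using K M x by (intro mono_onD[OF \<beta>(2)]) (auto intro: mult_right_mono)
    ultimately show ?thesis by simp
  qed
  have "summable (\<lambda>t. \<beta> ((1/2) ^ Suc t) * (2 ^ t) powr ((2 - 1 / real n) - 1))"
    using n1 by (intro dyadic_summable \<beta> int) auto
  then have S: "summable (\<lambda>t. 4 * K * (\<beta> ((1/2) ^ Suc t) * (2 ^ t) powr (1 - 1 / real n)))"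
    by (intro summable_mult) (simp add: algebra_simps)
  \<comment> \<open>The index is shifted because \<open>dyadic_summable\<close> evaluates beta at
    left endpoints 2^(-(t+1)). The 4 in \<open>S\<close> is one factor 2 from
    \<open>2 ^ Suc t\<close> and one from \<open>half_power_div_le\<close>.\<close>
  have "summable (\<lambda>t. 2 ^ Suc t * \<beta> (M / 2 ^ Suc t) * (1/2) ^ (Suc t div n))"
  proof (rule summable_comparison_test'[OF S])
    fix t :: nat
    have "(1/2 :: real) ^ (Suc t div n) \<le> 2 * (2 powr (- (1 / real n))) ^ Suc t"
      by (rule half_power_div_le[OF n])
    also have "\<dots> \<le> 2 * (2 powr (- (1 / real n))) ^ t"
      using powr_mono[of "- (1 / real n)" 0 2] by (intro mult_left_mono power_decreasing) auto
    also have "\<dots> = 2 * (2 ^ t) powr (- (1 / real n))"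
      by (simp add: powr_power powr_powr flip: powr_realpow)
    finally have p: "(1/2 :: real) ^ (Suc t div n) \<le> 2 * (2 ^ t) powr (- (1 / real n))" .
    have b: "\<beta> (M / 2 ^ Suc t) \<le> K * \<beta> ((1/2) ^ Suc t)"
      using \<beta>M[of "(1/2) ^ Suc t"] by (simp add: power_one_over del: power_Suc)
    have "2 ^ Suc t * \<beta> (M / 2 ^ Suc t) * (1/2) ^ (Suc t div n) \<le>
        2 ^ Suc t * (K * \<beta> ((1/2) ^ Suc t)) * (2 * (2 ^ t) powr (- (1 / real n)))"
      using K \<beta>(3) M by (intro mult_mono b p) auto
    also have "\<dots> = 4 * K * (\<beta> ((1/2) ^ Suc t) * (2 ^ t) powr (1 - 1 / real n))"
      by (simp add: powr_diff powr_minus_divide)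
    finally show "norm (2 ^ Suc t * \<beta> (M / 2 ^ Suc t) * (1/2) ^ (Suc t div n)) \<le> \<dots>"
      using \<beta>(3) M by simp
  qed
  then show ?thesis by (rule summable_Suc_iff[of "\<lambda>t. 2 ^ t * \<beta> (M / 2 ^ t) * (1/2) ^ (t div n)", THEN iffD1])
qed

section \<open>Repeated bisection of a cube\<close>

locale kd_tree =
  fixes e :: "nat \<Rightarrow> 'n::finite" and B :: nat
  assumes e: "bij_betw e {..<CARD('n)} UNIV" and B: "0 < B"
begin

definition dir :: "nat \<Rightarrow> 'n" where "dir t = e (t mod CARD('n))"

definition idx :: "'n \<Rightarrow> nat" where "idx = inv_into {..<CARD('n)} e"

text \<open>The exponent counts the bisections in direction \<open>i\<close> among the first \<open>t\<close> steps.\<close>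

definition side :: "nat \<Rightarrow> 'n \<Rightarrow> real" where
  "side t i = 2 * real B * (1/2) ^ ((t + CARD('n) - 1 - idx i) div CARD('n))"

text \<open>The boxes of level t are the nodes k < 2^t of a binary tree with children 2k and 2k+1;
  an even child keeps the corner of its parent.\<close>

primrec corner :: "nat \<Rightarrow> nat \<Rightarrow> real ^ 'n" where
  "corner 0 k = (\<chi> i. - real B)"
| "corner (Suc t) k = (if even k then corner t (k div 2)
     else seg_pt (corner t (k div 2)) (dir t) (side t (dir t) / 2))"

text \<open>Half-open, so that the boxes of one level partition the root box and no face is counted
  twice.\<close>

definition dbox :: "nat \<Rightarrow> nat \<Rightarrow> (real ^ 'n) set" where
  "dbox t k = {x. \<forall>i. corner t k $ i \<le> x $ i \<and> x $ i < corner t k $ i + side t i}"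

definition len :: "nat \<Rightarrow> real" where "len t = side t (dir t) / 2"

text \<open>Closed, in contrast to \<open>dbox 0 0\<close>, to have one compact set for the supports
  and for uniform continuity.\<close>

definition cube :: "(real ^ 'n) set" where "cube = {x. \<forall>i. - real B \<le> x $ i \<and> x $ i \<le> real B}"

lemma idx: "idx i < CARD('n)" "e (idx i) = i" "k < CARD('n) \<Longrightarrow> idx (e k) = k"
proof -
  have "i \<in> e ` {..<CARD('n)}" using e by (auto simp: bij_betw_def)
  then show "idx i < CARD('n)" "e (idx i) = i"
    unfolding idx_def using inv_into_into[of i e "{..<CARD('n)}"] f_inv_into_f[of i e "{..<CARD('n)}"] by auto
  show "k < CARD('n) \<Longrightarrow> idx (e k) = k" using e unfolding idx_def by (intro inv_into_f_f) (auto simp: bij_betw_def)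
qed

lemma dir_eq_iff: "dir t = i \<longleftrightarrow> t mod CARD('n) = idx i"
  using idx by (auto simp: dir_def)

text \<open>The exponent in \<open>side\<close> grows at step t exactly when \<open>CARD('n)\<close>
  divides \<open>t + CARD('n) - idx i\<close>, that is, when
  \<open>t mod CARD('n) = idx i\<close>.\<close>

lemma side_Suc: "side (Suc t) i = (if i = dir t then side t i / 2 else side t i)"
proof -
  define m where "m = t + CARD('n) - 1 - idx i"
  have npos: "0 < CARD('n)" by simp
  have Sm: "Suc m = t + CARD('n) - idx i" "Suc t + CARD('n) - 1 - idx i = Suc m" using idx(1)[of i] by (auto simp: m_def)
  have "Suc m mod CARD('n) = 0 \<longleftrightarrow> t mod CARD('n) = idx i"
  proof -
    \<comment> \<open>Reducing t modulo \<open>CARD('n)\<close> leaves a number strictly between 0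
      and \<open>2 * CARD('n)\<close>, and \<open>CARD('n)\<close> is its only multiple in that
      range.\<close>
    define r where "r = t mod CARD('n) + CARD('n) - idx i"
    have r: "0 < r" "r < 2 * CARD('n)" using idx(1)[of i] mod_less_divisor[OF npos, of t] unfolding r_def by linarith+
    have "Suc m = CARD('n) * (t div CARD('n)) + r"
      using idx(1)[of i] mult_div_mod_eq[of "CARD('n)" t] unfolding Sm r_def by linarith
    then have "Suc m mod CARD('n) = r mod CARD('n)" by simp
    also have "r mod CARD('n) = 0 \<longleftrightarrow> r = CARD('n)"
    proof
      assume "r mod CARD('n) = 0"
      then have "CARD('n) dvd r" by (simp add: dvd_eq_mod_eq_0)
      then obtain c where c: "r = CARD('n) * c" by (rule dvdE)
      then have "c < 2" "0 < c" using r by auto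
      then show "r = CARD('n)" using c by (simp add: numeral_2_eq_2 less_Suc_eq)
    qed simp
    also have "r = CARD('n) \<longleftrightarrow> t mod CARD('n) = idx i" using idx(1)[of i] unfolding r_def by linarith
    finally show ?thesis .
  qed
  then show ?thesis
    unfolding side_def Sm(2) div_Suc m_def[symmetric] using dir_eq_iff[of t i] by auto
qed

lemma side_0: "side 0 i = 2 * real B"
  using idx(1)[of i] by (simp add: side_def)

lemma side_pos: "0 < side t i"
  using B by (simp add: side_def)

lemma side_le: "side t i \<le> 2 * real B * (1/2) ^ (t div CARD('n))"
  unfolding side_def using idx(1)[of i] by (intro mult_left_mono power_decreasing div_le_mono) auto

lemma len_pos: "0 < len t" using side_pos by (simp add: len_def)

lemma len_le: "len t \<le> real B * (1/2) ^ (t div CARD('n))"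
  using side_le[of t "dir t"] by (simp add: len_def)

lemma summable_half_power_div: "summable (\<lambda>t. (1/2 :: real) ^ (t div CARD('n)))"
proof (rule summable_comparison_test')
  have "2 powr (- (1 / real CARD('n))) < 2 powr (0::real)" by (rule powr_less_mono) auto
  then show "summable (\<lambda>t. 2 * (2 powr (- (1 / real CARD('n)))) ^ t)"
    by (intro summable_mult summable_geometric) auto
  show "norm ((1/2 :: real) ^ (t div CARD('n))) \<le> 2 * (2 powr (- (1 / real CARD('n)))) ^ t" for t
    using half_power_div_le[of "CARD('n)" t] by simp
qed

lemma summable_len: "summable len"
  by (rule summable_comparison_test'[OF summable_mult[OF summable_half_power_div, of "real B"]])
     (use len_le len_pos in \<open>auto simp: less_imp_le\<close>)

lemma corner_children:
  "corner (Suc t) (2 * k) = corner t k"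
  "corner (Suc t) (2 * k + 1) = seg_pt (corner t k) (dir t) (len t)"
  by (simp_all add: len_def)

lemma dbox_split:
  "dbox t k = dbox (Suc t) (2 * k) \<union> dbox (Suc t) (2 * k + 1)" (is ?A)
  "dbox (Suc t) (2 * k) \<inter> dbox (Suc t) (2 * k + 1) = {}" (is ?B)
proof -
  have S: "side (Suc t) i = (if i = dir t then len t else side t i)" "side t (dir t) = len t + len t" for i
    by (simp_all add: side_Suc len_def)
  have all: "(\<forall>i. P i) \<longleftrightarrow> P (dir t) \<and> (\<forall>i. i \<noteq> dir t \<longrightarrow> P i)" for P by metis
  have mem: "x \<in> dbox t k \<longleftrightarrow> (corner t k $ dir t \<le> x $ dir t \<and> x $ dir t < corner t k $ dir t + (len t + len t)) \<and>
      (\<forall>i. i \<noteq> dir t \<longrightarrow> corner t k $ i \<le> x $ i \<and> x $ i < corner t k $ i + side t i)" for x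
    unfolding dbox_def mem_Collect_eq by (subst all) (simp add: S(2))
  have l: "x \<in> dbox (Suc t) (2 * k) \<longleftrightarrow> (corner t k $ dir t \<le> x $ dir t \<and> x $ dir t < corner t k $ dir t + len t) \<and>
      (\<forall>i. i \<noteq> dir t \<longrightarrow> corner t k $ i \<le> x $ i \<and> x $ i < corner t k $ i + side t i)" for x
    unfolding dbox_def mem_Collect_eq corner_children S(1) by (subst all) simp
  have r: "x \<in> dbox (Suc t) (2 * k + 1) \<longleftrightarrow> (corner t k $ dir t + len t \<le> x $ dir t \<and> x $ dir t < corner t k $ dir t + len t + len t) \<and>
      (\<forall>i. i \<noteq> dir t \<longrightarrow> corner t k $ i \<le> x $ i \<and> x $ i < corner t k $ i + side t i)" for x
    unfolding dbox_def mem_Collect_eq corner_children S(1) seg_pt_nth by (subst all) simp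
  show ?A ?B using len_pos[of t] by (auto simp: set_eq_iff mem l r[folded Suc_eq_plus1])
qed

lemma dbox_Suc_subset: "dbox (Suc t) k \<subseteq> dbox t (k div 2)"
proof (cases "even k")
  case True
  then have "dbox (Suc t) k = dbox (Suc t) (2 * (k div 2))" by simp
  then show ?thesis using dbox_split(1)[of t "k div 2"] by blast
next
  case False
  then have "dbox (Suc t) k = dbox (Suc t) (2 * (k div 2) + 1)" by simp
  then show ?thesis using dbox_split(1)[of t "k div 2"] by blast
qed

lemma dbox_borel [measurable]: "dbox t k \<in> sets borel"
proof -
  have "dbox t k = (\<Inter>i. {x. corner t k $ i \<le> x $ i} \<inter> {x. x $ i < corner t k $ i + side t i})"
    by (auto simp: dbox_def)
  also have "\<dots> \<in> sets borel"
    by (intro sets.countable_INT'' sets.Int) (auto intro!: borel_closed closed_Collect_le borel_open open_Collect_less continuous_intros)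
  finally show ?thesis .
qed

lemma dbox_disjoint: "disjoint_family_on (dbox t) {..<2 ^ t}"
proof (induction t)
  case 0 then show ?case by (simp add: disjoint_family_on_def)
next
  case (Suc t)
  show ?case
    unfolding disjoint_family_on_def
  proof (intro ballI impI)
    fix k l :: nat assume kl: "k \<in> {..<2 ^ Suc t}" "l \<in> {..<2 ^ Suc t}" "k \<noteq> l"
    show "dbox (Suc t) k \<inter> dbox (Suc t) l = {}"
    proof (cases "k div 2 = l div 2")
      case False
      then have "dbox t (k div 2) \<inter> dbox t (l div 2) = {}"
        using kl by (intro disjoint_family_onD[OF Suc]) auto
      then show ?thesis using dbox_Suc_subset by blast
    next
      case True
      have "k = 2 * (k div 2) \<and> l = 2 * (k div 2) + 1 \<or> l = 2 * (k div 2) \<and> k = 2 * (k div 2) + 1"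
        using kl(3) True by presburger
      then show ?thesis using dbox_split(2)[of t "k div 2"] by (metis Int_commute)
    qed
  qed
qed

lemma dbox_0: "dbox 0 0 = {x. \<forall>i. - real B \<le> x $ i \<and> x $ i < real B}"
  by (auto simp: dbox_def side_0)

lemma sum_double: "(\<Sum>k<2 ^ Suc t. f k) = (\<Sum>k<2 ^ t. f (2 * k) + f (2 * k + 1))"
  for f :: "nat \<Rightarrow> 'b::comm_monoid_add"
proof -
  have "(\<Sum>k<2 * N. f k) = (\<Sum>k<N. f (2 * k) + f (2 * k + 1))" for N
    by (induction N) (auto simp: add.assoc)
  then show ?thesis by simp
qed

lemma dbox_UN: "(\<Union>k<2 ^ t. dbox t k) = dbox 0 0"
proof (induction t)
  case 0 then show ?case by (simp add: lessThan_Suc)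
next
  case (Suc t)
  have "(\<Union>k<2 ^ Suc t. dbox (Suc t) k) = (\<Union>k<2 ^ t. dbox t k)"
  proof
    show "(\<Union>k<2 ^ Suc t. dbox (Suc t) k) \<subseteq> (\<Union>k<2 ^ t. dbox t k)"
      using dbox_Suc_subset by fastforce
    have "dbox t k \<subseteq> (\<Union>k<2 ^ Suc t. dbox (Suc t) k)" if "k < 2 ^ t" for k
      unfolding dbox_split(1)[of t k] using that by (intro Un_least UN_upper) auto
    then show "(\<Union>k<2 ^ t. dbox t k) \<subseteq> (\<Union>k<2 ^ Suc t. dbox (Suc t) k)" by blast
  qed
  then show ?case using Suc by simp
qed

lemma corner_bounds: "- real B \<le> corner t k $ i \<and> corner t k $ i + side t i \<le> real B"
proof (induction t arbitrary: k)
  case 0 then show ?case by (simp add: side_0)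
next
  case (Suc t)
  show ?case using Suc[of "k div 2"] side_pos[of t i]
    by (auto simp: side_Suc seg_pt_nth)
qed

lemma corner_in_dbox: "corner t k \<in> dbox t k"
  using side_pos by (simp add: dbox_def)

lemma dbox_subset_cube: "dbox t k \<subseteq> cube"
proof
  fix x assume "x \<in> dbox t k"
  then have "corner t k $ i \<le> x $ i \<and> x $ i < corner t k $ i + side t i" for i by (simp add: dbox_def)
  then have "- real B \<le> x $ i \<and> x $ i \<le> real B" for i
    using corner_bounds[of t k i] by (meson le_less_trans less_imp_le less_le_trans order_trans)
  then show "x \<in> cube" by (simp add: cube_def)
qed

lemma seg_subset_cube: "seg_pt (corner t k) (dir t) ` {0..len t} \<subseteq> cube"
proof clarify
  fix s assume s: "s \<in> {0..len t}"
  have "- real B \<le> seg_pt (corner t k) (dir t) s $ i \<and> seg_pt (corner t k) (dir t) s $ i \<le> real B" for i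
    using s corner_bounds[of t k i] side_pos[of t i] by (auto simp: seg_pt_nth len_def)
  then show "seg_pt (corner t k) (dir t) s \<in> cube" by (simp add: cube_def)
qed

lemma compact_cube: "compact cube"
proof -
  have "cube = cbox (\<chi> i. - real B) (\<chi> i. real B)"
    by (auto simp: cube_def mem_box_cart)
  then show ?thesis by simp
qed

text \<open>The even numerator keeps \<open>len t\<close>, which is half a side, a multiple of
  1/2^t.\<close>

lemma side_lattice: "\<exists>z::nat. side t i * 2 ^ t = 2 * real z"
proof (induction t)
  case 0 then show ?case by (auto simp: side_0)
next
  case (Suc t)
  then obtain z where z: "side t i * 2 ^ t = 2 * real z" by blast
  then have "side (Suc t) i * 2 ^ Suc t = 2 * real (if i = dir t then z else 2 * z)"
    by (auto simp: side_Suc)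
  then show ?case by blast
qed

lemma corner_lattice: "\<exists>z::int. corner t k $ i * 2 ^ t = of_int z"
proof (induction t arbitrary: k)
  case 0 show ?case by (rule exI[of _ "- int B"]) simp
next
  case (Suc t)
  obtain z where z: "corner t (k div 2) $ i * 2 ^ t = of_int z" using Suc by blast
  obtain y where y: "side t (dir t) * 2 ^ t = 2 * real y" using side_lattice by blast
  have "corner (Suc t) k $ i * 2 ^ Suc t = of_int (if even k \<or> i \<noteq> dir t then 2 * z else 2 * z + 2 * int y)"
    using z y by (auto simp: seg_pt_nth algebra_simps)
  then show ?case by blast
qed

text \<open>\<open>grid_polyhedral\<close> works with a single mesh, so all levels up to v are
  placed on the finest grid.\<close>

lemma corner_lattice': "t \<le> v \<Longrightarrow> \<exists>z::int. corner t k $ i = 1 / 2 ^ v * of_int z"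
proof -
  assume "t \<le> v"
  then obtain q where q: "v = t + q" using le_Suc_ex by blast
  obtain z where "corner t k $ i * 2 ^ t = of_int z" using corner_lattice by blast
  then have "corner t k $ i = 1 / 2 ^ v * of_int (z * 2 ^ q)" by (simp add: q field_simps power_add)
  then show ?thesis by blast
qed

lemma len_lattice: "t \<le> v \<Longrightarrow> \<exists>z::nat. len t = real z * (1 / 2 ^ v)"
proof -
  assume "t \<le> v"
  then obtain q where q: "v = t + q" using le_Suc_ex by blast
  obtain z where "side t (dir t) * 2 ^ t = 2 * real z" using side_lattice by blast
  then have "len t = real (z * 2 ^ q) * (1 / 2 ^ v)" by (simp add: q len_def field_simps power_add)
  then show ?thesis by blast
qed

lemma dist_corner_le:
  assumes "x \<in> dbox t k" shows "dist x (corner t k) \<le> real CARD('n) * (2 * real B * (1/2) ^ (t div CARD('n)))"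
proof -
  have "dist x (corner t k) \<le> (\<Sum>i\<in>UNIV. \<bar>(x - corner t k) $ i\<bar>)"
    unfolding dist_norm by (rule norm_le_l1_cart)
  also have "\<dots> \<le> (\<Sum>i::'n\<in>UNIV. 2 * real B * (1/2) ^ (t div CARD('n)))"
  proof (rule sum_mono)
    fix i
    have "\<bar>(x - corner t k) $ i\<bar> \<le> side t i" using assms by (auto simp: dbox_def abs_le_iff) (metis add.commute add_increasing2 diff_le_eq less_imp_le side_pos)
    then show "\<bar>(x - corner t k) $ i\<bar> \<le> 2 * real B * (1/2) ^ (t div CARD('n))" using side_le order_trans by blast
  qed
  finally show ?thesis by simp
qed

end

section \<open>The flux\<close>

lemma sum_Basis_vec:
  "(\<Sum>b\<in>(Basis :: ('a::euclidean_space ^ 'n) set). F b) = (\<Sum>i\<in>UNIV. \<Sum>u\<in>Basis. F (axis i u))"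
proof -
  have B: "(Basis :: ('a ^ 'n) set) = (\<lambda>p. axis (fst p) (snd p)) ` (UNIV \<times> Basis)"
    unfolding Basis_vec_def by force
  have inj: "inj_on (\<lambda>p. axis (fst p) (snd p) :: 'a ^ 'n) (UNIV \<times> Basis)"
    by (auto simp: inj_on_def axis_eq_axis)
  show ?thesis unfolding B sum.reindex[OF inj] sum.cartesian_product by (simp add: case_prod_unfold)
qed

lemma vm_integral_vec:
  "vm_integral \<mu> \<phi> = (\<Sum>j\<in>UNIV. signed_integral (\<lambda>A. \<mu> A $ j) (\<lambda>x. \<phi> x $ j))"
  for \<phi> :: "'a::topological_space \<Rightarrow> real ^ 'm"
  by (simp add: vm_integral_def sum_Basis_vec inner_axis)

lemma vm_integral_mat:
  "vm_integral \<mu> \<phi> = (\<Sum>i\<in>UNIV. \<Sum>j\<in>UNIV. signed_integral (\<lambda>A. \<mu> A $ i $ j) (\<lambda>x. \<phi> x $ i $ j))"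
  for \<phi> :: "'a::topological_space \<Rightarrow> real ^ 'm ^ 'n"
  by (simp add: vm_integral_def sum_Basis_vec inner_axis)

lemma bounded_compact_support:
  fixes f :: "'a::topological_space \<Rightarrow> real"
  assumes f: "continuous_on UNIV f" and K: "compact K" "\<And>x. x \<notin> K \<Longrightarrow> f x = 0"
  obtains M where "\<And>x. \<bar>f x\<bar> \<le> M"
proof -
  have "compact (f ` K)" using K(1) f by (intro compact_continuous_image) (auto intro: continuous_on_subset)
  from compact_imp_bounded[OF this] obtain M where M: "\<forall>y\<in>f ` K. norm y \<le> M"
    unfolding bounded_iff by blast
  have "\<bar>f x\<bar> \<le> max M 0" for x using M K(2)[of x] by (cases "x \<in> K") (auto simp: le_max_iff_disj)
  then show ?thesis by (rule that)
qed

text \<open>The sets with nonnegative value and those with negative value are united separately;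
  each union has value at most M in modulus.\<close>

lemma signed_variation_bound:
  fixes \<nu> :: "'a::topological_space set \<Rightarrow> real"
  assumes \<nu>: "vector_measure \<nu>" and M: "\<And>A. A \<in> sets borel \<Longrightarrow> \<bar>\<nu> A\<bar> \<le> M"
    and I: "finite I" and A: "\<And>k. k \<in> I \<Longrightarrow> A k \<in> sets borel" "disjoint_family_on A I"
  shows "(\<Sum>k\<in>I. \<bar>\<nu> (A k)\<bar>) \<le> 2 * M"
proof -
  define P where "P = {k \<in> I. 0 \<le> \<nu> (A k)}"
  define N where "N = {k \<in> I. \<not> 0 \<le> \<nu> (A k)}"
  have sub: "P \<subseteq> I" "N \<subseteq> I" by (auto simp: P_def N_def)
  have U: "\<nu> (\<Union>k\<in>J. A k) = (\<Sum>k\<in>J. \<nu> (A k))" if "J \<subseteq> I" for J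
    using that I A by (intro vector_measure_UN[OF \<nu>]) (auto intro: finite_subset disjoint_family_on_mono)
  have b: "(\<Union>k\<in>J. A k) \<in> sets borel" if "J \<subseteq> I" for J
    using that I A by (intro sets.finite_UN) (auto intro: finite_subset)
  have "(\<Sum>k\<in>I. \<bar>\<nu> (A k)\<bar>) = (\<Sum>k\<in>P. \<bar>\<nu> (A k)\<bar>) + (\<Sum>k\<in>N. \<bar>\<nu> (A k)\<bar>)"
    using I unfolding P_def N_def by (subst sum.union_disjoint[symmetric]) (auto intro!: sum.cong)
  also have "\<dots> = (\<Sum>k\<in>P. \<nu> (A k)) + (\<Sum>k\<in>N. - \<nu> (A k))"
    by (intro arg_cong2[where f = "(+)"] sum.cong) (auto simp: P_def N_def)
  also have "\<dots> = \<nu> (\<Union>k\<in>P. A k) - \<nu> (\<Union>k\<in>N. A k)"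
    by (simp add: U[OF sub(1)] U[OF sub(2)] sum_negf)
  also have "\<dots> \<le> 2 * M" using M[OF b[OF sub(1)]] M[OF b[OF sub(2)]] by (simp add: abs_le_iff)
  finally show ?thesis .
qed

text \<open>Both Jordan parts vanish off Q. This allows a test function to be replaced by its cutoff
  to the root box.\<close>

lemma signed_integral_off_null:
  fixes \<nu> :: "'a::topological_space set \<Rightarrow> real"
  assumes \<nu>: "vector_measure \<nu>" and Q: "Q \<in> sets borel" "\<And>A. A \<in> sets borel \<Longrightarrow> A \<inter> Q = {} \<Longrightarrow> \<nu> A = 0"
    and f: "f \<in> borel_measurable borel" "\<And>x. \<bar>f x\<bar> \<le> K" and g: "g \<in> borel_measurable borel" "\<And>x. \<bar>g x\<bar> \<le> L"
    and fg: "\<And>x. x \<in> Q \<Longrightarrow> f x = g x"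
  shows "signed_integral \<nu> f = signed_integral \<nu> g"
proof -
  have "integral\<^sup>L (jordan_pos \<mu>) f = integral\<^sup>L (jordan_pos \<mu>) g"
    if \<mu>: "vector_measure \<mu>" "\<And>A. A \<in> sets borel \<Longrightarrow> A \<inter> Q = {} \<Longrightarrow> \<mu> A = 0" for \<mu>
  proof (rule integral_cong_AE)
    have "emeasure (jordan_pos \<mu>) (- Q) \<le> ennreal 0"
      using Q(1) by (intro emeasure_jordan_le \<mu>(1)) (auto simp: \<mu>(2) disjoint_iff subset_iff)
    then show "AE x in jordan_pos \<mu>. f x = g x"
      using Q(1) fg by (intro AE_I[of _ _ "- Q"]) auto
  qed (use f g in auto)
  from this[OF \<nu> Q(2)] this[OF vector_measure_minus[OF \<nu>]] Q(2) show ?thesis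
    unfolding signed_integral_def by simp
qed

text \<open>Arc length on a segment. As a pushforward of Lebesgue measure it has finite mass and
  explicit integrals at once.\<close>

definition seg_measure :: "real ^ 'n \<Rightarrow> 'n::finite \<Rightarrow> real \<Rightarrow> (real ^ 'n) measure" where
  "seg_measure p i l = distr (density lborel (indicator {0..l})) borel (seg_pt p i)"

lemma seg_pt_measurable [measurable]: "seg_pt p i \<in> borel_measurable borel"
  by (intro borel_measurable_continuous_onI continuous_seg_pt)

lemma sets_seg_measure [simp, measurable_cong]: "sets (seg_measure p i l) = sets borel"
  by (simp add: seg_measure_def)

lemma space_seg_measure [simp]: "space (seg_measure p i l) = UNIV"
  by (simp add: seg_measure_def)

lemma emeasure_seg_measure:
  "A \<in> sets borel \<Longrightarrow> emeasure (seg_measure p i l) A = emeasure lborel ({0..l} \<inter> seg_pt p i -` A)"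
proof -
  assume A [measurable]: "A \<in> sets borel"
  have [measurable]: "seg_pt p i -` A \<in> sets borel"
    by (rule measurable_sets_borel[OF seg_pt_measurable A])
  show ?thesis unfolding seg_measure_def
    by (subst emeasure_distr) (auto simp: emeasure_density nn_integral_indicator simp flip: indicator_inter_arith)
qed

lemma finite_measure_seg: "finite_measure (seg_measure p i l)"
  by (rule finite_measureI) (auto simp: emeasure_seg_measure emeasure_lborel_Icc_eq)

lemma measure_seg_le: "0 \<le> l \<Longrightarrow> A \<in> sets borel \<Longrightarrow> measure (seg_measure p i l) A \<le> l"
proof -
  assume l: "0 \<le> l" and A: "A \<in> sets borel"
  interpret finite_measure "seg_measure p i l" by (rule finite_measure_seg)
  have "measure (seg_measure p i l) A \<le> measure (seg_measure p i l) UNIV"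
    using A by (intro finite_measure_mono) auto
  also have "\<dots> = l" using l by (simp add: measure_def emeasure_seg_measure)
  finally show ?thesis .
qed

lemma measure_seg_null:
  "A \<in> sets borel \<Longrightarrow> A \<inter> seg_pt p i ` {0..l} = {} \<Longrightarrow> measure (seg_measure p i l) A = 0"
proof -
  assume A: "A \<in> sets borel" and "A \<inter> seg_pt p i ` {0..l} = {}"
  then have "{0..l} \<inter> seg_pt p i -` A = {}" by auto
  then show ?thesis unfolding measure_def emeasure_seg_measure[OF A] by (simp only: emeasure_empty enn2real_0)
qed

lemma integral_seg_measure:
  fixes g :: "real ^ 'n \<Rightarrow> real"
  assumes g: "continuous_on UNIV g"
  shows "integral\<^sup>L (seg_measure p i l) g = seg_integral p i l g"
proof -
  have [measurable]: "g \<in> borel_measurable borel" by (rule borel_measurable_continuous_onI[OF g])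
  have "integral\<^sup>L (seg_measure p i l) g = (LINT s|density lborel (\<lambda>s. ennreal (indicator {0..l} s)). g (seg_pt p i s))"
    unfolding seg_measure_def by (subst integral_distr) (auto simp: ennreal_indicator)
  also have "\<dots> = (LINT s:{0..l}|lborel. g (seg_pt p i s))"
    unfolding set_lebesgue_integral_def by (rule integral_density) auto
  also have "\<dots> = seg_integral p i l g"
    unfolding seg_integral_def
    by (intro set_borel_integral_eq_integral(2) borel_integrable_atLeastAtMost' continuous_on_seg g)
  finally show ?thesis .
qed

text \<open>\<open>total\<close> is what compatibility provides, and \<open>null\<close> says that
  rho lives on the half-open root box.\<close>

locale kd_flux = kd_tree e B for e :: "nat \<Rightarrow> 'n::finite" and B +
  fixes \<rho> :: "(real ^ 'n) set \<Rightarrow> real ^ 'm::finite"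
  assumes \<rho>: "vector_measure \<rho>" and total: "\<rho> UNIV = 0"
    and null: "\<And>A. A \<in> sets borel \<Longrightarrow> A \<inter> dbox 0 0 = {} \<Longrightarrow> \<rho> A = 0"
begin

definition wt :: "nat \<Rightarrow> nat \<Rightarrow> real ^ 'm" where "wt t k = \<rho> (dbox (Suc t) (2 * k + 1))"

lemma vm_component: "vector_measure (\<lambda>A. \<rho> A $ j)"
  by (rule vector_measure_bounded_linear[OF \<rho> bounded_linear_vec_nth])

text \<open>The bound is uniform in t because the boxes that receive mass in one step are
  disjoint.\<close>

lemma variation_ex: "\<exists>M\<ge>0. \<forall>t. (\<Sum>k<2 ^ t. \<Sum>j\<in>UNIV. \<bar>wt t k $ j\<bar>) \<le> M"
proof -
  have "\<exists>M\<ge>0. \<forall>A\<in>sets borel. \<bar>\<rho> A $ j\<bar> \<le> M" for j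
    using signed_measure_bounded[OF vm_component] by metis
  then obtain M where M: "\<And>j. 0 \<le> M j" "\<And>j A. A \<in> sets borel \<Longrightarrow> \<bar>\<rho> A $ j\<bar> \<le> M j" by metis
  have "(\<Sum>k<2 ^ t. \<Sum>j\<in>UNIV. \<bar>wt t k $ j\<bar>) \<le> (\<Sum>j\<in>UNIV. 2 * M j)" for t
  proof -
    have "(\<Sum>k<2 ^ t. \<bar>wt t k $ j\<bar>) \<le> 2 * M j" for j
      unfolding wt_def
    proof (rule signed_variation_bound[OF vm_component M(2)])
      show "disjoint_family_on (\<lambda>k. dbox (Suc t) (2 * k + 1)) {..<2 ^ t}"
        using dbox_disjoint[of "Suc t"] unfolding disjoint_family_on_def by force
    qed (auto intro: dbox_borel)
    then show ?thesis by (subst sum.swap) (intro sum_mono)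
  qed
  then show ?thesis using M(1) by (intro exI[of _ "\<Sum>j\<in>UNIV. 2 * M j"]) (auto intro!: sum_nonneg)
qed

text \<open>Some uniform bound on the mass moved in one step, not the total variation
  itself.\<close>

definition var :: real where "var = (SOME M. 0 \<le> M \<and> (\<forall>t. (\<Sum>k<2 ^ t. \<Sum>j\<in>UNIV. \<bar>wt t k $ j\<bar>) \<le> M))"

lemma var: "0 \<le> var" "(\<Sum>k<2 ^ t. \<Sum>j\<in>UNIV. \<bar>wt t k $ j\<bar>) \<le> var"
  using someI_ex[of "\<lambda>M. 0 \<le> M \<and> (\<forall>t. (\<Sum>k<2 ^ t. \<Sum>j\<in>UNIV. \<bar>wt t k $ j\<bar>) \<le> M)"] variation_ex
  unfolding var_def by blast+

lemma var_component: "(\<Sum>k<2 ^ t. \<bar>wt t k $ j\<bar>) \<le> var"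
  by (rule order_trans[OF sum_mono var(2)]) (auto intro: member_le_sum)

text \<open>Entry (i, j) of the matrix measure carried by the segments of step t; they are all
  parallel to \<open>dir t\<close>, so the other rows vanish.\<close>

definition step :: "nat \<Rightarrow> 'n \<Rightarrow> 'm \<Rightarrow> (real ^ 'n) set \<Rightarrow> real" where
  "step t i j A = (\<Sum>k<2 ^ t. (if dir t = i then wt t k $ j else 0) * measure (seg_measure (corner t k) (dir t) (len t)) A)"

definition flux :: "(real ^ 'n) set \<Rightarrow> real ^ 'm ^ 'n" where
  "flux A = (\<chi> i j. \<Sum>t. step t i j A)"

lemma vm_seg: "vector_measure (measure (seg_measure p i l))"
  by (rule vector_measure_measure[OF finite_measure_seg sets_seg_measure])

lemma vm_step: "vector_measure (step t i j)"
  unfolding step_def by (intro vector_measure_sum vector_measure_scale vm_seg)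

lemma step_bound: "A \<in> sets borel \<Longrightarrow> \<bar>step t i j A\<bar> \<le> var * len t"
proof -
  assume A: "A \<in> sets borel"
  have "\<bar>step t i j A\<bar> \<le> (\<Sum>k<2 ^ t. \<bar>wt t k $ j\<bar> * len t)"
    unfolding step_def using measure_seg_le[OF less_imp_le[OF len_pos] A] len_pos[of t]
    by (intro order_trans[OF sum_abs sum_mono]) (auto simp: abs_mult intro!: mult_left_mono)
  also have "\<dots> \<le> var * len t"
    using var_component[of t j] len_pos[of t] by (simp add: sum_distrib_right[symmetric])
  finally show ?thesis .
qed

lemma summable_step: "A \<in> sets borel \<Longrightarrow> summable (\<lambda>t. step t i j A)"
  by (rule summable_comparison_test'[OF summable_mult[OF summable_len, of var]]) (simp add: step_bound)

lemma signed_integral_step_eq: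
  assumes g: "continuous_on UNIV g" "\<And>x. \<bar>g x\<bar> \<le> K"
  shows "signed_integral (step t i j) g =
    (\<Sum>k<2 ^ t. (if dir t = i then wt t k $ j else 0) * seg_integral (corner t k) (dir t) (len t) g)"
proof -
  have "signed_integral (step t i j) g =
    (\<Sum>k<2 ^ t. (if dir t = i then wt t k $ j else 0) * signed_integral (measure (seg_measure (corner t k) (dir t) (len t))) g)"
    by (rule signed_integral_lincomb[OF _ vm_seg vm_step _ borel_measurable_continuous_onI[OF g(1)] g(2)])
       (auto simp: step_def)
  then show ?thesis
    by (simp only: signed_integral_measure[OF finite_measure_seg sets_seg_measure] integral_seg_measure[OF g(1)])
qed

text \<open>The remainder after t steps is at most the tail of the series of
  \<open>var * len u\<close> on every Borel set alike, so
  \<open>signed_measure_uniform_limit\<close> applies.\<close>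

lemma flux_component:
  "vector_measure (\<lambda>A. flux A $ i $ j)" (is ?V)
  "continuous_on UNIV g \<Longrightarrow> (\<And>x. \<bar>g x\<bar> \<le> K) \<Longrightarrow>
    (\<lambda>t. \<Sum>u<t. \<Sum>k<2 ^ u. (if dir u = i then wt u k $ j else 0) * seg_integral (corner u k) (dir u) (len u) g)
      \<longlonglongrightarrow> signed_integral (\<lambda>A. flux A $ i $ j) g" (is "PROP ?C \<Longrightarrow> PROP ?K \<Longrightarrow> ?L")
proof -
  define \<nu> where "\<nu> t A = (\<Sum>u<t. step u i j A)" for t A
  define \<epsilon> where "\<epsilon> t = (\<Sum>u. var * len (u + t))" for t
  have vm: "vector_measure (\<nu> t)" for t unfolding \<nu>_def by (intro vector_measure_sum vm_step)
  have sl: "summable (\<lambda>u. var * len u)" by (intro summable_mult summable_len)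
  have \<epsilon>: "\<epsilon> \<longlonglongrightarrow> 0" unfolding \<epsilon>_def by (rule suminf_exist_split2[OF sl])
  have bd: "\<bar>\<nu> t A - flux A $ i $ j\<bar> \<le> \<epsilon> t" if A: "A \<in> sets borel" for t A
  proof -
    have s: "summable (\<lambda>u. var * len (u + t))" using sl by (simp add: summable_iff_shift[where f = "\<lambda>u. var * len u"])
    have "\<nu> t A - flux A $ i $ j = - (\<Sum>u. step (u + t) i j A)"
      by (simp add: \<nu>_def flux_def suminf_minus_initial_segment[OF summable_step[OF A]])
    moreover have "norm (\<Sum>u. step (u + t) i j A) \<le> \<epsilon> t"
      unfolding \<epsilon>_def by (rule norm_suminf_le[OF _ s]) (simp add: step_bound[OF A])
    ultimately show ?thesis by simp
  qed
  show ?V by (rule signed_measure_uniform_limit(1)[OF vm \<epsilon> bd])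
  assume g: "continuous_on UNIV g" "\<And>x. \<bar>g x\<bar> \<le> K"
  have "(\<lambda>t. signed_integral (\<nu> t) g) \<longlonglongrightarrow> signed_integral (\<lambda>A. flux A $ i $ j) g"
    by (rule signed_measure_uniform_limit(2)[OF vm \<epsilon> bd borel_measurable_continuous_onI[OF g(1)] g(2)])
  moreover have "signed_integral (\<nu> t) g = (\<Sum>u<t. 1 * signed_integral (step u i j) g)" for t
    by (rule signed_integral_lincomb[OF _ vm_step vm _ borel_measurable_continuous_onI[OF g(1)] g(2)])
       (auto simp: \<nu>_def)
  ultimately show ?L by (simp add: signed_integral_step_eq[OF g])
qed

text \<open>Step u only charges row \<open>dir u\<close>, so the sum over rows collapses to the
  function g of that row.\<close>

lemma flux_limit:
  assumes g: "\<And>i. continuous_on UNIV (g i)" "\<And>i x. \<bar>g i x\<bar> \<le> K i"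
  shows "(\<lambda>t. \<Sum>u<t. \<Sum>k<2 ^ u. wt u k $ j * seg_integral (corner u k) (dir u) (len u) (g (dir u)))
      \<longlonglongrightarrow> (\<Sum>i\<in>UNIV. signed_integral (\<lambda>A. flux A $ i $ j) (g i))"
proof -
  have "(\<lambda>t. \<Sum>i\<in>UNIV. \<Sum>u<t. \<Sum>k<2 ^ u. (if dir u = i then wt u k $ j else 0) * seg_integral (corner u k) (dir u) (len u) (g i))
      \<longlonglongrightarrow> (\<Sum>i\<in>UNIV. signed_integral (\<lambda>A. flux A $ i $ j) (g i))"
    by (intro tendsto_sum flux_component(2)[OF g])
  moreover have "(\<Sum>i\<in>UNIV. \<Sum>u<t. \<Sum>k<2 ^ u. (if dir u = i then wt u k $ j else 0) * seg_integral (corner u k) (dir u) (len u) (g i)) =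
      (\<Sum>u<t. \<Sum>k<2 ^ u. wt u k $ j * seg_integral (corner u k) (dir u) (len u) (g (dir u)))" for t
  proof -
    have "(\<Sum>i\<in>UNIV. (if dir u = i then wt u k $ j else 0) * seg_integral (corner u k) (dir u) (len u) (g i)) =
        (\<Sum>i\<in>UNIV. if dir u = i then wt u k $ j * seg_integral (corner u k) (dir u) (len u) (g i) else 0)" for u k
      by (intro sum.cong) auto
    then have *: "(\<Sum>i\<in>UNIV. (if dir u = i then wt u k $ j else 0) * seg_integral (corner u k) (dir u) (len u) (g i)) =
        wt u k $ j * seg_integral (corner u k) (dir u) (len u) (g (dir u))" for u k
      by (simp add: sum.delta')
    show ?thesis
      by (subst sum.swap, rule sum.cong[OF refl], subst sum.swap, rule sum.cong[OF refl]) (rule *)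
  qed
  ultimately show ?thesis by simp
qed

lemma vector_measure_flux: "vector_measure flux"
  by (intro vector_measure_vecI flux_component(1))

lemma flux_support: "vm_support flux \<subseteq> cube" "compact (vm_support flux)"
proof -
  have "open (- cube)" using compact_cube by (simp add: compact_imp_closed open_Compl)
  moreover have "flux A = 0" if A: "A \<in> sets borel" "A \<subseteq> - cube" for A
  proof -
    have "measure (seg_measure (corner t k) (dir t) (len t)) A = 0" for t k
      using A seg_subset_cube[of t k] by (intro measure_seg_null) auto
    then show ?thesis by (simp add: flux_def step_def vec_eq_iff)
  qed
  ultimately show sub: "vm_support flux \<subseteq> cube" unfolding vm_support_def by blast
  have "closed (vm_support flux)" unfolding vm_support_def by (intro closed_Compl open_Union) auto
  then show "compact (vm_support flux)"
    using sub compact_cube by (metis closed_Int_compact inf.absorb_iff1)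
qed

section \<open>Riemann sums and the divergence of the flux\<close>

definition riemann :: "(real ^ 'n \<Rightarrow> real) \<Rightarrow> 'm \<Rightarrow> nat \<Rightarrow> real" where
  "riemann \<phi> j t = (\<Sum>k<2 ^ t. \<rho> (dbox t k) $ j * \<phi> (corner t k))"

text \<open>The even child keeps the corner of its parent, so refining the Riemann sum changes only
  the point at which the mass of the odd child is evaluated.\<close>

lemma telescope:
  "(\<Sum>k<2 ^ t. wt t k $ j * (\<phi> (seg_pt (corner t k) (dir t) (len t)) - \<phi> (corner t k))) =
    riemann \<phi> j (Suc t) - riemann \<phi> j t"
proof -
  have split: "\<rho> (dbox t k) = \<rho> (dbox (Suc t) (2 * k)) + wt t k" for k
    unfolding wt_def by (subst dbox_split(1), rule vector_measure_Un[OF \<rho> dbox_borel dbox_borel dbox_split(2)])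
  have Suc: "riemann \<phi> j (Suc t) = (\<Sum>k<2 ^ t. \<rho> (dbox (Suc t) (2 * k)) $ j * \<phi> (corner t k) +
      wt t k $ j * \<phi> (seg_pt (corner t k) (dir t) (len t)))"
    unfolding riemann_def sum_double corner_children wt_def ..
  show ?thesis unfolding Suc
    unfolding riemann_def sum_subtractf[symmetric] by (intro sum.cong refl) (simp add: split algebra_simps)
qed

text \<open>The root box carries the whole mass, which is zero; this is where compatibility
  enters.\<close>

lemma riemann_0: "riemann \<phi> j 0 = 0"
proof -
  have "\<rho> (dbox 0 0 \<union> - dbox 0 0) = \<rho> (dbox 0 0) + \<rho> (- dbox 0 0)"
    by (rule vector_measure_Un[OF \<rho> dbox_borel]) (use dbox_borel[of 0 0] in auto)
  moreover have "\<rho> (- dbox 0 0) = 0" using dbox_borel[of 0 0] by (intro null) auto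
  ultimately show ?thesis by (simp add: riemann_def total lessThan_Suc)
qed

text \<open>A Riemann sum is the integral of the step function \<open>st t\<close>. The test
  function is cut off to \<open>\<psi>\<close> outside the root box, where rho vanishes, so that
  uniform continuity on the cube makes the approximation uniform on the whole space.\<close>

lemma riemann_limit:
  assumes \<phi>: "continuous_on UNIV \<phi>" "\<And>x. \<bar>\<phi> x\<bar> \<le> K"
  shows "(\<lambda>t. riemann \<phi> j t) \<longlonglongrightarrow> signed_integral (\<lambda>A. \<rho> A $ j) \<phi>"
proof -
  define Q where "Q = dbox 0 0"
  have Q: "Q \<in> sets borel" "Q \<subseteq> cube" unfolding Q_def by (auto intro: dbox_borel dest: subsetD[OF dbox_subset_cube])
  have \<phi>m [measurable]: "\<phi> \<in> borel_measurable borel" by (rule borel_measurable_continuous_onI[OF \<phi>(1)])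
  define \<psi> where "\<psi> x = \<phi> x * indicator Q x" for x
  have \<psi>m: "\<psi> \<in> borel_measurable borel" unfolding \<psi>_def using Q by measurable
  have K: "0 \<le> K" by (rule order_trans[OF abs_ge_zero \<phi>(2)])
  have \<psi>K: "\<bar>\<psi> x\<bar> \<le> K" for x using \<phi>(2)[of x] K by (auto simp: \<psi>_def indicator_def)
  define st where "st t x = (\<Sum>k<2 ^ t. \<phi> (corner t k) * indicator (dbox t k) x)" for t x
  have stm: "st t \<in> borel_measurable borel" for t unfolding st_def by measurable
  have stK: "\<bar>st t x\<bar> \<le> 2 ^ t * K" for t x
  proof -
    have "\<bar>st t x\<bar> \<le> (\<Sum>k<2 ^ t::nat. K)" unfolding st_def
      using \<phi>(2) K by (intro order_trans[OF sum_abs sum_mono]) (auto simp: indicator_def)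
    then show ?thesis by simp
  qed
  obtain M where M: "0 \<le> M" "\<And>A. A \<in> sets borel \<Longrightarrow> \<bar>\<rho> A $ j\<bar> \<le> M"
    using signed_measure_bounded[OF vm_component] by metis
  have r: "riemann \<phi> j t = signed_integral (\<lambda>A. \<rho> A $ j) (st t)" for t
    unfolding st_def riemann_def
    by (subst signed_integral_step[OF vm_component]) (auto simp: dbox_borel mult.commute)
  have p: "signed_integral (\<lambda>A. \<rho> A $ j) \<phi> = signed_integral (\<lambda>A. \<rho> A $ j) \<psi>"
    by (rule signed_integral_off_null[OF vm_component Q(1) _ \<phi>m \<phi>(2) \<psi>m \<psi>K])
       (auto simp: null Q_def \<psi>_def)
  have "uniformly_continuous_on cube \<phi>"
    using \<phi>(1) compact_cube by (intro compact_uniformly_continuous) (auto intro: continuous_on_subset)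
  note uc = this[unfolded uniformly_continuous_on_def, rule_format]
  have z: "(\<lambda>t. real CARD('n) * (2 * real B * (1/2) ^ (t div CARD('n)))) \<longlonglongrightarrow> 0"
    using summable_LIMSEQ_zero[OF summable_mult[OF summable_half_power_div, of "real CARD('n) * (2 * real B)"]]
    by (simp add: mult.assoc)
  show ?thesis
  proof (rule LIMSEQ_I)
    fix r :: real assume r0: "0 < r"
    \<comment> \<open>Chosen to make \<open>2 * M * \<epsilon>\<close> smaller than r even if M =
      0.\<close>
    define \<epsilon> where "\<epsilon> = r / (4 * M + 2)"
    have \<epsilon>: "0 < \<epsilon>" using r0 M by (simp add: \<epsilon>_def)
    obtain d where d: "0 < d" "\<And>x x'. x \<in> cube \<Longrightarrow> x' \<in> cube \<Longrightarrow> dist x' x < d \<Longrightarrow> dist (\<phi> x') (\<phi> x) < \<epsilon>"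
      using uc[OF \<epsilon>] by metis
    obtain N where N: "\<And>t. t \<ge> N \<Longrightarrow> real CARD('n) * (2 * real B * (1/2) ^ (t div CARD('n))) < d"
      using order_tendstoD(2)[OF z d(1)] by (auto simp: eventually_sequentially)
    have "norm (riemann \<phi> j t - signed_integral (\<lambda>A. \<rho> A $ j) \<phi>) < r" if t: "t \<ge> N" for t
    proof -
      have near: "\<bar>st t x - \<psi> x\<bar> \<le> \<epsilon>" for x
      proof (cases "x \<in> Q")
        case True
        then obtain k where k: "k < 2 ^ t" "x \<in> dbox t k" using dbox_UN[of t] by (auto simp: Q_def)
        have "indicator (dbox t l) x = (if l = k then 1 else 0 :: real)" if "l < 2 ^ t" for l
          using disjoint_family_onD[OF dbox_disjoint[of t], of l k] that k by (auto simp: indicator_def)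
        then have "st t x = (\<Sum>l<2 ^ t. if l = k then \<phi> (corner t l) else 0)"
          unfolding st_def by (intro sum.cong) auto
        then have "st t x = \<phi> (corner t k)" using k by simp
        moreover have "dist (\<phi> (corner t k)) (\<phi> x) < \<epsilon>"
        proof (rule d(2))
          show "x \<in> cube" "corner t k \<in> cube" using k(2) corner_in_dbox dbox_subset_cube by blast+
          show "dist (corner t k) x < d" using dist_corner_le[OF k(2)] N[OF t] by (simp add: dist_commute)
        qed
        ultimately show ?thesis using True by (simp add: \<psi>_def dist_real_def less_imp_le)
      next
        case False
        then have "x \<notin> dbox t l" if "l < 2 ^ t" for l using dbox_UN[of t] that by (auto simp: Q_def)
        then show ?thesis using False \<epsilon> by (simp add: st_def \<psi>_def)
      qed
      have "riemann \<phi> j t - signed_integral (\<lambda>A. \<rho> A $ j) \<phi> = signed_integral (\<lambda>A. \<rho> A $ j) (\<lambda>x. st t x - \<psi> x)"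
        unfolding r p by (rule signed_integral_diff[OF vm_component stm stK \<psi>m \<psi>K, symmetric])
      also have "\<bar>\<dots>\<bar> \<le> 2 * M * \<epsilon>"
        by (rule signed_integral_bound[OF vm_component _ near M(2)]) (use stm \<psi>m in auto)
      finally have le: "\<bar>riemann \<phi> j t - signed_integral (\<lambda>A. \<rho> A $ j) \<phi>\<bar> \<le> 2 * M * \<epsilon>" .
      have "4 * M + 2 \<noteq> 0" using M(1) by linarith
      then have "\<epsilon> * (4 * M + 2) = r" by (simp add: \<epsilon>_def)
      then have "2 * M * \<epsilon> < r" using r0 \<epsilon> by (simp add: algebra_simps)
      with le show ?thesis by simp
    qed
    then show "\<exists>N. \<forall>t\<ge>N. norm (riemann \<phi> j t - signed_integral (\<lambda>A. \<rho> A $ j) \<phi>) < r" by blast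
  qed
qed

end

lemma seg_integral_derivative:
  fixes \<phi> :: "real ^ 'n \<Rightarrow> real ^ 'm"
  assumes d: "\<And>x. \<phi> differentiable at x" and l: "0 \<le> l"
  shows "seg_integral p i l (\<lambda>x. jacobian \<phi> x $ i $ j) = \<phi> (seg_pt p i l) $ j - \<phi> p $ j"
proof -
  have "((\<lambda>s. \<phi> (seg_pt p i s) $ j) has_vector_derivative jacobian \<phi> (seg_pt p i s) $ i $ j) (at s within {0..l})" for s
  proof -
    have 1: "(seg_pt p i has_derivative (\<lambda>h. h *\<^sub>R axis i 1)) (at s within {0..l})"
      unfolding seg_pt_def by (auto intro!: derivative_eq_intros)
    have 2: "(\<phi> has_derivative frechet_derivative \<phi> (at (seg_pt p i s))) (at (seg_pt p i s))"
      using d frechet_derivative_works by blast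
    have "((\<lambda>s. \<phi> (seg_pt p i s)) has_derivative (\<lambda>h. frechet_derivative \<phi> (at (seg_pt p i s)) (h *\<^sub>R axis i 1))) (at s within {0..l})"
      using has_derivative_compose[OF 1 2] .
    then have "((\<lambda>s. \<phi> (seg_pt p i s) $ j) has_derivative (\<lambda>h. frechet_derivative \<phi> (at (seg_pt p i s)) (h *\<^sub>R axis i 1) $ j)) (at s within {0..l})"
      by (rule bounded_linear.has_derivative[OF bounded_linear_vec_nth])
    moreover have "frechet_derivative \<phi> (at (seg_pt p i s)) (h *\<^sub>R axis i 1) $ j = h *\<^sub>R jacobian \<phi> (seg_pt p i s) $ i $ j" for h
      using linear_scale[OF linear_frechet_derivative[OF d]] by (simp add: jacobian_def)
    ultimately show ?thesis by (simp add: has_vector_derivative_def)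
  qed
  then have "((\<lambda>s. jacobian \<phi> (seg_pt p i s) $ i $ j) has_integral (\<phi> (seg_pt p i l) $ j - \<phi> (seg_pt p i 0) $ j)) {0..l}"
    using l by (intro fundamental_theorem_of_calculus) auto
  then show ?thesis by (simp add: seg_integral_def integral_unique seg_pt_def)
qed

lemma smooth_jacobian:
  fixes \<phi> :: "real ^ 'n \<Rightarrow> real ^ 'm"
  assumes "smooth \<phi>"
  shows "\<phi> differentiable at x" "continuous_on UNIV \<phi>" "continuous_on UNIV (\<lambda>x. jacobian \<phi> x $ i $ j)"
proof -
  have "C_diff (Suc 0) \<phi>" "C_diff 0 \<phi>" using assms unfolding smooth_def by blast+
  then show "\<phi> differentiable at x" "continuous_on UNIV \<phi>" "continuous_on UNIV (\<lambda>x. jacobian \<phi> x $ i $ j)"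
    unfolding jacobian_def by (auto intro!: continuous_on_component)
qed

lemma jacobian_off_support:
  fixes \<phi> :: "real ^ 'n \<Rightarrow> real ^ 'm"
  assumes "x \<notin> closure {x. \<phi> x \<noteq> 0}"
  shows "jacobian \<phi> x $ i $ j = 0"
proof -
  have "open (- closure {x. \<phi> x \<noteq> 0})" by (rule open_Compl) (rule closed_closure)
  then have "(\<phi> has_derivative (\<lambda>_. 0)) (at x)"
    using assms closure_subset[of "{x. \<phi> x \<noteq> 0}"]
    by (intro has_derivative_transform_within_open[OF has_derivative_const[of 0]]) auto
  then have "frechet_derivative \<phi> (at x) = (\<lambda>_. 0)" by (rule frechet_derivative_at[symmetric])
  then show ?thesis by (simp add: jacobian_def)
qed

text \<open>As the Riemann sum of the root is zero, the partial sums tested with the Jacobian are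
  exactly the Riemann sums, whose limit is then evaluated in two ways.\<close>

lemma (in kd_flux) flux_divergence:
  fixes \<phi> :: "real ^ 'n \<Rightarrow> real ^ 'm"
  assumes \<phi>: "smooth \<phi>" "compact (closure {x. \<phi> x \<noteq> 0})"
  shows "divergence flux \<phi> = - vm_integral \<rho> \<phi>"
proof -
  have "\<exists>K. \<forall>x. \<bar>jacobian \<phi> x $ i $ j\<bar> \<le> K" for i j
    by (rule bounded_compact_support[OF smooth_jacobian(3)[OF \<phi>(1)] \<phi>(2) jacobian_off_support]) blast+
  then obtain K where K: "\<And>i j x. \<bar>jacobian \<phi> x $ i $ j\<bar> \<le> K i j" by metis
  have cj: "continuous_on UNIV (\<lambda>x. \<phi> x $ j)" for j
    by (intro continuous_on_component smooth_jacobian(2)[OF \<phi>(1)])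
  have "(\<Sum>i\<in>UNIV. signed_integral (\<lambda>A. flux A $ i $ j) (\<lambda>x. jacobian \<phi> x $ i $ j)) =
      signed_integral (\<lambda>A. \<rho> A $ j) (\<lambda>x. \<phi> x $ j)" for j
  proof -
    have off: "\<phi> x $ j = 0" if "x \<notin> closure {x. \<phi> x \<noteq> 0}" for x
      
    proof -
      have "\<phi> x = 0" using that closure_subset[of "{x. \<phi> x \<noteq> 0}"] by blast
      then show ?thesis by simp
    qed
    obtain L where L: "\<And>x. \<bar>\<phi> x $ j\<bar> \<le> L"
      using bounded_compact_support[OF cj \<phi>(2) off] by blast
    have "(\<Sum>u<t. \<Sum>k<2 ^ u. wt u k $ j * seg_integral (corner u k) (dir u) (len u) (\<lambda>x. jacobian \<phi> x $ dir u $ j)) =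
        riemann (\<lambda>x. \<phi> x $ j) j t" for t
    proof -
      have "(\<Sum>k<2 ^ u. wt u k $ j * seg_integral (corner u k) (dir u) (len u) (\<lambda>x. jacobian \<phi> x $ dir u $ j)) =
        riemann (\<lambda>x. \<phi> x $ j) j (Suc u) - riemann (\<lambda>x. \<phi> x $ j) j u" for u
        unfolding telescope[symmetric] using seg_integral_derivative[OF smooth_jacobian(1)[OF \<phi>(1)] less_imp_le[OF len_pos]]
        by (intro sum.cong refl) simp
      then show ?thesis by (simp add: sum_lessThan_telescope riemann_0)
    qed
    then have "(\<lambda>t. riemann (\<lambda>x. \<phi> x $ j) j t) \<longlonglongrightarrow> (\<Sum>i\<in>UNIV. signed_integral (\<lambda>A. flux A $ i $ j) (\<lambda>x. jacobian \<phi> x $ i $ j))"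
      using flux_limit[of "\<lambda>i x. jacobian \<phi> x $ i $ j" "\<lambda>i. K i j" j, OF smooth_jacobian(3)[OF \<phi>(1)] K] by simp
    then show ?thesis using riemann_limit[OF cj L] LIMSEQ_unique by blast
  qed
  then show ?thesis
    unfolding divergence_def vm_integral_mat vm_integral_vec by (subst sum.swap) simp
qed

section \<open>Flat convergence and energy\<close>

text \<open>
  A monotone subsequence of the norms converges in the extended reals, so neither a triangle inequality
  for the polyhedral flat norm nor convergence of the whole sequence is needed.
\<close>

lemma flat_norm_le:
  fixes X :: "('n::finite, 'm::finite) current"
  assumes P: "flat_approx k P X" and b: "\<And>i. poly_flat_norm k (P i) \<le> b"
  shows "flat_norm k X \<le> b"
proof -
  obtain r :: "nat \<Rightarrow> nat" where r: "strict_mono r" "monoseq (\<lambda>i. poly_flat_norm k (P (r i)))"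
    using seq_monosub[of "\<lambda>i. poly_flat_norm k (P i)"] by metis
  obtain L where L: "(\<lambda>i. poly_flat_norm k (P (r i))) \<longlonglongrightarrow> L"
    using r(2) LIMSEQ_SUP LIMSEQ_INF unfolding monoseq_iff by blast
  have "flat_approx k (\<lambda>i. P (r i)) X"
    unfolding flat_approx_def
  proof (intro conjI allI impI)
    show "polyhedral k (P (r i))" for i using P by (simp add: flat_approx_def)
  next
    fix \<epsilon> :: real assume "0 < \<epsilon>"
    then obtain N where N: "\<And>a b. N \<le> a \<Longrightarrow> N \<le> b \<Longrightarrow> poly_flat_norm k (current_minus (P a) (P b)) < ennreal \<epsilon>"
      using P unfolding flat_approx_def by meson
    have "N \<le> r a" if "N \<le> a" for a using seq_suble[OF r(1), of a] that by simp
    then show "\<exists>N. \<forall>a\<ge>N. \<forall>b\<ge>N. poly_flat_norm k (current_minus (P (r a)) (P (r b))) < ennreal \<epsilon>"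
      using N by blast
  next
    fix j and \<omega> :: "'n form" assume "test_form k \<omega>"
    then have "(\<lambda>i. P i j \<omega>) \<longlonglongrightarrow> X j \<omega>" using P by (simp add: flat_approx_def)
    from LIMSEQ_subseq_LIMSEQ[OF this r(1)] show "(\<lambda>i. P (r i) j \<omega>) \<longlonglongrightarrow> X j \<omega>" by (simp add: comp_def)
  qed
  then have "flat_norm k X \<le> L" unfolding flat_norm_def using L by (intro Inf_lower) auto
  also have "L \<le> b" using b by (intro LIMSEQ_le_const2[OF L]) auto
  finally show ?thesis .
qed

lemma poly_flat_norm_le_mass:
  fixes P R :: "('n::finite, 'm::finite) current"
  assumes R: "polyhedral k R" and eq: "\<And>j \<omega>. test_form k \<omega> \<Longrightarrow> P j \<omega> = R j \<omega>"
  shows "poly_flat_norm k P \<le> mass k R"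
proof -
  define Z :: "('n, 'm) current" where "Z = (\<lambda>j \<omega>. 0)"
  have "polyhedral (Suc k) Z"
    unfolding polyhedral_def by (intro exI[of _ "[]"]) (simp add: polyhedral_data_def polyhedral_current_def Z_def)
  then have "poly_flat_norm k P \<le> mass k R + mass (Suc k) Z"
    unfolding poly_flat_norm_def using R eq
    by (intro Inf_lower CollectI exI[of _ R] exI[of _ Z]) (simp add: Z_def boundary_def)
  moreover have "mass (Suc k) Z \<le> 0"
    unfolding mass_def by (rule SUP_least) (simp add: current_apply_def Z_def)
  ultimately show ?thesis by simp
qed

lemma current_support_polyhedral:
  fixes Ps :: "('n::finite, 'm::finite) piece list"
  assumes K: "closed K" and sub: "\<And>\<sigma> \<tau> \<theta>. (\<sigma>, \<tau>, \<theta>) \<in> set Ps \<Longrightarrow> \<sigma> \<subseteq> K"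
  shows "current_support k (polyhedral_current k Ps) \<subseteq> K"
proof -
  have "current_apply (polyhedral_current k Ps) \<omega> = 0"
    if \<omega>: "\<forall>j. test_form k (\<omega> j) \<and> form_support (\<omega> j) \<subseteq> - K" for \<omega> :: "'m \<Rightarrow> 'n form"
  proof -
    have zero: "\<omega> j x v = 0" if "x \<in> K" for j x v
    proof (rule ccontr)
      assume "\<omega> j x v \<noteq> 0"
      then have "x \<in> form_support (\<omega> j)"
        unfolding form_support_def using closure_subset[of "{x. \<exists>v. \<omega> j x v \<noteq> 0}"] by blast
      then show False using \<omega> that by blast
    qed
    have "(LINT x:\<sigma>|hausdorff_measure k. \<theta> $ j * \<omega> j x \<tau>) = 0" if "(\<sigma>, \<tau>, \<theta>) \<in> set Ps" for \<sigma> \<tau> \<theta> j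
    proof -
      have "(\<lambda>x. indicator \<sigma> x *\<^sub>R (\<theta> $ j * \<omega> j x \<tau>)) = (\<lambda>_. 0)"
        using sub[OF that] zero by (auto simp: fun_eq_iff indicator_def)
      then show ?thesis unfolding set_lebesgue_integral_def by (simp only: Bochner_Integration.integral_zero)
    qed
    then have "map (\<lambda>(\<sigma>, \<tau>, \<theta>). LINT x:\<sigma>|hausdorff_measure k. \<theta> $ j * \<omega> j x \<tau>) Ps = map (\<lambda>_. 0) Ps" for j
      by (intro map_cong refl) (auto split: prod.splits)
    then have "polyhedral_current k Ps j (\<omega> j) = 0" for j
      unfolding polyhedral_current_def by (simp only: sum_list_0)
    then show ?thesis by (simp add: current_apply_def)
  qed
  moreover have "open (- K)" using K by (rule open_Compl)
  ultimately show ?thesis unfolding current_support_def by blast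
qed

lemma test_form_continuous: "test_form k \<omega> \<Longrightarrow> continuous_on UNIV (\<lambda>x. \<omega> x v)"
  unfolding test_form_def smooth_def by (metis C_diff.simps(1))

lemma test_form_bounded:
  assumes "test_form k \<omega>" obtains K where "\<And>x. \<bar>\<omega> x v\<bar> \<le> K"
proof (rule bounded_compact_support[OF test_form_continuous[OF assms]])
  show "compact (form_support \<omega>)" using assms by (simp add: test_form_def)
  show "\<omega> x v = 0" if "x \<notin> form_support \<omega>" for x
    using that closure_subset[of "{x. \<exists>v. \<omega> x v \<noteq> 0}"] unfolding form_support_def by blast
qed (rule that)

lemma seg_integral_bound:
  assumes "continuous_on UNIV g" "\<And>x. \<bar>g x\<bar> \<le> K" "0 \<le> l"
  shows "\<bar>seg_integral p i l g\<bar> \<le> K * l"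
  using integral_bound[of 0 l "\<lambda>s. g (seg_pt p i s)" K] assms continuous_on_seg[OF assms(1)]
  by (simp add: seg_integral_def)

context kd_flux
begin

section \<open>Blocks of consecutive steps as polyhedral currents\<close>

definition form_step :: "nat \<Rightarrow> 'm \<Rightarrow> 'n form \<Rightarrow> real" where
  "form_step t j \<omega> =
    (\<Sum>k<2 ^ t. wt t k $ j * seg_integral (corner t k) (dir t) (len t) (\<lambda>x. \<omega> x (\<lambda>_. axis (dir t) 1)))"

lemma flux_current_limit:
  assumes \<omega>: "test_form 1 \<omega>"
  shows "(\<lambda>t. \<Sum>u<t. form_step u j \<omega>) \<longlonglongrightarrow> measure_current flux j \<omega>"
proof -
  have "\<exists>K. \<forall>x. \<bar>\<omega> x (\<lambda>_. axis i 1)\<bar> \<le> K" for i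
    by (rule test_form_bounded[OF \<omega>]) blast
  then obtain K where K: "\<And>i x. \<bar>\<omega> x (\<lambda>_. axis i 1)\<bar> \<le> K i" by metis
  have "measure_current flux j \<omega> = (\<Sum>i\<in>UNIV. signed_integral (\<lambda>A. flux A $ i $ j) (\<lambda>x. \<omega> x (\<lambda>_. axis i 1)))"
    by (simp add: measure_current_def vm_integral_vec column_def)
  then show ?thesis
    unfolding form_step_def
    using flux_limit[of "\<lambda>i x. \<omega> x (\<lambda>_. axis i 1)" K j, OF test_form_continuous[OF \<omega>] K] by simp
qed

text \<open>The sign c is included because differences of partial sums in either order must
  themselves be polyhedral currents; evenness of the cost leaves the energy bound unchanged.\<close>

lemma block:
  fixes C :: "real ^ 'm \<Rightarrow> real"
  assumes C: "C 0 = 0" "\<And>\<eta> \<theta>. C (\<eta> + \<theta>) \<le> C \<eta> + C \<theta>" "\<And>\<theta>. C (- \<theta>) = C \<theta>"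
    and c: "c = 1 \<or> c = - 1"
  obtains Ps :: "('n, 'm) piece list" where "polyhedral_data 1 Ps"
    "\<And>j \<omega>. (\<And>v. continuous_on UNIV (\<lambda>x. \<omega> x v)) \<Longrightarrow>
        polyhedral_current 1 Ps j \<omega> = c * (\<Sum>t\<in>{u..<v}. form_step t j \<omega>)"
    "discrete_energy C Ps \<le> (\<Sum>t\<in>{u..<v}. \<Sum>k<2 ^ t. C (wt t k) * len t)"
    "\<And>\<sigma> \<tau> \<eta>. (\<sigma>, \<tau>, \<eta>) \<in> set Ps \<Longrightarrow> \<sigma> \<subseteq> cube"
proof -
  define A where "A = Sigma {u..<v} (\<lambda>t. {..<2 ^ t :: nat})"
  \<comment> \<open>The mesh of level v, on which the corners and lengths of all steps of the block
    lie.\<close>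
  define \<delta> :: real where "\<delta> = 1 / 2 ^ v"
  have "\<forall>t. \<exists>z. t \<le> v \<longrightarrow> len t = real z * \<delta>" unfolding \<delta>_def using len_lattice by blast
  then obtain l where l: "\<And>t. t \<le> v \<Longrightarrow> len t = real (l t) * \<delta>" by metis
  have lA: "real (l (fst a)) * \<delta> = len (fst a)" if "a \<in> A" for a
    using that l by (auto simp: A_def)
  have sumA: "(\<Sum>a\<in>A. F (fst a) (snd a)) = (\<Sum>t\<in>{u..<v}. \<Sum>k<2 ^ t. F t k)" for F :: "nat \<Rightarrow> nat \<Rightarrow> real"
    unfolding A_def by (subst sum.Sigma) (auto simp: case_prod_unfold)
  show ?thesis
  proof (rule grid_polyhedral[where A = A and \<delta> = \<delta> and C = C and p = "\<lambda>a. corner (fst a) (snd a)" and d = "\<lambda>a. dir (fst a)"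
        and l = "\<lambda>a. l (fst a)" and \<theta> = "\<lambda>a. c *\<^sub>R wt (fst a) (snd a)"])
    show "finite A" by (simp add: A_def)
    show "0 < \<delta>" by (simp add: \<delta>_def)
    show "\<exists>z::int. corner (fst a) (snd a) $ i = \<delta> * of_int z" if "a \<in> A" for a i
      unfolding \<delta>_def using that by (intro corner_lattice') (auto simp: A_def)
    show "C 0 = 0" "\<And>\<eta> \<theta>. C (\<eta> + \<theta>) \<le> C \<eta> + C \<theta>" by (rule C)+
    fix Ps :: "('n, 'm) piece list"
    assume Ps: "polyhedral_data 1 Ps"
      "\<And>j \<omega>. (\<And>v. continuous_on UNIV (\<lambda>x. \<omega> x v)) \<Longrightarrow> polyhedral_current 1 Ps j \<omega> =
        (\<Sum>a\<in>A. (c *\<^sub>R wt (fst a) (snd a)) $ j * seg_integral (corner (fst a) (snd a)) (dir (fst a)) (real (l (fst a)) * \<delta>) (\<lambda>x. \<omega> x (\<lambda>_. axis (dir (fst a)) 1)))"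
      "discrete_energy C Ps \<le> (\<Sum>a\<in>A. C (c *\<^sub>R wt (fst a) (snd a)) * (real (l (fst a)) * \<delta>))"
      "\<And>\<sigma> \<tau> \<eta>. (\<sigma>, \<tau>, \<eta>) \<in> set Ps \<Longrightarrow> \<exists>a\<in>A. \<sigma> \<subseteq> seg_pt (corner (fst a) (snd a)) (dir (fst a)) ` {0..real (l (fst a)) * \<delta>}"
    show ?thesis
    proof (rule that[OF Ps(1)])
      fix j and \<omega> :: "'n form" assume \<omega>: "\<And>v. continuous_on UNIV (\<lambda>x. \<omega> x v)"
      have "polyhedral_current 1 Ps j \<omega> = (\<Sum>a\<in>A. c * (wt (fst a) (snd a) $ j * seg_integral (corner (fst a) (snd a)) (dir (fst a)) (len (fst a)) (\<lambda>x. \<omega> x (\<lambda>_. axis (dir (fst a)) 1))))"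
        unfolding Ps(2)[OF \<omega>] by (intro sum.cong refl) (simp add: lA)
      also have "\<dots> = c * (\<Sum>t\<in>{u..<v}. form_step t j \<omega>)"
        unfolding form_step_def sum_distrib_left[symmetric]
        by (rule arg_cong[where f = "\<lambda>x. c * x"], rule sumA)
      finally show "polyhedral_current 1 Ps j \<omega> = c * (\<Sum>t\<in>{u..<v}. form_step t j \<omega>)" .
    next
      have "(\<Sum>a\<in>A. C (c *\<^sub>R wt (fst a) (snd a)) * (real (l (fst a)) * \<delta>)) = (\<Sum>a\<in>A. C (wt (fst a) (snd a)) * len (fst a))"
        using c C(3) by (intro sum.cong refl) (auto simp: lA)
      then show "discrete_energy C Ps \<le> (\<Sum>t\<in>{u..<v}. \<Sum>k<2 ^ t. C (wt t k) * len t)"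
        using Ps(3) sumA[of "\<lambda>t k. C (wt t k) * len t"] by simp
    next
      fix \<sigma> \<tau> \<eta> assume "(\<sigma>, \<tau>, \<eta>) \<in> set Ps"
      from Ps(4)[OF this] obtain a where a: "a \<in> A" "\<sigma> \<subseteq> seg_pt (corner (fst a) (snd a)) (dir (fst a)) ` {0..real (l (fst a)) * \<delta>}" by blast
      then show "\<sigma> \<subseteq> cube" using seg_subset_cube[of "fst a" "snd a"] by (simp add: lA)
    qed
  qed
qed

text \<open>Unit axis vectors have \<open>simple_vec_norm\<close> 1, so a competing form has
  components of modulus at most 1 along every segment. The components are estimated separately,
  which leads to the l1 norms of the coefficients that \<open>var\<close> controls.\<close>

lemma block_mass:
  assumes P: "\<And>j \<omega>. (\<And>v. continuous_on UNIV (\<lambda>x. \<omega> x v)) \<Longrightarrow> P j \<omega> = c * (\<Sum>t\<in>{u..<v}. form_step t j \<omega>)"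
    and c: "\<bar>c\<bar> = 1"
  shows "mass 1 P \<le> ennreal (\<Sum>t\<in>{u..<v}. var * len t)"
  unfolding mass_def
proof (rule SUP_least, clarify)
  fix \<omega> :: "'m \<Rightarrow> 'n form"
  assume \<omega>: "\<forall>j. test_form 1 (\<omega> j)" and n: "\<forall>x v. simple_vec_norm 1 v \<le> 1 \<longrightarrow> norm (\<chi> j. \<omega> j x v) \<le> 1"
  have cont: "continuous_on UNIV (\<lambda>x. \<omega> j x v)" for j v using \<omega> test_form_continuous by blast
  have b: "\<bar>\<omega> j x (\<lambda>_. axis i 1)\<bar> \<le> 1" for j x i
  proof -
    have "norm (\<chi> j. \<omega> j x (\<lambda>_. axis i 1)) \<le> 1" using n by (simp add: simple_vec_norm_1[unfolded One_nat_def] norm_axis_1)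
    then show ?thesis using component_le_norm_cart[of "\<chi> j. \<omega> j x (\<lambda>_. axis i 1)" j] by simp
  qed
  have fs: "\<bar>form_step t j (\<omega> j)\<bar> \<le> (\<Sum>k<2 ^ t. \<bar>wt t k $ j\<bar> * len t)" for t j
    unfolding form_step_def
  proof (intro order_trans[OF sum_abs sum_mono])
    fix k
    have "\<bar>seg_integral (corner t k) (dir t) (len t) (\<lambda>x. \<omega> j x (\<lambda>_. axis (dir t) 1))\<bar> \<le> 1 * len t"
      using len_pos[of t] by (intro seg_integral_bound cont b) simp
    then show "\<bar>wt t k $ j * seg_integral (corner t k) (dir t) (len t) (\<lambda>x. \<omega> j x (\<lambda>_. axis (dir t) 1))\<bar> \<le> \<bar>wt t k $ j\<bar> * len t"
      by (simp add: abs_mult mult_left_mono)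
  qed
  have "current_apply P \<omega> = c * (\<Sum>t\<in>{u..<v}. \<Sum>j\<in>UNIV. form_step t j (\<omega> j))"
    unfolding current_apply_def by (simp add: P[OF cont] sum_distrib_left[symmetric]) (subst sum.swap, simp)
  then have "\<bar>current_apply P \<omega>\<bar> = \<bar>\<Sum>t\<in>{u..<v}. \<Sum>j\<in>UNIV. form_step t j (\<omega> j)\<bar>" using c by (simp add: abs_mult)
  also have "\<dots> \<le> (\<Sum>t\<in>{u..<v}. var * len t)"
  proof (intro order_trans[OF sum_abs sum_mono])
    fix t
    have "\<bar>\<Sum>j\<in>UNIV. form_step t j (\<omega> j)\<bar> \<le> (\<Sum>j\<in>UNIV. \<Sum>k<2 ^ t. \<bar>wt t k $ j\<bar> * len t)"
      by (intro order_trans[OF sum_abs sum_mono] fs)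
    also have "\<dots> = (\<Sum>k<2 ^ t. \<Sum>j\<in>UNIV. \<bar>wt t k $ j\<bar>) * len t"
      by (subst sum.swap) (simp add: sum_distrib_right)
    also have "\<dots> \<le> var * len t" using var(2) len_pos[of t] by (intro mult_right_mono) auto
    finally show "\<bar>\<Sum>j\<in>UNIV. form_step t j (\<omega> j)\<bar> \<le> var * len t" .
  qed
  finally show "ennreal \<bar>current_apply P \<omega>\<bar> \<le> ennreal (\<Sum>t\<in>{u..<v}. var * len t)" by (rule ennreal_leI)
qed

definition tail :: "nat \<Rightarrow> real" where "tail h = (\<Sum>t. var * len (t + h))"

lemma summable_var_len: "summable (\<lambda>t. var * len t)"
  by (intro summable_mult summable_len)

lemma tail_LIMSEQ: "tail \<longlonglongrightarrow> 0"
  unfolding tail_def by (rule suminf_exist_split2[OF summable_var_len])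

lemma sum_le_tail: "(\<Sum>t\<in>{u..<v}. var * len t) \<le> tail u"
proof -
  have "(\<Sum>t\<in>{u..<v}. var * len t) = (\<Sum>t<v - u. var * len (t + u))"
    by (subst sum.atLeastLessThan_shift_0) (simp add: lessThan_atLeast0 add.commute)
  also have "\<dots> \<le> tail u" unfolding tail_def
    using summable_var_len var(1) len_pos
    by (intro sum_le_suminf) (auto simp: summable_iff_shift[where f = "\<lambda>t. var * len t"] intro: mult_nonneg_nonneg less_imp_le)
  finally show ?thesis .
qed

text \<open>P minus the flux is the limit of minus the steps h, ..., h+a-1 as a grows. These sums
  and their differences are realised by \<open>block\<close> as polyhedral currents, so their flat
  norms are at most their masses, hence at most a tail.\<close>

lemma flat_norm_tail:
  assumes P: "\<And>j \<omega>. (\<And>v. continuous_on UNIV (\<lambda>x. \<omega> x v)) \<Longrightarrow> P j \<omega> = (\<Sum>t<h. form_step t j \<omega>)"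
  shows "flat_norm 1 (current_minus P (measure_current flux)) \<le> ennreal (tail h)"
proof -
  \<comment> \<open>The zero cost meets the hypotheses of \<open>block\<close>; only the currents
    matter here.\<close>
  have bl: "\<exists>Ps. polyhedral_data 1 Ps \<and> (\<forall>j \<omega>. (\<forall>v. continuous_on UNIV (\<lambda>x. \<omega> x v)) \<longrightarrow>
        polyhedral_current 1 Ps j \<omega> = c * (\<Sum>t\<in>{u..<v}. form_step t j \<omega>))" if "c = 1 \<or> c = - 1" for c u v
    by (rule block[of "\<lambda>_. 0" c u v]) (use that in auto)
  have ex: "\<exists>R. polyhedral 1 R \<and> (\<forall>j \<omega>. (\<forall>v. continuous_on UNIV (\<lambda>x. \<omega> x v)) \<longrightarrow>
        R j \<omega> = c * (\<Sum>t\<in>{u..<v}. form_step t j \<omega>)) \<and> mass 1 R \<le> ennreal (tail u)" if c: "c = 1 \<or> c = - 1" for c u v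
  proof -
    obtain Ps where Ps: "polyhedral_data 1 Ps" "\<And>j \<omega>. (\<And>v. continuous_on UNIV (\<lambda>x. \<omega> x v)) \<Longrightarrow>
        polyhedral_current 1 Ps j \<omega> = c * (\<Sum>t\<in>{u..<v}. form_step t j \<omega>)"
      using bl[OF c, of u v] by blast
    have "mass 1 (polyhedral_current 1 Ps) \<le> ennreal (\<Sum>t\<in>{u..<v}. var * len t)"
      by (rule block_mass[OF Ps(2)]) (use c in auto)
    also have "\<dots> \<le> ennreal (tail u)" by (intro ennreal_leI sum_le_tail)
    finally show ?thesis using Ps unfolding polyhedral_def by blast
  qed
  have "\<forall>a. \<exists>R. polyhedral 1 R \<and> (\<forall>j \<omega>. (\<forall>v. continuous_on UNIV (\<lambda>x. \<omega> x v)) \<longrightarrow>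
        R j \<omega> = - 1 * (\<Sum>t\<in>{h..<h + a}. form_step t j \<omega>)) \<and> mass 1 R \<le> ennreal (tail h)"
    by (intro allI ex) simp
  from choice[OF this] obtain Q where Q0: "\<And>a. polyhedral 1 (Q a) \<and> (\<forall>j \<omega>. (\<forall>v. continuous_on UNIV (\<lambda>x. \<omega> x v)) \<longrightarrow>
        Q a j \<omega> = - 1 * (\<Sum>t\<in>{h..<h + a}. form_step t j \<omega>)) \<and> mass 1 (Q a) \<le> ennreal (tail h)"
    by blast
  have Q: "polyhedral 1 (Q a)"
    "(\<And>v. continuous_on UNIV (\<lambda>x. \<omega> x v)) \<Longrightarrow> Q a j \<omega> = - 1 * (\<Sum>t\<in>{h..<h + a}. form_step t j \<omega>)"
    "mass 1 (Q a) \<le> ennreal (tail h)" for a j \<omega>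
    using Q0[of a] by blast+
  have diff: "poly_flat_norm 1 (current_minus (Q a) (Q b)) \<le> ennreal (tail (h + min a b))" for a b
  proof -
    \<comment> \<open>\<open>Q a\<close> is minus a partial sum, so for a below b the difference of
      \<open>Q a\<close> and \<open>Q b\<close> is plus the steps in between.\<close>
    define c :: real where "c = (if a \<le> b then 1 else - 1)"
    have c: "c = 1 \<or> c = - 1" by (simp add: c_def)
    obtain R where R: "polyhedral 1 R" "\<And>j \<omega>. (\<And>v. continuous_on UNIV (\<lambda>x. \<omega> x v)) \<Longrightarrow>
        R j \<omega> = c * (\<Sum>t\<in>{h + min a b..<h + max a b}. form_step t j \<omega>)" "mass 1 R \<le> ennreal (tail (h + min a b))"
      using ex[OF c, of "h + min a b" "h + max a b"] by blast
    have "current_minus (Q a) (Q b) j \<omega> = R j \<omega>" if \<omega>: "test_form 1 \<omega>" for j \<omega>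
    proof -
      note cont = test_form_continuous[OF \<omega>]
      have "(\<Sum>t\<in>{h..<h + max a b}. form_step t j \<omega>) =
          (\<Sum>t\<in>{h..<h + min a b}. form_step t j \<omega>) + (\<Sum>t\<in>{h + min a b..<h + max a b}. form_step t j \<omega>)"
        by (rule sum.atLeastLessThan_concat[symmetric]) auto
      then show ?thesis
        unfolding current_minus_def Q(2)[OF cont] R(2)[OF cont] by (cases "a \<le> b") (auto simp: c_def max_def min_def)
    qed
    then have "poly_flat_norm 1 (current_minus (Q a) (Q b)) \<le> mass 1 R" by (intro poly_flat_norm_le_mass R(1))
    with R(3) show ?thesis by (rule order_trans[rotated])
  qed
  have "flat_approx 1 Q (current_minus P (measure_current flux))"
    unfolding flat_approx_def
  proof (intro conjI allI impI)
    fix \<epsilon> :: real assume \<epsilon>: "0 < \<epsilon>"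
    obtain N where N: "\<And>u. u \<ge> N \<Longrightarrow> tail u < \<epsilon>"
      using order_tendstoD(2)[OF tail_LIMSEQ \<epsilon>] by (auto simp: eventually_sequentially)
    have "poly_flat_norm 1 (current_minus (Q a) (Q b)) < ennreal \<epsilon>" if "N \<le> a" "N \<le> b" for a b
    proof -
      have "tail (h + min a b) < \<epsilon>" using that by (intro N) auto
      then have "ennreal (tail (h + min a b)) < ennreal \<epsilon>" using \<epsilon> by (simp add: ennreal_less_iff ennreal_lessI)
      with diff[of a b] show ?thesis by (rule le_less_trans)
    qed
    then show "\<exists>N. \<forall>a\<ge>N. \<forall>b\<ge>N. poly_flat_norm 1 (current_minus (Q a) (Q b)) < ennreal \<epsilon>" by blast
  next
    fix j and \<omega> :: "'n form" assume \<omega>: "test_form 1 \<omega>"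
    note cont = test_form_continuous[OF \<omega>]
    have "(\<lambda>a. \<Sum>u<a + h. form_step u j \<omega>) \<longlonglongrightarrow> measure_current flux j \<omega>"
      by (rule LIMSEQ_ignore_initial_segment[OF flux_current_limit[OF \<omega>]])
    then have "(\<lambda>a. P j \<omega> - (\<Sum>u<a + h. form_step u j \<omega>)) \<longlonglongrightarrow> P j \<omega> - measure_current flux j \<omega>"
      by (intro tendsto_diff tendsto_const)
    moreover have "P j \<omega> - (\<Sum>u<a + h. form_step u j \<omega>) = Q a j \<omega>" for a
    proof -
      have "(\<Sum>u<a + h. form_step u j \<omega>) = (\<Sum>u<h. form_step u j \<omega>) + (\<Sum>u\<in>{h..<h + a}. form_step u j \<omega>)"
        unfolding lessThan_atLeast0 add.commute[of a] by (rule sum.atLeastLessThan_concat[symmetric]) auto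
      then show ?thesis unfolding Q(2)[OF cont] P[OF cont] by simp
    qed
    ultimately show "(\<lambda>a. Q a j \<omega>) \<longlonglongrightarrow> current_minus P (measure_current flux) j \<omega>"
      by (simp add: current_minus_def)
  qed (rule Q(1))
  moreover have "poly_flat_norm 1 (Q a) \<le> ennreal (tail h)" for a
    by (rule order_trans[OF poly_flat_norm_le_mass[OF Q(1) refl] Q(3)])
  ultimately show ?thesis by (rule flat_norm_le)
qed

section \<open>Finite energy\<close>

lemma summable_cost:
  fixes C :: "real ^ 'm \<Rightarrow> real"
  assumes C: "transportation_cost C" and adm: "admissible_cost CARD('n) C"
  shows "summable (\<lambda>t. \<Sum>k<2 ^ t. C (wt t k) * len t)"
proof -
  obtain \<beta> :: "real \<Rightarrow> real" where \<beta>: "concave_on {0..} \<beta>" "mono_on {0..} \<beta>" "\<And>x. 0 \<le> x \<Longrightarrow> 0 \<le> \<beta> x"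
    "\<And>x. 0 \<le> x \<Longrightarrow> C (\<chi> j. x) \<le> \<beta> x"
    "(\<integral>\<^sup>+x\<in>{0<..<1}. ennreal (\<beta> x * x powr (- (2 - 1 / real CARD('n)))) \<partial>lborel) < \<infinity>"
    using adm unfolding admissible_cost_def by auto
  have S: "summable (\<lambda>t. 2 * real B * (2 ^ t * \<beta> (var / 2 ^ t) * (1/2) ^ (t div CARD('n))))"
    by (intro summable_mult admissible_summable \<beta> var(1)) auto
  show ?thesis
  proof (rule summable_comparison_test'[OF S])
    fix t :: nat
    have C0: "0 \<le> C \<theta>" for \<theta> using C by (simp add: transportation_cost_def)
    have "(\<Sum>k<2 ^ t. C (wt t k)) \<le> (\<Sum>k<2 ^ t. 2 * \<beta> (\<Sum>j\<in>UNIV. \<bar>wt t k $ j\<bar>))"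
      by (intro sum_mono transportation_cost_le[OF C \<beta>(4)])
    also have "\<dots> = 2 * (\<Sum>k<2 ^ t. \<beta> (\<Sum>j\<in>UNIV. \<bar>wt t k $ j\<bar>))" by (simp add: sum_distrib_left)
    also have "\<dots> \<le> 2 * (2 ^ t * \<beta> (var / 2 ^ t))"
      using concave_sum_le[OF \<beta>(1,2), of "{..<2 ^ t}" "\<lambda>k. \<Sum>j\<in>UNIV. \<bar>wt t k $ j\<bar>" var] var(2)[of t]
      by (simp add: sum_nonneg lessThan_empty_iff)
    finally have "(\<Sum>k<2 ^ t. C (wt t k)) * len t \<le> 2 * (2 ^ t * \<beta> (var / 2 ^ t)) * (real B * (1/2) ^ (t div CARD('n)))"
      using len_le[of t] len_pos[of t] \<beta>(3) var(1) by (intro mult_mono) auto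
    moreover have "norm (\<Sum>k<2 ^ t. C (wt t k) * len t) = (\<Sum>k<2 ^ t. C (wt t k)) * len t"
      unfolding sum_distrib_right[symmetric] using C0 len_pos[of t] by (simp add: sum_nonneg)
    ultimately show "norm (\<Sum>k<2 ^ t. C (wt t k) * len t) \<le> 2 * real B * (2 ^ t * \<beta> (var / 2 ^ t) * (1/2) ^ (t div CARD('n)))"
      by (simp only: mult_ac)
  qed
qed

lemma energy_flux:
  fixes C :: "real ^ 'm \<Rightarrow> real"
  assumes C: "transportation_cost C" and adm: "admissible_cost CARD('n) C"
  shows "energy C flux < \<infinity>"
proof -
  have C': "C 0 = 0" "\<And>\<eta> \<theta>. C (\<eta> + \<theta>) \<le> C \<eta> + C \<theta>" "\<And>\<theta>. C (- \<theta>) = C \<theta>" "\<And>\<theta>. 0 \<le> C \<theta>"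
    using C by (auto simp: transportation_cost_def)
  define E where "E = (\<Sum>t. \<Sum>k<2 ^ t. C (wt t k) * len t)"
  have "\<exists>Ps. polyhedral_data 1 Ps \<and> (\<forall>j \<omega>. (\<forall>v. continuous_on UNIV (\<lambda>x. \<omega> x v)) \<longrightarrow>
        polyhedral_current 1 Ps j \<omega> = (\<Sum>t<h. form_step t j \<omega>)) \<and>
      discrete_energy C Ps \<le> E \<and> (\<forall>\<sigma> \<tau> \<eta>. (\<sigma>, \<tau>, \<eta>) \<in> set Ps \<longrightarrow> \<sigma> \<subseteq> cube)" for h
  proof (rule block[OF C'(1,2,3), of 1 0 h])
    fix Ps :: "('n, 'm) piece list"
    assume Ps: "polyhedral_data 1 Ps"
      "\<And>j \<omega>. (\<And>v. continuous_on UNIV (\<lambda>x. \<omega> x v)) \<Longrightarrow> polyhedral_current 1 Ps j \<omega> = 1 * (\<Sum>t\<in>{0..<h}. form_step t j \<omega>)"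
      "discrete_energy C Ps \<le> (\<Sum>t\<in>{0..<h}. \<Sum>k<2 ^ t. C (wt t k) * len t)"
      "\<And>\<sigma> \<tau> \<eta>. (\<sigma>, \<tau>, \<eta>) \<in> set Ps \<Longrightarrow> \<sigma> \<subseteq> cube"
    have "(\<Sum>t\<in>{0..<h}. \<Sum>k<2 ^ t. C (wt t k) * len t) \<le> E"
      unfolding E_def using C'(4)
      by (intro sum_le_suminf summable_cost[OF C adm]) (auto intro!: sum_nonneg mult_nonneg_nonneg less_imp_le[OF len_pos])
    then show ?thesis using Ps
      by (intro exI[of _ Ps]) (auto simp: lessThan_atLeast0)
  qed simp
  then obtain Ps :: "nat \<Rightarrow> ('n, 'm) piece list" where Ps: "\<And>h. polyhedral_data 1 (Ps h)"
    "\<And>h j \<omega>. (\<And>v. continuous_on UNIV (\<lambda>x. \<omega> x v)) \<Longrightarrow> polyhedral_current 1 (Ps h) j \<omega> = (\<Sum>t<h. form_step t j \<omega>)"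
    "\<And>h. discrete_energy C (Ps h) \<le> E" "\<And>h \<sigma> \<tau> \<eta>. (\<sigma>, \<tau>, \<eta>) \<in> set (Ps h) \<Longrightarrow> \<sigma> \<subseteq> cube"
    by metis
  have lim: "(\<lambda>h. flat_norm 1 (current_minus (polyhedral_current 1 (Ps h)) (measure_current flux))) \<longlonglongrightarrow> 0"
  proof (rule tendsto_sandwich[OF _ _ tendsto_const])
    show "(\<lambda>h. ennreal (tail h)) \<longlonglongrightarrow> 0" using tendsto_ennrealI[OF tail_LIMSEQ] by simp
    show "\<forall>\<^sub>F h in sequentially. flat_norm 1 (current_minus (polyhedral_current 1 (Ps h)) (measure_current flux)) \<le> ennreal (tail h)"
      by (intro always_eventually allI flat_norm_tail Ps(2))
  qed simp
  have supp: "\<exists>K. compact K \<and> (\<forall>h. current_support 1 (polyhedral_current 1 (Ps h)) \<subseteq> K)"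
    by (intro exI[of _ cube] conjI allI compact_cube current_support_polyhedral[OF compact_imp_closed[OF compact_cube] Ps(4)])
  have "energy C flux \<le> liminf (\<lambda>h. ennreal (discrete_energy C (Ps h)))"
    unfolding energy_def using Ps(1) lim supp by (intro Inf_lower) blast
  also have "\<dots> \<le> limsup (\<lambda>h. ennreal (discrete_energy C (Ps h)))" by (rule Liminf_le_Limsup) simp
  also have "\<dots> \<le> ennreal E" by (rule Limsup_bounded) (auto intro!: always_eventually ennreal_leI Ps(3))
  also have "\<dots> < \<infinity>" by simp
  finally show ?thesis .
qed

end

section \<open>Reduction to a measure of total mass zero in a cube\<close>

theorem proposition7p4:
  fixes C :: "real ^ 'm \<Rightarrow> real"
    and \<mu>m \<mu>p :: "(real ^ 'n) set \<Rightarrow> real ^ 'm"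
  assumes "CARD('n) \<ge> 2"
    and "transportation_cost C"
    and "admissible_cost CARD('n) C"
    and "vector_measure \<mu>m" and "compact (vm_support \<mu>m)"
    and "vector_measure \<mu>p" and "compact (vm_support \<mu>p)"
    and "compatible \<mu>m \<mu>p"
  shows "\<exists>T :: (real ^ 'n) set \<Rightarrow> real ^ 'm ^ 'n.
           multi_material_flux \<mu>m \<mu>p T \<and> energy C T < \<infinity>"
proof -
  note vm = assms(4,6)
  \<comment> \<open>The order of the difference compensates the minus sign in
    \<open>divergence\<close>.\<close>
  define \<rho> where "\<rho> A = \<mu>p A - \<mu>m A" for A
  have \<rho>: "vector_measure \<rho>" unfolding \<rho>_def by (rule vector_measure_diff[OF vm(2,1)])
  have comp: "vector_measure (\<lambda>A. \<mu> A $ j)" if "vector_measure \<mu>" for \<mu> :: "(real ^ 'n) set \<Rightarrow> real ^ 'm" and j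
    by (rule vector_measure_bounded_linear[OF that bounded_linear_vec_nth])
  have "bounded (vm_support \<mu>m \<union> vm_support \<mu>p)"
    using assms(5,7) by (simp add: compact_imp_bounded)
  then obtain r where r: "\<And>x. x \<in> vm_support \<mu>m \<union> vm_support \<mu>p \<Longrightarrow> norm x \<le> r"
    unfolding bounded_iff by blast
  \<comment> \<open>The strict inequality places both supports inside the half-open root box, and
    the maximum with 0 makes B positive.\<close>
  obtain B :: nat where B: "max r 0 < real B" using reals_Archimedean2 by blast
  obtain e :: "nat \<Rightarrow> 'n" where e: "bij_betw e {..<CARD('n)} UNIV"
    using ex_bij_betw_nat_finite[of "UNIV :: 'n set"] by (auto simp: lessThan_atLeast0)
  interpret kd: kd_tree e B using e B by unfold_locales auto
  have sub: "vm_support \<mu>m \<union> vm_support \<mu>p \<subseteq> kd.dbox 0 0"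
  proof
    fix x assume "x \<in> vm_support \<mu>m \<union> vm_support \<mu>p"
    then have "norm x < real B" using r B by fastforce
    then have "\<bar>x $ i\<bar> < real B" for i using component_le_norm_cart[of x i] by linarith
    then show "x \<in> kd.dbox 0 0" unfolding kd.dbox_0 by (auto simp: abs_less_iff minus_less_iff less_imp_le)
  qed
  have tot: "\<rho> UNIV = 0"
  proof -
    \<comment> \<open>Testing compatibility with the constant unit fields compares the total masses
      component by component.\<close>
    have c: "vm_integral \<mu> (\<lambda>x. axis j 1) = \<mu> UNIV $ j" if "vector_measure \<mu>" for \<mu> :: "(real ^ 'n) set \<Rightarrow> real ^ 'm" and j
    proof -
      have "vm_integral \<mu> (\<lambda>x. axis j 1) = (\<Sum>i\<in>UNIV. axis j 1 $ i * \<mu> UNIV $ i)"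
        by (simp add: vm_integral_vec signed_integral_const[OF comp[OF that]])
      also have "\<dots> = (\<Sum>i\<in>UNIV. if i = j then \<mu> UNIV $ i else 0)" by (intro sum.cong) (auto simp: axis_def)
      finally show ?thesis by simp
    qed
    have "\<mu>m UNIV $ j = \<mu>p UNIV $ j" for j using assms(8) c[OF vm(1)] c[OF vm(2)] by (metis compatible_def)
    then show ?thesis by (simp add: \<rho>_def vec_eq_iff)
  qed
  interpret kd_flux e B \<rho>
  proof unfold_locales
    fix A :: "(real ^ 'n) set" assume A: "A \<in> sets borel" "A \<inter> kd.dbox 0 0 = {}"
    then have "\<mu>m A = 0" "\<mu>p A = 0" using sub vm by (auto intro!: vector_measure_null)
    then show "\<rho> A = 0" by (simp add: \<rho>_def)
  qed (rule \<rho> tot)+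
  have "divergence flux \<phi> = vm_integral \<mu>m \<phi> - vm_integral \<mu>p \<phi>"
    if \<phi>: "smooth \<phi>" "compact (closure {x. \<phi> x \<noteq> 0})" for \<phi>
  proof -
    have "signed_integral (\<lambda>A. \<rho> A $ j) (\<lambda>x. \<phi> x $ j) =
        signed_integral (\<lambda>A. \<mu>p A $ j) (\<lambda>x. \<phi> x $ j) - signed_integral (\<lambda>A. \<mu>m A $ j) (\<lambda>x. \<phi> x $ j)" for j
    proof -
      have c: "continuous_on UNIV (\<lambda>x. \<phi> x $ j)"
        by (intro continuous_on_component smooth_jacobian(2)[OF \<phi>(1)])
      have off: "\<phi> x $ j = 0" if "x \<notin> closure {x. \<phi> x \<noteq> 0}" for x
      proof -
        have "\<phi> x = 0" using that closure_subset[of "{x. \<phi> x \<noteq> 0}"] by blast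
        then show ?thesis by simp
      qed
      obtain L where L: "\<And>x. \<bar>\<phi> x $ j\<bar> \<le> L"
        using bounded_compact_support[OF c \<phi>(2) off] by blast
      have "signed_integral (\<lambda>A. \<rho> A $ j) (\<lambda>x. \<phi> x $ j) =
        (\<Sum>a\<in>UNIV. (if a then 1 else -1) * signed_integral (\<lambda>A. (if a then \<mu>p else \<mu>m) A $ j) (\<lambda>x. \<phi> x $ j))"
        by (rule signed_integral_lincomb[OF _ _ comp[OF \<rho>] _ borel_measurable_continuous_onI[OF c] L])
           (auto simp: UNIV_bool \<rho>_def vm comp)
      then show ?thesis by (simp add: UNIV_bool)
    qed
    then show ?thesis unfolding flux_divergence[OF \<phi>] by (simp add: vm_integral_vec sum_subtractf)
  qed
  then have "multi_material_flux \<mu>m \<mu>p flux"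
    unfolding multi_material_flux_def using vector_measure_flux flux_support(2) by blast
  with energy_flux[OF assms(2,3)] show ?thesis by blast
qed

end
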